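(* Let $\Omega\subset\mathbb{R}^n$ be open and uniformly convex. Let $f\in C^0(\bar\Omega\times\mathbb{R}\times\mathbb{R}^n)$ be non-negative and non-decreasing in its second argument, and suppose that for every $R>0$ there exists a constant $C_R\ge 0$ such that $|f^{1/n}(x,s,p)-f^{1/n}(x,s,q)|\le C_R|p-q|$ for every $x\in\bar\Omega$, $|s|\le R$, and $|p|,|q|\le R$. Let $g:\partial\Omega\to\mathbb{R}$ and suppose that there exists a viscosity solution $u\in C^{0,1}(\bar\Omega)$ of the generalised Dirichlet problem for the Monge-Amp\`ere equation with right-hand side $f$ and boundary data $g$ that satisfies $u(x)=g(x)$ for every $x\in\partial\Omega$. Let $v$ be any viscosity subsolution and $w$ any viscosity supersolution of this generalised Dirichlet problem. Then $v\le w$ on $\bar\Omega$.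
   Context: Uniform convexity of $\Omega$: $\Omega$ is convex and there is $\alpha>0$ such that for every $x_0\in\partial\Omega$ and every unit outward normal $n$ to a supporting hyperplane of $\Omega$ at $x_0$, one has $(x-x_0)\cdot n\le -\alpha|x-x_0|^2$ for all $x\in\bar\Omega$ (in particular $\Omega$ is bounded). Modified determinant: let $\mathcal{S}^n$ be the real symmetric $n\times n$ matrices. ${\det}^+:\mathcal{S}^n\to\mathbb{R}$ is a fixed continuous function, non-decreasing with respect to the usual order on $\mathcal{S}^n$, with ${\det}^+(X)=\det(X)$ if $X\ge 0$ (positive semidefinite) and ${\det}^+(X)<0$ otherwise. Generalised Dirichlet problem for the Monge-Amp\`ere equation: it is the equation $F(x,u,\nabla u,D^2u)=0$ on $\bar\Omega$, where $F(x,s,p,X)=-{\det}^+(X)+f(x,s,p)$ for $x\in\Omega$ and $F(x,s,p,X)=s-g(x)$ for $x\in\partial\Omega$. Its lower and upper semicontinuous envelopes are $F_*(x,s,p,X)=F^*(x,s,p,X)=-{\det}^+(X)+f(x,s,p)$ for $x\in\Omega$, and, for $x\in\partial\Omega$, $F_*(x,s,p,X)=\min\{s-g(x),\,-{\det}^+(X)+f(x,s,p)\}$ and $F^*(x,s,p,X)=\max\{s-g(x),\,-{\det}^+(X)+f(x,s,p)\}$. An upper semicontinuous function $v:\bar\Omega\to\mathbb{R}$ is a viscosity subsolution if for every $\phi\in C^2(\bar\Omega)$ and every $x\in\bar\Omega$ at which $v-\phi$ has a local maximum (relative to $\bar\Omega$), $F_*(x,v(x),\nabla\phi(x),D^2\phi(x))\le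 0$. A lower semicontinuous function $w:\bar\Omega\to\mathbb{R}$ is a viscosity supersolution if for every $\phi\in C^2(\bar\Omega)$ and every $x\in\bar\Omega$ at which $w-\phi$ has a local minimum (relative to $\bar\Omega$), $F^*(x,w(x),\nabla\phi(x),D^2\phi(x))\ge 0$. A function $u$ on $\bar\Omega$ is a viscosity solution if its upper semicontinuous envelope $u^*(x)=\limsup_{y\to x}u(y)$ is a subsolution and its lower semicontinuous envelope $u_*(x)=\liminf_{y\to x}u(y)$ is a supersolution (for continuous $u$, $u^*=u_*=u$). *)

theory Defs
  imports "HOL-Analysis.Analysis"
begin

text \<open>
  Boundedness is stated separately in \<open>uniformly_convex\<close>: it follows from the inequality only when
  the frontier is nonempty, and without it the whole space would satisfy the condition vacuously.
\<close>

definition outward_normal :: "'a::euclidean_space set \<Rightarrow> 'a \<Rightarrow> 'a \<Rightarrow> bool" where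
  "outward_normal \<Omega> x0 \<nu> \<longleftrightarrow> norm \<nu> = 1 \<and> (\<forall>x\<in>closure \<Omega>. (x - x0) \<bullet> \<nu> \<le> 0)"

definition uniformly_convex :: "'a::euclidean_space set \<Rightarrow> bool" where
  "uniformly_convex \<Omega> \<longleftrightarrow> convex \<Omega> \<and> bounded \<Omega> \<and>
     (\<exists>\<alpha>>0. \<forall>x0\<in>frontier \<Omega>. \<forall>\<nu>. outward_normal \<Omega> x0 \<nu> \<longrightarrow>
        (\<forall>x\<in>closure \<Omega>. (x - x0) \<bullet> \<nu> \<le> - \<alpha> * (norm (x - x0))\<^sup>2))"

definition sym_matrices :: "(real^'n^'n) set" where
  "sym_matrices = {X. transpose X = X}"

definition psd :: "real^'n^'n \<Rightarrow> bool" where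
  "psd X \<longleftrightarrow> X \<in> sym_matrices \<and> (\<forall>\<xi>. 0 \<le> \<xi> \<bullet> (X *v \<xi>))"

definition modified_det :: "(real^'n^'n \<Rightarrow> real) \<Rightarrow> bool" where
  "modified_det detp \<longleftrightarrow>
     continuous_on sym_matrices detp \<and>
     (\<forall>X\<in>sym_matrices. \<forall>Y\<in>sym_matrices. psd (Y - X) \<longrightarrow> detp X \<le> detp Y) \<and>
     (\<forall>X. psd X \<longrightarrow> detp X = det X) \<and>
     (\<forall>X\<in>sym_matrices. \<not> psd X \<longrightarrow> detp X < 0)"

text \<open>
  Semicontinuous envelopes relative to a set \<open>S\<close>; the limits are taken over all \<open>y \<in> S\<close> tending
  to \<open>x\<close>, including \<open>y = x\<close>. They may be infinite.
\<close>

definition usc_env :: "'a::topological_space set \<Rightarrow> ('a \<Rightarrow> real) \<Rightarrow> 'a \<Rightarrow> ereal" where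
  "usc_env S u x = Limsup (inf (nhds x) (principal S)) (\<lambda>y. ereal (u y))"

definition lsc_env :: "'a::topological_space set \<Rightarrow> ('a \<Rightarrow> real) \<Rightarrow> 'a \<Rightarrow> ereal" where
  "lsc_env S u x = Liminf (inf (nhds x) (principal S)) (\<lambda>y. ereal (u y))"

definition usc_on :: "'a::topological_space set \<Rightarrow> ('a \<Rightarrow> real) \<Rightarrow> bool" where
  "usc_on S v \<longleftrightarrow> (\<forall>x\<in>S. \<forall>c>v x. \<forall>\<^sub>F y in at x within S. v y < c)"

definition lsc_on :: "'a::topological_space set \<Rightarrow> ('a \<Rightarrow> real) \<Rightarrow> bool" where
  "lsc_on S w \<longleftrightarrow> (\<forall>x\<in>S. \<forall>c<w x. \<forall>\<^sub>F y in at x within S. c < w y)"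

text \<open>
  The operator of the generalised Dirichlet problem and its envelopes. The explicit formulas for
  the envelopes are the usual ones; they agree with \<open>lsc_env\<close> and \<open>usc_env\<close> of the operator
  whenever the data are continuous (\<open>lsc_env_MA_op\<close> and \<open>usc_env_MA_op\<close> below).
\<close>

definition MA_op :: "(real^'n^'n \<Rightarrow> real) \<Rightarrow> (real^'n) set \<Rightarrow>
    (real^'n \<Rightarrow> real \<Rightarrow> real^'n \<Rightarrow> real) \<Rightarrow> (real^'n \<Rightarrow> real) \<Rightarrow>
    real^'n \<Rightarrow> real \<Rightarrow> real^'n \<Rightarrow> real^'n^'n \<Rightarrow> real" where
  "MA_op detp \<Omega> f g x s p X = (if x \<in> \<Omega> then - detp X + f x s p else s - g x)"

definition MA_op_lower :: "(real^'n^'n \<Rightarrow> real) \<Rightarrow> (real^'n) set \<Rightarrow>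
    (real^'n \<Rightarrow> real \<Rightarrow> real^'n \<Rightarrow> real) \<Rightarrow> (real^'n \<Rightarrow> real) \<Rightarrow>
    real^'n \<Rightarrow> real \<Rightarrow> real^'n \<Rightarrow> real^'n^'n \<Rightarrow> real" where
  "MA_op_lower detp \<Omega> f g x s p X =
     (if x \<in> \<Omega> then - detp X + f x s p else min (s - g x) (- detp X + f x s p))"

definition MA_op_upper :: "(real^'n^'n \<Rightarrow> real) \<Rightarrow> (real^'n) set \<Rightarrow>
    (real^'n \<Rightarrow> real \<Rightarrow> real^'n \<Rightarrow> real) \<Rightarrow> (real^'n \<Rightarrow> real) \<Rightarrow>
    real^'n \<Rightarrow> real \<Rightarrow> real^'n \<Rightarrow> real^'n^'n \<Rightarrow> real" where
  "MA_op_upper detp \<Omega> f g x s p X =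
     (if x \<in> \<Omega> then - detp X + f x s p else max (s - g x) (- detp X + f x s p))"

text \<open>
  \<open>C2_closure \<Omega> \<phi> G H\<close>: \<open>\<phi>\<close> is of class \<open>C\<^sup>2\<close> up to the boundary of the open set \<open>\<Omega>\<close>, i.e. it is
  \<open>C\<^sup>2\<close> in \<open>\<Omega>\<close> and \<open>\<phi>\<close>, its gradient and its Hessian extend continuously to the closure. \<open>G\<close> and
  \<open>H\<close> are these extensions, so they are uniquely determined by \<open>\<phi>\<close> on the closure and give the
  meaning of the gradient and the Hessian at frontier points.
\<close>

definition C2_closure :: "(real^'n) set \<Rightarrow> (real^'n \<Rightarrow> real) \<Rightarrow> (real^'n \<Rightarrow> real^'n) \<Rightarrow>
    (real^'n \<Rightarrow> real^'n^'n) \<Rightarrow> bool" where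
  "C2_closure \<Omega> \<phi> G H \<longleftrightarrow>
     continuous_on (closure \<Omega>) \<phi> \<and> continuous_on (closure \<Omega>) G \<and> continuous_on (closure \<Omega>) H \<and>
     (\<forall>x\<in>\<Omega>. GDERIV \<phi> x :> G x \<and> (G has_derivative (\<lambda>h. H x *v h)) (at x))"

definition viscosity_subsolution :: "(real^'n^'n \<Rightarrow> real) \<Rightarrow> (real^'n) set \<Rightarrow>
    (real^'n \<Rightarrow> real \<Rightarrow> real^'n \<Rightarrow> real) \<Rightarrow> (real^'n \<Rightarrow> real) \<Rightarrow> (real^'n \<Rightarrow> real) \<Rightarrow> bool" where
  "viscosity_subsolution detp \<Omega> f g v \<longleftrightarrow>
     usc_on (closure \<Omega>) v \<and>
     (\<forall>\<phi> G H. C2_closure \<Omega> \<phi> G H \<longrightarrow>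
        (\<forall>x\<in>closure \<Omega>.
           (\<forall>\<^sub>F y in at x within closure \<Omega>. v y - \<phi> y \<le> v x - \<phi> x) \<longrightarrow>
           MA_op_lower detp \<Omega> f g x (v x) (G x) (H x) \<le> 0))"

definition viscosity_supersolution :: "(real^'n^'n \<Rightarrow> real) \<Rightarrow> (real^'n) set \<Rightarrow>
    (real^'n \<Rightarrow> real \<Rightarrow> real^'n \<Rightarrow> real) \<Rightarrow> (real^'n \<Rightarrow> real) \<Rightarrow> (real^'n \<Rightarrow> real) \<Rightarrow> bool" where
  "viscosity_supersolution detp \<Omega> f g w \<longleftrightarrow>
     lsc_on (closure \<Omega>) w \<and>
     (\<forall>\<phi> G H. C2_closure \<Omega> \<phi> G H \<longrightarrow>
        (\<forall>x\<in>closure \<Omega>.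
           (\<forall>\<^sub>F y in at x within closure \<Omega>. w x - \<phi> x \<le> w y - \<phi> y) \<longrightarrow>
           0 \<le> MA_op_upper detp \<Omega> f g x (w x) (G x) (H x)))"

text \<open>The envelopes of a solution are required to be finite on the closure.\<close>

definition viscosity_solution :: "(real^'n^'n \<Rightarrow> real) \<Rightarrow> (real^'n) set \<Rightarrow>
    (real^'n \<Rightarrow> real \<Rightarrow> real^'n \<Rightarrow> real) \<Rightarrow> (real^'n \<Rightarrow> real) \<Rightarrow> (real^'n \<Rightarrow> real) \<Rightarrow> bool" where
  "viscosity_solution detp \<Omega> f g u \<longleftrightarrow>
     (\<exists>v w. (\<forall>x\<in>closure \<Omega>. usc_env (closure \<Omega>) u x = ereal (v x)) \<and>
            (\<forall>x\<in>closure \<Omega>. lsc_env (closure \<Omega>) u x = ereal (w x)) \<and>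
            viscosity_subsolution detp \<Omega> f g v \<and>
            viscosity_supersolution detp \<Omega> f g w)"


lemma Liminf_sup_filter:
  fixes X :: "'a \<Rightarrow> ereal"
  shows "Liminf (sup F G) X = min (Liminf F X) (Liminf G X)"
proof -
  have "C \<le> Liminf (sup F G) X \<longleftrightarrow> C \<le> min (Liminf F X) (Liminf G X)" for C
    by (auto simp: le_Liminf_iff eventually_sup)
  then show ?thesis by (meson antisym order_refl)
qed

lemma env_continuous:
  fixes A :: "'a::first_countable_topology \<Rightarrow> real"
  assumes "continuous_on T A" "S \<subseteq> T" "z \<in> T" "z \<in> closure S" "\<And>y. y \<in> S \<Longrightarrow> B y = A y"
  shows "lsc_env S B z = ereal (A z)"
proof -
  let ?F = "inf (nhds z) (principal S)"
  have nt: "?F \<noteq> bot"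
  proof
    assume "?F = bot"
    then have "eventually (\<lambda>y. False) ?F" by simp
    then have "eventually (\<lambda>y. y \<notin> S) (nhds z)"
      by (simp add: eventually_inf_principal)
    then obtain U where "open U" "z \<in> U" "\<forall>y\<in>U. y \<notin> S"
      by (auto simp: eventually_nhds)
    then show False using assms(4) by (auto simp: closure_iff_nhds_not_empty)
  qed
  have "(A \<longlongrightarrow> A z) (inf (nhds z) (principal T))"
  proof (rule topological_tendstoI)
    fix O' :: "real set" assume O: "open O'" "A z \<in> O'"
    have "(A \<longlongrightarrow> A z) (at z within T)"
      using assms(1,3) by (simp add: continuous_on_def)
    then have "eventually (\<lambda>y. A y \<in> O') (at z within T)" using O by (rule topological_tendstoD)
    then have "eventually (\<lambda>y. y \<noteq> z \<longrightarrow> y \<in> T \<longrightarrow> A y \<in> O') (nhds z)"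
      by (simp add: eventually_at_filter)
    then show "eventually (\<lambda>y. A y \<in> O') (inf (nhds z) (principal T))"
      unfolding eventually_inf_principal by (rule eventually_mono) (use O in auto)
  qed
  then have "(A \<longlongrightarrow> A z) ?F"
    by (rule tendsto_mono[rotated]) (use assms(2) in \<open>simp add: le_infI2\<close>)
  moreover have "eventually (\<lambda>y. A y = B y) ?F"
    using assms(5) by (auto simp: eventually_inf_principal)
  ultimately have "(B \<longlongrightarrow> A z) ?F" by (rule Lim_transform_eventually)
  then have "((\<lambda>y. ereal (B y)) \<longlongrightarrow> ereal (A z)) ?F" by simp
  then show ?thesis unfolding lsc_env_def by (rule lim_imp_Liminf[OF nt])
qed

lemma usc_env_eq: "usc_env S u x = - lsc_env S (\<lambda>y. - u y) x"
  unfolding usc_env_def lsc_env_def by (simp add: ereal_Liminf_uminus flip: uminus_ereal.simps(1))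

lemma lsc_env_piecewise:
  fixes A B :: "'a::first_countable_topology \<Rightarrow> 'b::first_countable_topology \<Rightarrow> real"
    and \<Omega> :: "'a set"
  assumes \<Omega>: "open \<Omega>" and x: "x \<in> closure \<Omega>" and c: "c \<in> C"
    and A: "continuous_on (closure \<Omega> \<times> C) (\<lambda>(x, c). A x c)"
    and B: "continuous_on (frontier \<Omega> \<times> C) (\<lambda>(x, c). B x c)"
  shows "lsc_env (closure \<Omega> \<times> C) (\<lambda>(x, c). if x \<in> \<Omega> then A x c else B x c) (x, c) =
           ereal (if x \<in> \<Omega> then A x c else min (B x c) (A x c))"
proof -
  let ?P = "\<lambda>(x, c). if x \<in> \<Omega> then A x c else B x c"
  let ?N = "nhds (x, c)"
  have fr: "frontier \<Omega> = closure \<Omega> - \<Omega>"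
    using \<Omega> by (simp add: frontier_def interior_open)
  have xc: "(x, c) \<in> closure (\<Omega> \<times> C)"
    using x c closure_subset[of C] by (auto simp: closure_Times)
  have 1: "lsc_env (\<Omega> \<times> C) ?P (x, c) = ereal (A x c)"
  proof -
    have "\<Omega> \<times> C \<subseteq> closure \<Omega> \<times> C" using closure_subset[of \<Omega>] by auto
    then show ?thesis
      using env_continuous[OF A, of "\<Omega> \<times> C" "(x, c)" ?P] xc x c by auto
  qed
  show ?thesis
  proof (cases "x \<in> \<Omega>")
    case True
    have "open (\<Omega> \<times> (UNIV :: 'b set))" using \<Omega> by (intro open_Times) auto
    then have "eventually (\<lambda>y. y \<in> \<Omega> \<times> UNIV) ?N"
      using True by (intro eventually_nhds_in_open) auto
    then have ev: "eventually (\<lambda>y. y \<in> closure \<Omega> \<times> C \<longleftrightarrow> y \<in> \<Omega> \<times> C) ?N"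
      by (rule eventually_mono) (use closure_subset[of \<Omega>] in auto)
    have "inf ?N (principal (closure \<Omega> \<times> C)) = inf ?N (principal (\<Omega> \<times> C))"
    proof (rule filter_eq_iff[THEN iffD2], intro allI iffI)
      fix P
      assume "eventually P (inf ?N (principal (closure \<Omega> \<times> C)))"
      then show "eventually P (inf ?N (principal (\<Omega> \<times> C)))"
        unfolding eventually_inf_principal using ev by eventually_elim auto
    next
      fix P
      assume "eventually P (inf ?N (principal (\<Omega> \<times> C)))"
      then show "eventually P (inf ?N (principal (closure \<Omega> \<times> C)))"
        unfolding eventually_inf_principal using ev by eventually_elim auto
    qed
    then show ?thesis using 1 True by (simp add: lsc_env_def)
  next
    case False
    then have xf: "x \<in> frontier \<Omega>" using x fr by simp
    have 2: "lsc_env (frontier \<Omega> \<times> C) ?P (x, c) = ereal (B x c)"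
      using env_continuous[OF B, of "frontier \<Omega> \<times> C" "(x, c)" ?P] xf c fr
        closure_subset[of "frontier \<Omega> \<times> C"]
      by (auto split: prod.splits)
    have "closure \<Omega> \<times> C = (\<Omega> \<times> C) \<union> (frontier \<Omega> \<times> C)"
      using fr closure_subset[of \<Omega>] by auto
    then have "inf ?N (principal (closure \<Omega> \<times> C)) =
        sup (inf ?N (principal (\<Omega> \<times> C))) (inf ?N (principal (frontier \<Omega> \<times> C)))"
      by (simp add: inf_sup_distrib1 flip: sup_principal)
    then have "lsc_env (closure \<Omega> \<times> C) ?P (x, c) =
        min (lsc_env (\<Omega> \<times> C) ?P (x, c)) (lsc_env (frontier \<Omega> \<times> C) ?P (x, c))"
      unfolding lsc_env_def by (simp add: Liminf_sup_filter)
    then show ?thesis using 1 2 False by (simp add: min.commute)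
  qed
qed

context
  fixes \<Omega> :: "(real^'n) set" and f :: "real^'n \<Rightarrow> real \<Rightarrow> real^'n \<Rightarrow> real"
    and g :: "real^'n \<Rightarrow> real" and detp :: "real^'n^'n \<Rightarrow> real"
  assumes \<Omega>: "open \<Omega>"
    and detp: "continuous_on sym_matrices detp"
    and f: "continuous_on (closure \<Omega> \<times> UNIV \<times> UNIV) (\<lambda>(x, s, p). f x s p)"
    and g: "continuous_on (frontier \<Omega>) g"
begin

lemma MA_continuous_interior:
  "continuous_on (closure \<Omega> \<times> UNIV \<times> UNIV \<times> sym_matrices) (\<lambda>(x, s, p, X). - detp X + f x s p)"
proof -
  have "continuous_on (closure \<Omega> \<times> UNIV \<times> UNIV \<times> sym_matrices)
      (\<lambda>z. - detp (snd (snd (snd z))) +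
        (\<lambda>(x, s, p). f x s p) (fst z, fst (snd z), fst (snd (snd z))))"
    by (intro continuous_intros continuous_on_compose2[OF detp] continuous_on_compose2[OF f]) auto
  then show ?thesis by (simp add: case_prod_unfold)
qed

lemma MA_continuous_boundary:
  "continuous_on (frontier \<Omega> \<times> UNIV \<times> UNIV \<times> sym_matrices)
     (\<lambda>(x, s :: real, p :: real^'n, X :: real^'n^'n). s - g x)"
proof -
  have "continuous_on (frontier \<Omega> \<times> UNIV \<times> UNIV \<times> sym_matrices)
      (\<lambda>z. fst (snd z) - g (fst z))"
    by (intro continuous_intros continuous_on_compose2[OF g]) auto
  then show ?thesis by (simp add: case_prod_unfold)
qed

lemma lsc_env_MA_op:
  assumes "x \<in> closure \<Omega>" "X \<in> sym_matrices"
  shows "lsc_env (closure \<Omega> \<times> UNIV \<times> UNIV \<times> sym_matrices)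
           (\<lambda>(x, s, p, X). MA_op detp \<Omega> f g x s p X) (x, s, p, X) =
         ereal (MA_op_lower detp \<Omega> f g x s p X)"
proof -
  let ?C = "(UNIV :: real set) \<times> (UNIV :: (real^'n) set) \<times> (sym_matrices :: (real^'n^'n) set)"
  let ?A = "\<lambda>x (s, p, X). - detp X + f x s p"
  let ?B = "\<lambda>x (s, p, X). s - g x"
  have A: "continuous_on (closure \<Omega> \<times> ?C) (\<lambda>(x, c). ?A x c)"
    using MA_continuous_interior by (simp add: case_prod_unfold)
  have B: "continuous_on (frontier \<Omega> \<times> ?C) (\<lambda>(x, c). ?B x c)"
    using MA_continuous_boundary by (simp add: case_prod_unfold)
  have eq: "(\<lambda>(x, s, p, X). MA_op detp \<Omega> f g x s p X) =
      (\<lambda>(x, c). if x \<in> \<Omega> then ?A x c else ?B x c)"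
    by (auto simp: MA_op_def fun_eq_iff)
  show ?thesis
    unfolding eq
    using lsc_env_piecewise[OF \<Omega> assms(1) _ A B, of "(s, p, X)"] assms(2)
    by (auto simp: MA_op_lower_def)
qed

lemma usc_env_MA_op:
  assumes "x \<in> closure \<Omega>" "X \<in> sym_matrices"
  shows "usc_env (closure \<Omega> \<times> UNIV \<times> UNIV \<times> sym_matrices)
           (\<lambda>(x, s, p, X). MA_op detp \<Omega> f g x s p X) (x, s, p, X) =
         ereal (MA_op_upper detp \<Omega> f g x s p X)"
proof -
  let ?C = "(UNIV :: real set) \<times> (UNIV :: (real^'n) set) \<times> (sym_matrices :: (real^'n^'n) set)"
  let ?A = "\<lambda>x (s, p, X). - (- detp X + f x s p)"
  let ?B = "\<lambda>x (s, p, X). - (s - g x)"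
  have A: "continuous_on (closure \<Omega> \<times> ?C) (\<lambda>(x, c). ?A x c)"
    using continuous_on_minus[OF MA_continuous_interior] by (simp add: case_prod_unfold)
  have B: "continuous_on (frontier \<Omega> \<times> ?C) (\<lambda>(x, c). ?B x c)"
    using continuous_on_minus[OF MA_continuous_boundary] by (simp add: case_prod_unfold)
  have eq: "(\<lambda>y. - (case y of (x, s, p, X) \<Rightarrow> MA_op detp \<Omega> f g x s p X)) =
      (\<lambda>(x, c). if x \<in> \<Omega> then ?A x c else ?B x c)"
    by (auto simp: MA_op_def fun_eq_iff)
  show ?thesis
    unfolding usc_env_eq eq
    using lsc_env_piecewise[OF \<Omega> assms(1) _ A B, of "(s, p, X)"] assms(2)
    by (auto simp: MA_op_upper_def min_def max_def)
qed

end

end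

theory Submission
  imports "HOL-Probability.Probability" Defs
begin

text \<open>
  Subsolutions are convex, and the \<open>n\<close>-th root of the determinant is the infimum of linear functionals:
  \<open>n (det X)\<^sup>1\<^sup>/\<^sup>n = inf trace (B\<^sup>T X B)\<close> over \<open>det B = 1\<close>. So a mollified subsolution of \<open>det D\<^sup>2V \<ge> c\<close> is a
  classical one as soon as this is known for each constant coefficient operator \<open>trace (B\<^sup>T D\<^sup>2V B)\<close>, i.e.
  after a linear change of variables for the Laplacian. There a viscosity subsolution is compared with
  its own heat evolution, which is smooth and hence an admissible test function.

  This replaces the theorem on sums: in the doubled functional \<open>V\<^sub>\<eta>(x) - W(y) - |x - y|\<^sup>2/2\<epsilon>\<close>, with \<open>V\<^sub>\<eta>\<close> the
  mollification of \<open>V\<close>, a translate of \<open>V\<^sub>\<eta>\<close> is a smooth test function for \<open>W\<close> at a maximum. The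
  paraboloid touching \<open>V\<^sub>\<eta>\<close> from above there keeps all gradients of the convex function \<open>V\<close> on the
  \<open>\<eta>\<close>-ball within \<open>13\<eta>/\<epsilon>\<close> of a single vector, so \<open>\<eta> << \<epsilon>\<close> allows the gradient dependence of \<open>f\<close>.

  The solution \<open>u\<close> is compared with \<open>w\<close> and \<open>v\<close> with \<open>u\<close>; the Lipschitz bound of \<open>u\<close> bounds the gradients
  that occur. Subsolutions are first contracted towards an interior point, which makes them finite
  near the closure, and made strict by adding a multiple of a convex barrier.
\<close>

section \<open>Determinants of positive semidefinite matrices\<close>

text \<open>A direct comparison of v with w would leave the gradient at a doubled maximum
  uncontrolled: it has size |x - y| / \<epsilon>, whereas the Lipschitz constant of the n-th root of
  f is available only on a ball of gradients fixed beforehand. Putting the Lipschitz function u on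
  one side removes this, at the price of two comparisons. Monotonicity of f in its second argument
  need not be strict, so strictness must come from the barrier \<psi>. Adding \<epsilon> \<psi>
  raises the n-th root of the determinant by at least \<epsilon> times that of D^2 \<psi>
  (Minkowski) and changes the n-th root of f by at most a multiple of \<epsilon> |D \<psi>|; both
  are linear in \<epsilon>, which is why the Lipschitz condition concerns the root. The two
  functions enter asymmetrically. The subsolution must live on a neighbourhood of the closure in
  order to be mollified, hence the contraction. The supersolution is tested on the closed domain
  itself, where at a frontier point with w < g the equation is still available. A subsolution gets
  its frontier values from uniform convexity instead.\<close>

lemma trace_congruence:
  fixes X B :: "real^'n^'n"
  shows "trace (transpose B ** X ** B) = (\<Sum>j\<in>UNIV. column j B \<bullet> (X *v column j B))"
proof -
  have "(transpose B ** X ** B) $ j $ j = column j B \<bullet> (X *v column j B)" for j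
    unfolding matrix_mul_assoc[symmetric]
    by (simp add: matrix_matrix_mult_def transpose_def column_def inner_vec_def matrix_vector_mult_def)
  then show ?thesis by (simp add: trace_def)
qed

lemma continuous_on_congruence_trace:
  fixes X :: "real^'n^'n"
  shows "continuous_on S (\<lambda>B::real^'n^'n. trace (transpose B ** X ** B))"
  unfolding trace_congruence inner_vec_def column_def matrix_vector_mult_def
  by (simp, intro continuous_intros)

lemma continuous_on_det: "continuous_on S (det :: real^'n^'n \<Rightarrow> real)"
  unfolding det_def by (intro continuous_intros)

lemma norm_matrix_columns:
  fixes C :: "real^'n^'n"
  shows "(norm C)^2 = (\<Sum>j\<in>UNIV. column j C \<bullet> column j C)"
proof -
  have "(norm C)^2 = (\<Sum>i\<in>UNIV. \<Sum>j\<in>UNIV. C$i$j * C$i$j)"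
    by (simp add: power2_norm_eq_inner inner_vec_def)
  also have "\<dots> = (\<Sum>j\<in>UNIV. \<Sum>i\<in>UNIV. C$i$j * C$i$j)" by (rule sum.swap)
  finally show ?thesis by (simp add: column_def inner_vec_def)
qed

text \<open>The functional dominates \<delta> |C|^2, so its sublevel set through the identity,
  intersected with the closed set det C = 1, is compact.\<close>

lemma trace_minimizer_exists:
  fixes X :: "real^'n^'n"
  assumes d: "\<delta> > 0" "\<And>\<xi>. \<delta> * (\<xi> \<bullet> \<xi>) \<le> \<xi> \<bullet> (X *v \<xi>)"
  obtains B where "det B = 1"
    "\<And>C. det C = 1 \<Longrightarrow> trace (transpose B ** X ** B) \<le> trace (transpose C ** X ** C)"
proof -
  let ?f = "\<lambda>C::real^'n^'n. trace (transpose C ** X ** C)"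
  let ?S = "{C::real^'n^'n. det C = 1 \<and> ?f C \<le> ?f (mat 1)}"
  have low: "\<delta> * (norm C)^2 \<le> ?f C" for C
    unfolding trace_congruence norm_matrix_columns sum_distrib_left by (intro sum_mono d)
  have "closed {C::real^'n^'n. det C = 1}"
    by (intro closed_Collect_eq continuous_on_det continuous_on_const)
  moreover have "closed {C. ?f C \<le> ?f (mat 1)}"
    by (intro closed_Collect_le continuous_on_congruence_trace continuous_on_const)
  ultimately have cl: "closed ?S" unfolding Collect_conj_eq by (rule closed_Int)
  have "norm C \<le> sqrt (?f (mat 1) / \<delta>)" if "C \<in> ?S" for C
    using low[of C] that d(1) by (intro real_le_rsqrt) (simp add: field_simps)
  then have "bounded ?S" unfolding bounded_iff by blast
  with cl have "compact ?S" by (simp add: compact_eq_bounded_closed)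
  moreover have "mat 1 \<in> ?S" by (simp add: det_I)
  ultimately obtain B where B: "B \<in> ?S" "\<And>C. C \<in> ?S \<Longrightarrow> ?f B \<le> ?f C"
    using continuous_attains_inf[of ?S ?f] continuous_on_congruence_trace[of _ X] by blast
  show thesis
  proof (rule that)
    show "det B = 1" using B by simp
    fix C :: "real^'n^'n" assume "det C = 1"
    then show "?f B \<le> ?f C"
      using B(1) B(2)[of C] by (cases "?f C \<le> ?f (mat 1)") auto
  qed
qed

text \<open>A competitor for the minimisation: it adds t times one coordinate axis to another and so
  probes an off-diagonal entry.\<close>

lemma det_transvection:
  fixes k l :: "'n::finite"
  assumes "k \<noteq> l"
  shows "det (\<chi> i j. if i = j then 1 else if i = k \<and> j = l then t else (0::real)) = 1"
proof -
  have "(\<chi> i j. if i = j then 1 else if i = k \<and> j = l then t else (0::real)) =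
      (\<chi> m. if m = k then row k (mat 1) + t *s row l (mat 1) else row m (mat 1))"
    using assms by (auto simp: vec_eq_iff row_def mat_def)
  then show ?thesis using det_row_operation[OF assms, of "mat 1" t] by (simp add: det_I)
qed

text \<open>The second kind of competitor: it trades length between two coordinate axes and so
  compares two diagonal entries.\<close>

lemma det_two_scaling:
  fixes k l :: "'n::finite"
  assumes "k \<noteq> l" "s \<noteq> 0"
  shows "det (\<chi> i j. if i = j then (if i = k then s else if i = l then 1/s else 1) else (0::real)) = 1"
proof -
  let ?d = "\<lambda>i. if i = k then s else if i = l then 1/s else 1"
  have "det (\<chi> i j. if i = j then ?d i else (0::real)) = (\<Prod>i\<in>UNIV. ?d i)"
    by (subst det_diagonal) auto
  also have "\<dots> = ?d k * (?d l * (\<Prod>i\<in>UNIV - {k} - {l}. ?d i))"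
    using assms by (simp add: prod.remove[of UNIV k] prod.remove[of "UNIV - {k}" l])
  also have "(\<Prod>i\<in>UNIV - {k} - {l}. ?d i) = 1" by (rule prod.neutral) auto
  finally show ?thesis using assms by simp
qed

lemma quadratic_nonneg_imp_zero:
  fixes a b :: real
  assumes "\<And>t. 0 \<le> 2 * t * a + t^2 * b"
  shows "a = 0"
proof (rule ccontr)
  assume a: "a \<noteq> 0"
  \<comment> \<open>Of the sign opposite to a, and small enough, thanks to |b| + 1, for the linear
    term to outweigh the quadratic one.\<close>
  let ?t = "- a / (\<bar>b\<bar> + 1)"
  have "2 * ?t * a + ?t^2 * b = (a^2 / (\<bar>b\<bar>+1)^2) * (b - 2 * (\<bar>b\<bar> + 1))"
  proof -
    have "\<bar>b\<bar> + 1 \<noteq> 0" by linarith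
    then show ?thesis by (simp add: divide_simps) (simp add: algebra_simps power2_eq_square)
  qed
  also have "\<dots> < 0" using a by (intro mult_pos_neg) (auto intro!: divide_pos_pos)
  finally show False using assms[of ?t] by linarith
qed

text \<open>The identity is a minimiser here. Stationarity under transvections kills every
  off-diagonal entry, and optimality under scalings of two axes makes the diagonal entries equal. No
  eigenvalues are involved.\<close>

lemma minimal_trace_scalar:
  fixes Y :: "real^'n^'n"
  assumes sym: "transpose Y = Y" and pos: "\<And>i. Y $ i $ i > 0"
    and min: "\<And>C. det C = 1 \<Longrightarrow> trace Y \<le> trace (transpose C ** Y ** C)"
  obtains c where "Y = mat c"
proof -
  have sy: "Y $ i $ j = Y $ j $ i" for i j
    using arg_cong[OF sym, of "\<lambda>Z. Z $ i $ j"] by (simp add: transpose_def)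
  have ax: "axis i 1 \<bullet> (Y *v axis j 1) = Y $ i $ j" for i j
    by (simp add: inner_axis' matrix_vector_mult_basis column_def)
  have off: "Y $ k $ l = 0" if kl: "k \<noteq> l" for k l
  proof (rule quadratic_nonneg_imp_zero)
    fix t :: real
    let ?C = "\<chi> i j. if i = j then 1 else if i = k \<and> j = l then t else (0::real)"
    have col: "column j ?C = (if j = l then axis l 1 + t *\<^sub>R axis k 1 else axis j 1)" for j
      using kl by (auto simp: column_def vec_eq_iff axis_def)
    have *: "column j ?C \<bullet> (Y *v column j ?C) = Y$j$j + (if j = l then 2*t*Y$k$l + t^2*Y$k$k else 0)" for j
      unfolding col
      by (simp add: ax matrix_vector_right_distrib matrix_vector_mult_scaleR inner_add_left inner_add_right
          sy[of l k] algebra_simps power2_eq_square)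
    have "trace Y \<le> trace (transpose ?C ** Y ** ?C)" by (intro min det_transvection kl)
    also have "\<dots> = trace Y + (2*t*Y$k$l + t^2*Y$k$k)"
      unfolding trace_congruence * by (simp add: sum.distrib trace_def)
    finally show "0 \<le> 2*t*Y$k$l + t^2*Y$k$k" by simp
  qed
  have diag: "Y $ k $ k = Y $ l $ l" for k l
  proof (cases "k = l")
    case False
    define a b where "a = Y$k$k" and "b = Y$l$l"
    have ab: "a > 0" "b > 0" using pos by (auto simp: a_def b_def)
    \<comment> \<open>The scaling that minimises s^2 a + b / s^2. The minimum is twice the geometric
      mean of a and b, so minimality of a + b forces a = b.\<close>
    define s where "s = sqrt (sqrt b / sqrt a)"
    have s: "s > 0" "s^2 = sqrt b / sqrt a" using ab by (auto simp: s_def)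
    let ?d = "\<lambda>i. if i = k then s else if i = l then 1/s else 1"
    let ?C = "\<chi> i j. if i = j then ?d i else (0::real)"
    have col: "column j ?C = ?d j *\<^sub>R axis j 1" for j
      by (simp add: column_def vec_eq_iff axis_def)
    have *: "column j ?C \<bullet> (Y *v column j ?C) = (?d j)^2 * Y$j$j" for j
      unfolding col matrix_vector_mult_scaleR inner_scaleR_left inner_scaleR_right ax
      by (simp add: power2_eq_square)
    have **: "(\<Sum>j\<in>UNIV. g j) = g k + (g l + (\<Sum>j\<in>UNIV-{k}-{l}. g j))" for g :: "'n \<Rightarrow> real"
      using False by (simp add: sum.remove[of UNIV k] sum.remove[of "UNIV - {k}" l])
    have r: "(\<Sum>j\<in>UNIV-{k}-{l}. (?d j)^2 * Y$j$j) = (\<Sum>j\<in>UNIV-{k}-{l}. Y$j$j)"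
      by (rule sum.cong) auto
    have "trace Y \<le> trace (transpose ?C ** Y ** ?C)" 
      using s False by (intro min det_two_scaling) auto
    then have "a + b \<le> s^2 * a + (1/s)^2 * b"
      unfolding trace_congruence * unfolding trace_def ** r using False by (simp add: a_def b_def)
    also have "(1/s)^2 = sqrt a / sqrt b" using s by (simp add: power_one_over)
    also have "s^2 * a + sqrt a / sqrt b * b = 2 * (sqrt a * sqrt b)"
      unfolding s(2) using ab real_div_sqrt[of a] real_div_sqrt[of b]
      by (simp add: field_simps)
    finally have "(sqrt a - sqrt b)^2 \<le> 0"
      using ab by (simp add: power2_diff)
    then have "a = b" using ab by simp
    then show ?thesis by (simp add: a_def b_def)
  qed simp
  have "Y = mat (Y $ undefined $ undefined)"
    using off diag by (auto simp: vec_eq_iff mat_def)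
  then show thesis by (rule that)
qed

text \<open>The congruence by a minimiser B turns X into a matrix for which the identity is a
  minimiser, hence into c times the identity. Since det B = 1, c is the n-th root of det X: the
  infimum formula, with the infimum attained.\<close>

lemma posdef_normal_form:
  fixes X :: "real^'n^'n"
  assumes sym: "transpose X = X" and d: "\<delta> > 0" "\<And>\<xi>. \<delta> * (\<xi> \<bullet> \<xi>) \<le> \<xi> \<bullet> (X *v \<xi>)"
  obtains B c where "det B = 1" "0 \<le> c" "det X = c ^ CARD('n)"
    "trace (transpose B ** X ** B) = real CARD('n) * c"
    "\<And>C. det C = 1 \<Longrightarrow> real CARD('n) * c \<le> trace (transpose C ** X ** C)"
proof -
  obtain B where B: "det B = 1"
    "\<And>C. det C = 1 \<Longrightarrow> trace (transpose B ** X ** B) \<le> trace (transpose C ** X ** C)"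
    using trace_minimizer_exists[OF d] by blast
  define Y where "Y = transpose B ** X ** B"
  have symY: "transpose Y = Y"
    by (simp add: Y_def matrix_transpose_mul sym matrix_mul_assoc)
  have minY: "trace Y \<le> trace (transpose C ** Y ** C)" if "det C = 1" for C
  proof -
    have "transpose C ** Y ** C = transpose (B ** C) ** X ** (B ** C)"
      by (simp add: Y_def matrix_transpose_mul matrix_mul_assoc)
    then show ?thesis using B(2)[of "B ** C"] that B(1) by (simp add: Y_def det_mul)
  qed
  have posY: "Y $ i $ i > 0" for i
  proof -
    have "Y $ i $ i = column i B \<bullet> (X *v column i B)"
      unfolding Y_def matrix_mul_assoc[symmetric]
      by (simp add: matrix_matrix_mult_def transpose_def column_def inner_vec_def matrix_vector_mult_def)
    moreover have "column i B \<noteq> 0"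
    proof
      assume "column i B = 0"
      then have "det B = 0" by (rule det_zero_column)
      then show False using B by simp
    qed
    then have "0 < \<delta> * (column i B \<bullet> column i B)" using d(1) by simp
    ultimately show ?thesis using d(2)[of "column i B"] by linarith
  qed
  obtain c where c: "Y = mat c" using minimal_trace_scalar[OF symY posY minY] by blast
  have tr: "trace Y = real CARD('n) * c" by (simp add: c trace_def mat_def)
  have "det Y = c ^ CARD('n)"
    unfolding c by (subst det_diagonal) (auto simp: mat_def)
  moreover have "det Y = det X" by (simp add: Y_def det_mul B(1))
  moreover have "0 \<le> c" using posY[of undefined] by (simp add: c mat_def)
  ultimately show thesis using that[of B c] B tr by (simp add: Y_def)
qed

section \<open>Positive semidefinite matrices as limits of definite ones\<close>

lemma mat_mult_vec: "mat t *v \<xi> = t *\<^sub>R \<xi>" for \<xi> :: "real^'n"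
  by (simp add: vec_eq_iff matrix_vector_mult_def mat_def if_distrib if_distribR sum.delta cong: if_cong)

text \<open>For singular X the infimum of the trace functional need not be attained; adding t times
  the identity restores definiteness, and t tends to 0 later.\<close>

lemma psd_shift:
  fixes X :: "real^'n^'n"
  assumes "psd X" "t > 0"
  shows "transpose (X + mat t) = X + mat t" "t * (\<xi> \<bullet> \<xi>) \<le> \<xi> \<bullet> ((X + mat t) *v \<xi>)"
proof -
  show "transpose (X + mat t) = X + mat t"
    using assms(1) by (auto simp: psd_def sym_matrices_def transpose_def vec_eq_iff mat_def)
  then show "t * (\<xi> \<bullet> \<xi>) \<le> \<xi> \<bullet> ((X + mat t) *v \<xi>)"
    using assms(1) by (simp add: psd_def matrix_vector_mult_add_rdistrib inner_add_right mat_mult_vec)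
qed

lemma det_shift_tendsto:
  fixes X :: "real^'n^'n"
  shows "((\<lambda>t. det (X + mat t)) \<longlongrightarrow> det X) (at_right 0)"
proof -
  have "((\<lambda>t. mat t :: real^'n^'n) \<longlongrightarrow> mat 0) (at_right 0)"
  proof (intro vec_tendstoI)
    fix i j :: 'n
    show "((\<lambda>t. (mat t :: real^'n^'n) $ i $ j) \<longlongrightarrow> mat 0 $ i $ j) (at_right 0)"
      by (cases "i = j") (simp_all add: mat_def)
  qed
  then have "((\<lambda>t. X + mat t) \<longlongrightarrow> X + mat 0) (at_right 0)"
    by (intro tendsto_add tendsto_const)
  moreover have "isCont det X" 
    using continuous_on_det[of "UNIV :: (real^'n^'n) set"]
    by (simp add: continuous_on_eq_continuous_at)
  moreover have "X + mat 0 = X" by (simp add: vec_eq_iff mat_def)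
  ultimately show ?thesis by (metis isCont_tendsto_compose)
qed

lemma trace_congruence_shift:
  fixes X B :: "real^'n^'n"
  shows "trace (transpose B ** (X + mat t) ** B) = trace (transpose B ** X ** B) + t * (norm B)^2"
    by (simp add: trace_congruence norm_matrix_columns matrix_vector_mult_add_rdistrib inner_add_right sum.distrib
        sum_distrib_left mat_mult_vec)

text \<open>One half of the infimum formula. For a fixed B the error t |B|^2 of the shift vanishes
  as t tends to 0.\<close>

lemma det_le_trace_congruence:
  fixes X B :: "real^'n^'n"
  assumes X: "psd X" and B: "det B = 1"
  shows "real CARD('n) * root CARD('n) (det X) \<le> trace (transpose B ** X ** B)"
proof (rule tendsto_le[of "at_right (0::real)"])
  show "((\<lambda>t. CARD('n) * root CARD('n) (det (X + mat t))) \<longlongrightarrow> CARD('n) * root CARD('n) (det X)) (at_right 0)"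
    by (intro tendsto_intros det_shift_tendsto)
  have "((\<lambda>t. trace (transpose B ** X ** B) + t * (norm B)^2) \<longlongrightarrow> trace (transpose B ** X ** B) + 0 * (norm B)^2) (at_right 0)"
    by (intro tendsto_intros)
  then show "((\<lambda>t. trace (transpose B ** X ** B) + t * (norm B)^2) \<longlongrightarrow> trace (transpose B ** X ** B)) (at_right 0)"
    by simp
  have "real CARD('n) * root CARD('n) (det (X + mat t)) \<le> trace (transpose B ** X ** B) + t * (norm B)^2" if t: "t > 0" for t
  proof -
    obtain c where c: "0 \<le> c" "det (X + mat t) = c ^ CARD('n)"
      "real CARD('n) * c \<le> trace (transpose B ** (X + mat t) ** B)"
      using posdef_normal_form[OF psd_shift(1)[OF X t] t psd_shift(2)[OF X t]] B by metis
    then show ?thesis by (simp add: trace_congruence_shift real_root_power_cancel)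
  qed
  then show "\<forall>\<^sub>F t in at_right 0. CARD('n) * root CARD('n) (det (X + mat t)) \<le> trace (transpose B ** X ** B) + t * (norm B)^2"
    by (auto simp: eventually_at_right_field intro!: exI[of _ 1])
qed simp

text \<open>The other half. The extra term t |B|^2 is non-negative, so the trace bound survives the
  shift with the same constant for every B, in particular for the minimiser, which depends on
  t.\<close>

lemma det_ge_of_trace_congruence:
  fixes X :: "real^'n^'n"
  assumes X: "psd X" and k: "0 \<le> k" and tr: "\<And>B. det B = 1 \<Longrightarrow> real CARD('n) * k \<le> trace (transpose B ** X ** B)"
  shows "k ^ CARD('n) \<le> det X"
proof (rule tendsto_le[OF _ det_shift_tendsto tendsto_const])
  have "k ^ CARD('n) \<le> det (X + mat t)" if t: "t > 0" for t
  proof -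
    obtain B c where c: "det B = 1" "0 \<le> c" "det (X + mat t) = c ^ CARD('n)"
      "trace (transpose B ** (X + mat t) ** B) = real CARD('n) * c"
      using posdef_normal_form[OF psd_shift(1)[OF X t] t psd_shift(2)[OF X t]] by metis
    have "real CARD('n) * k \<le> real CARD('n) * c" 
      using tr[OF c(1)] c(4) mult_nonneg_nonneg[OF less_imp_le[OF t] zero_le_power2[of "norm B"]]
      unfolding trace_congruence_shift by linarith
    then have "k \<le> c" by simp
    then show ?thesis unfolding c(3) using k by (intro power_mono)
  qed
  then show "\<forall>\<^sub>F t in at_right 0. k ^ CARD('n) \<le> det (X + mat t)"
    by (auto simp: eventually_at_right_field intro!: exI[of _ 1])
qed simp

lemma psd_det_nonneg:
  fixes X :: "real^'n^'n"
  assumes "psd X" shows "0 \<le> det X"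
proof -
  have "0 ^ CARD('n) \<le> det X"
  proof (rule det_ge_of_trace_congruence[OF assms])
    show "real CARD('n) * 0 \<le> trace (transpose B ** X ** B)" for B :: "real^'n^'n"
      using assms by (simp add: trace_congruence psd_def sum_nonneg)
  qed simp
  then show ?thesis by (simp add: zero_power)
qed

lemma psd_add: "psd X \<Longrightarrow> psd Y \<Longrightarrow> psd (X + Y)"
  by (auto simp: psd_def sym_matrices_def transpose_def vec_eq_iff matrix_vector_mult_add_rdistrib inner_add_right)

text \<open>An infimum of linear functionals is superadditive: test X + Y against one B and bound
  the two summands separately.\<close>

lemma Minkowski_determinant:
  fixes X Y :: "real^'n^'n"
  assumes X: "psd X" and Y: "psd Y"
  shows "root CARD('n) (det X) + root CARD('n) (det Y) \<le> root CARD('n) (det (X + Y))"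
proof -
  let ?k = "root CARD('n) (det X) + root CARD('n) (det Y)"
  have k: "0 \<le> ?k" using psd_det_nonneg[OF X] psd_det_nonneg[OF Y] by simp
  have "?k ^ CARD('n) \<le> det (X + Y)"
  proof (rule det_ge_of_trace_congruence[OF psd_add[OF X Y] k])
    fix B :: "real^'n^'n" assume B: "det B = 1"
    have "trace (transpose B ** (X + Y) ** B) = trace (transpose B ** X ** B) + trace (transpose B ** Y ** B)"
      by (simp add: trace_congruence matrix_vector_mult_add_rdistrib inner_add_right sum.distrib)
    then show "CARD('n) * ?k \<le> trace (transpose B ** (X + Y) ** B)"
      using det_le_trace_congruence[OF X B] det_le_trace_congruence[OF Y B] by (simp add: distrib_left)
  qed
  then have "root CARD('n) (?k ^ CARD('n)) \<le> root CARD('n) (det (X + Y))" by simp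
  then show ?thesis using k by (simp add: real_root_power_cancel)
qed

section \<open>Test functions of class $C^2$ and semicontinuity\<close>

text \<open>Gradient and Hessian are carried as explicit functions on the whole space, which makes
  sums, affine substitutions and convolutions of test functions easy to form. Symmetry of the
  Hessian is part of the data so that the modified determinant applies to it.\<close>

definition C2 :: "(real^'n \<Rightarrow> real) \<Rightarrow> (real^'n \<Rightarrow> real^'n) \<Rightarrow> (real^'n \<Rightarrow> real^'n^'n) \<Rightarrow> bool" where
  "C2 \<phi> G H \<longleftrightarrow> (\<forall>x. GDERIV \<phi> x :> G x \<and> (G has_derivative (\<lambda>h. H x *v h)) (at x) \<and> transpose (H x) = H x) \<and>
     continuous_on UNIV H"

text \<open>\<open>P\<close> is a placeholder for the inequality at a touching point, so that one
  notion covers the determinant, linear operators with constant coefficients and mere convexity. The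
  filter \<open>at z\<close> is not restricted to \<open>U\<close>: touching is meant in a full
  neighbourhood of z.\<close>

definition test_above :: "(real^'n \<Rightarrow> real) \<Rightarrow> (real^'n) set \<Rightarrow> (real^'n \<Rightarrow> real^'n \<Rightarrow> real^'n^'n \<Rightarrow> bool) \<Rightarrow> bool" where
  "test_above v U P \<longleftrightarrow> (\<forall>\<phi> G H. C2 \<phi> G H \<longrightarrow>
     (\<forall>z\<in>U. (\<forall>\<^sub>F y in at z. v y - \<phi> y \<le> v z - \<phi> z) \<longrightarrow> P z (G z) (H z)))"

definition outer :: "real^'n \<Rightarrow> real^'n^'n" where
  "outer e = (\<chi> i j. e $ i * e $ j)"

lemma outer_mult_vec: "outer e *v h = (e \<bullet> h) *\<^sub>R e"
  by (simp add: outer_def vec_eq_iff matrix_vector_mult_def inner_vec_def sum_distrib_left mult_ac)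

lemma transpose_outer [simp]: "transpose (outer e) = outer e"
  by (simp add: outer_def transpose_def vec_eq_iff mult_ac)

lemma transpose_add: "transpose (A + B) = transpose A + (transpose B :: real^'n^'m)"
  by (simp add: transpose_def vec_eq_iff)

lemma transpose_scaleR: "transpose (c *\<^sub>R A) = c *\<^sub>R (transpose A :: real^'n^'m)"
  by (simp add: transpose_def vec_eq_iff)

lemma continuous_on_outer: "continuous_on S outer"
  unfolding outer_def by (intro continuous_intros)

lemma continuous_on_mat: "continuous_on S f \<Longrightarrow> continuous_on S (\<lambda>x. mat (f x) :: real^'n^'n)"
proof -
  assume f: "continuous_on S f"
  have "continuous_on S (\<lambda>x. if i = j then f x else 0)" for i j :: 'n
    using f by (cases "i = j") auto
  then show ?thesis unfolding mat_def by (intro continuous_on_vec_lambda)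
qed

lemma scaleR_mult_vec: "(c *\<^sub>R A) *v h = c *\<^sub>R (A *v (h :: real^'n))" for A :: "real^'n^'m"
  by (simp add: vec_eq_iff matrix_vector_mult_def sum_distrib_left mult_ac)

section \<open>Calculus of \<open>C2\<close> functions\<close>

lemma C2_D:
  assumes "C2 \<phi> G H"
  shows "GDERIV \<phi> x :> G x" "(G has_derivative (\<lambda>h. H x *v h)) (at x)" "transpose (H x) = H x"
    "continuous_on S H" "continuous_on S G" "continuous_on S \<phi>"
proof -
  show g: "GDERIV \<phi> x :> G x" and h: "(G has_derivative (\<lambda>h. H x *v h)) (at x)" and "transpose (H x) = H x" for x
    using assms by (auto simp: C2_def)
  show "continuous_on S H" using assms continuous_on_subset unfolding C2_def by blast
  show "continuous_on S G" by (intro continuous_at_imp_continuous_on ballI has_derivative_continuous[OF h])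
  show "continuous_on S \<phi>" 
    by (intro continuous_at_imp_continuous_on ballI has_derivative_continuous[OF g[unfolded gderiv_def]])
qed

lemma C2_imp_C2_closure: "C2 \<phi> G H \<Longrightarrow> C2_closure \<Omega> \<phi> G H"
  using C2_D[of \<phi> G H] unfolding C2_closure_def by blast

lemma C2_add:
  assumes "C2 \<phi> G H" "C2 \<phi>' G' H'"
  shows "C2 (\<lambda>x. \<phi> x + \<phi>' x) (\<lambda>x. G x + G' x) (\<lambda>x. H x + H' x)"
proof -
  have "((\<lambda>x. G x + G' x) has_derivative (\<lambda>h. (H x + H' x) *v h)) (at x)" for x
    using has_derivative_add[OF C2_D(2)[OF assms(1)] C2_D(2)[OF assms(2)]]
    by (simp add: matrix_vector_mult_add_rdistrib)
  then show ?thesis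
    using C2_D[OF assms(1)] C2_D[OF assms(2)]
    by (auto simp: C2_def transpose_add intro!: GDERIV_add continuous_on_add)
qed

lemma C2_scale:
  assumes "C2 \<phi> G H"
  shows "C2 (\<lambda>x. c * \<phi> x) (\<lambda>x. c *\<^sub>R G x) (\<lambda>x. c *\<^sub>R H x)"
proof -
  have "((\<lambda>x. c *\<^sub>R G x) has_derivative (\<lambda>h. (c *\<^sub>R H x) *v h)) (at x)" for x
    using has_derivative_scaleR_right[OF C2_D(2)[OF assms]] by (simp add: scaleR_mult_vec)
  moreover have "GDERIV (\<lambda>x. c * \<phi> x) x :> c *\<^sub>R G x" for x
    using C2_D(1)[OF assms, of x] unfolding gderiv_def
    by (auto dest: has_derivative_mult_right[of _ _ _ c])
  ultimately show ?thesis
    using C2_D[OF assms]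
    by (auto simp: C2_def transpose_scaleR intro!: continuous_intros)
qed

lemma C2_quadratic:
  assumes "transpose Q = Q"
  shows "C2 (\<lambda>x. c + p \<bullet> x + x \<bullet> (Q *v x) / 2) (\<lambda>x. p + Q *v x) (\<lambda>_. Q)"
proof -
  have Q: "x \<bullet> (Q *v h) = h \<bullet> (Q *v x)" for x h
    using assms by (metis dot_lmul_matrix inner_commute vector_transpose_matrix)
  have 1: "((\<lambda>x. Q *v x) has_derivative (\<lambda>h. Q *v h)) (at x)" for x
    by (intro bounded_linear_imp_has_derivative matrix_vector_mul_bounded_linear)
  have "((\<lambda>x. c + p \<bullet> x + x \<bullet> (Q *v x) / 2) has_derivative (\<lambda>h. h \<bullet> (p + Q *v x))) (at x)" for x
    by (rule derivative_eq_intros 1 refl)+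
      (auto simp: fun_eq_iff Q inner_add_right inner_commute)
  then have "GDERIV (\<lambda>x. c + p \<bullet> x + x \<bullet> (Q *v x) / 2) x :> p + Q *v x" for x
    by (simp add: gderiv_def)
  moreover have "((\<lambda>x. p + Q *v x) has_derivative (\<lambda>h. Q *v h)) (at x)" for x
    by (rule derivative_eq_intros 1 refl)+ auto
  ultimately show ?thesis using assms by (auto simp: C2_def)
qed

lemma C2_affine_comp:
  fixes A :: "real^'n^'n"
  assumes "C2 \<phi> G H"
  shows "C2 (\<lambda>x. \<phi> (b + A *v x)) (\<lambda>x. transpose A *v G (b + A *v x)) (\<lambda>x. transpose A ** H (b + A *v x) ** A)"
proof -
  have A: "((\<lambda>x. b + A *v x) has_derivative (\<lambda>h. A *v h)) (at x)" for x
    by (rule derivative_eq_intros bounded_linear_imp_has_derivative matrix_vector_mul_bounded_linear refl)+ auto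
  have adj: "(A *v h) \<bullet> g = h \<bullet> (transpose A *v g)" for h g :: "real^'n"
    by (metis dot_lmul_matrix inner_commute transpose_matrix_vector)
  have "((\<lambda>x. \<phi> (b + A *v x)) has_derivative (\<lambda>h. h \<bullet> (transpose A *v G (b + A *v x)))) (at x)" for x
    by (rule has_derivative_eq_rhs[OF has_derivative_compose[OF A C2_D(1)[OF assms, unfolded gderiv_def]]])
      (simp only: adj)
  moreover have "((\<lambda>x. transpose A *v G (b + A *v x)) has_derivative (\<lambda>h. (transpose A ** H (b + A *v x) ** A) *v h)) (at x)" for x
    using bounded_linear.has_derivative[OF matrix_vector_mul_bounded_linear has_derivative_compose[OF A C2_D(2)[OF assms]]]
    by (simp add: matrix_vector_mul_assoc matrix_mul_assoc del: transpose_matrix_vector)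
  moreover have "transpose (transpose A ** H y ** A) = transpose A ** H y ** A" for y
    by (simp add: matrix_transpose_mul C2_D(3)[OF assms] matrix_mul_assoc)
  moreover have "continuous_on UNIV (\<lambda>x. transpose A ** H (b + A *v x) ** A)"
    unfolding matrix_matrix_mult_def transpose_def
    by (intro continuous_intros continuous_on_compose2[OF C2_D(4)[OF assms]] matrix_vector_mult_linear_continuous_on) auto
  ultimately show ?thesis by (auto simp: C2_def gderiv_def)
qed

lemma C2_translate:
  assumes "C2 \<phi> G H"
  shows "C2 (\<lambda>x. \<phi> (x + b)) (\<lambda>x. G (x + b)) (\<lambda>x. H (x + b))"
  using C2_affine_comp[OF assms, of b "mat 1"] by (simp add: add.commute)

text \<open>Serves the heat kernel, the mollifier and the exponential barrier. Taking |x|^2 as the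
  radial variable avoids any singularity at the origin.\<close>

lemma C2_radial:
  fixes \<psi> \<psi>' \<psi>'' :: "real \<Rightarrow> real"
  assumes "\<And>r. DERIV \<psi> r :> \<psi>' r" "\<And>r. DERIV \<psi>' r :> \<psi>'' r" "continuous_on UNIV \<psi>''"
  shows "C2 (\<lambda>x. \<psi> (x \<bullet> x)) (\<lambda>x. (2 * \<psi>' (x \<bullet> x)) *\<^sub>R x)
    (\<lambda>x. mat (2 * \<psi>' (x \<bullet> x)) + (4 * \<psi>'' (x \<bullet> x)) *\<^sub>R outer x)"
proof -
  have r: "((\<lambda>x. x \<bullet> x) has_derivative (\<lambda>h. 2 * (x \<bullet> h))) (at x)" for x :: "real^'n"
    by (rule derivative_eq_intros refl)+ (auto simp: inner_commute)
  have "((\<lambda>x. \<psi> (x \<bullet> x)) has_derivative (\<lambda>h. h \<bullet> ((2 * \<psi>' (x \<bullet> x)) *\<^sub>R x))) (at x)" for x :: "real^'n"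
    by (rule has_derivative_eq_rhs[OF has_derivative_compose[OF r assms(1)[unfolded has_field_derivative_def]]]) 
      (simp add: fun_eq_iff inner_commute)
  moreover have "((\<lambda>x. (2 * \<psi>' (x \<bullet> x)) *\<^sub>R x) has_derivative
      (\<lambda>h. (mat (2 * \<psi>' (x \<bullet> x)) + (4 * \<psi>'' (x \<bullet> x)) *\<^sub>R outer x) *v h)) (at x)" for x :: "real^'n"
  proof -
    have 1: "((\<lambda>x. \<psi>' (x \<bullet> x)) has_derivative (\<lambda>h. \<psi>'' (x \<bullet> x) * (2 * (x \<bullet> h)))) (at x)"
      by (rule has_derivative_eq_rhs[OF has_derivative_compose[OF r assms(2)[unfolded has_field_derivative_def]]]) simp
    show ?thesis
      by (rule derivative_eq_intros 1 refl)+
        (auto simp: fun_eq_iff matrix_vector_mult_add_rdistrib mat_mult_vec scaleR_mult_vec outer_mult_vec mult_ac)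
  qed
  moreover have "continuous_on UNIV (\<lambda>x::real^'n. mat (2 * \<psi>' (x \<bullet> x)) + (4 * \<psi>'' (x \<bullet> x)) *\<^sub>R outer x)"
  proof -
    have i: "continuous_on UNIV (\<lambda>x::real^'n. x \<bullet> x)" by (intro continuous_intros)
    have "continuous_on UNIV \<psi>'" by (intro continuous_at_imp_continuous_on ballI DERIV_isCont[OF assms(2)])
    then have "continuous_on UNIV (\<lambda>x::real^'n. \<psi>' (x \<bullet> x))" "continuous_on UNIV (\<lambda>x::real^'n. \<psi>'' (x \<bullet> x))"
      using continuous_on_compose2[OF _ i] assms(3) by blast+
    then show ?thesis
      by (intro continuous_on_add continuous_on_mat continuous_on_mult_left continuous_on_scaleR continuous_on_outer)
  qed
  moreover have "transpose (mat c :: real^'n^'n) = mat c" for c :: real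
    by (simp add: transpose_def mat_def vec_eq_iff)
  ultimately show ?thesis by (auto simp: C2_def gderiv_def transpose_add transpose_scaleR)
qed

text \<open>The remainder has gradient G (x + s) - G x - H x s, of size at most e |s| near 0; the
  mean value inequality on the ball of radius |s| contributes a second factor |s|.\<close>

lemma C2_taylor:
  fixes \<phi> :: "real^'n \<Rightarrow> real"
  assumes C: "C2 \<phi> G H" and e: "e > 0"
  shows "\<exists>d>0. \<forall>s. norm s < d \<longrightarrow> \<bar>\<phi> (x + s) - \<phi> x - G x \<bullet> s - s \<bullet> (H x *v s) / 2\<bar> \<le> e * (norm s)^2"
proof -
  obtain d where d: "d > 0" "\<And>y. norm (y - x) < d \<Longrightarrow> norm (G y - G x - H x *v (y - x)) \<le> e * norm (y - x)"
    using C2_D(2)[OF C, of x] e unfolding has_derivative_at_alt by blast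
  let ?r = "\<lambda>s. \<phi> (x + s) - \<phi> x - G x \<bullet> s - s \<bullet> (H x *v s) / 2"
  have Q: "u \<bullet> (H x *v h) = h \<bullet> (H x *v u)" for u h
    using C2_D(3)[OF C, of x] by (metis dot_lmul_matrix inner_commute vector_transpose_matrix)
  have H: "((\<lambda>s. H x *v s) has_derivative (\<lambda>h. H x *v h)) (at s within S)" for s S
    by (intro bounded_linear_imp_has_derivative matrix_vector_mul_bounded_linear)
  have "((\<lambda>s. x + s) has_derivative (\<lambda>h. h)) (at s within S)" for s S
    by (auto intro!: derivative_eq_intros)
  then have \<phi>: "((\<lambda>s. \<phi> (x + s)) has_derivative (\<lambda>h. h \<bullet> G (x + s))) (at s within S)" for s S
    using has_derivative_compose[OF _ C2_D(1)[OF C, unfolded gderiv_def]] by blast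
  have der: "(?r has_derivative (\<lambda>h. (G (x + s) - G x - H x *v s) \<bullet> h)) (at s within S)" for s S
    by (rule derivative_eq_intros H \<phi> refl)+
      (auto simp: fun_eq_iff inner_diff_left inner_diff_right inner_commute Q)
  have "\<bar>?r s\<bar> \<le> e * (norm s)^2" if s: "norm s < d" for s
  proof -
    have "norm (?r s - ?r 0) \<le> (e * norm s) * norm (s - 0)"
    proof (rule differentiable_bound[of "cball (0::real^'n) (norm s)"])
      fix u assume u: "u \<in> cball (0::real^'n) (norm s)"
      show "onorm (\<lambda>h. (G (x + u) - G x - H x *v u) \<bullet> h) \<le> e * norm s"
      proof (rule onorm_bound)
        fix h
        have "norm (G (x + u) - G x - H x *v u) \<le> e * norm u" using d(2)[of "x + u"] u s by auto
        also have "\<dots> \<le> e * norm s" using u e by simp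
        finally show "norm ((G (x + u) - G x - H x *v u) \<bullet> h) \<le> e * norm s * norm h"
          unfolding real_norm_def by (intro order_trans[OF Cauchy_Schwarz_ineq2] mult_right_mono) auto
      qed (use e in auto)
    qed (use der in auto)
    then show ?thesis by (simp add: power2_eq_square mult_ac)
  qed
  then show ?thesis using d(1) by blast
qed

section \<open>Upper semicontinuous functions\<close>

lemma usc_on_attains_max:
  fixes S :: "'a::metric_space set"
  assumes S: "compact S" "S \<noteq> {}" and v: "usc_on S v"
  obtains x where "x \<in> S" "\<And>y. y \<in> S \<Longrightarrow> v y \<le> v x"
proof -
  have "\<exists>x\<in>S. \<forall>y\<in>S. v y \<le> v x"
  proof (rule ccontr)
    assume "\<not> ?thesis"
    then have "\<forall>x\<in>S. \<exists>x'\<in>S. v x < v x'" by (meson not_le)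
    then obtain g where g: "\<And>x. x \<in> S \<Longrightarrow> g x \<in> S \<and> v x < v (g x)" by metis
    have "\<exists>U. open U \<and> x \<in> U \<and> (\<forall>y\<in>U\<inter>S. v y < v (g x))" if x: "x \<in> S" for x
    proof -
      have "\<forall>\<^sub>F y in at x within S. v y < v (g x)" using v x g[OF x] by (auto simp: usc_on_def)
      then obtain U where "open U" "x \<in> U" "\<forall>y\<in>U. y \<noteq> x \<longrightarrow> y \<in> S \<longrightarrow> v y < v (g x)"
        unfolding eventually_at_topological by auto
      then show ?thesis using g[OF x] by (intro exI[of _ U]) auto
    qed
    then obtain U where U: "\<And>x. x \<in> S \<Longrightarrow> open (U x) \<and> x \<in> U x \<and> (\<forall>y\<in>U x \<inter> S. v y < v (g x))" by metis
    obtain F where F: "F \<subseteq> S" "finite F" "S \<subseteq> (\<Union>x\<in>F. U x)"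
      by (rule compactE_image[OF S(1), of S U]) (use U in blast)+
    \<comment> \<open>Among the finitely many points \<open>g x\<close> take one of largest value:
      it lies in one of the covering sets, where its value is strictly below another of these
      values.\<close>
    have "F \<noteq> {}" using F S by auto
    then have "Max ((\<lambda>y. v (g y)) ` F) \<in> (\<lambda>y. v (g y)) ` F" using F(2) by (intro Max_in) auto
    then obtain x where x: "x \<in> F" "Max ((\<lambda>y. v (g y)) ` F) = v (g x)" by blast
    have xmax: "v (g y) \<le> v (g x)" if "y \<in> F" for y
      unfolding x(2)[symmetric] using F(2) that by (intro Max_ge) auto
    have "g x \<in> S" using x F g by blast
    then obtain y where y: "y \<in> F" "g x \<in> U y" using F by blast
    then have "v (g x) < v (g y)" using U[of y] F \<open>g x \<in> S\<close> by blast
    then show False using xmax[OF y(1)] by simp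
  qed
  then show thesis using that by blast
qed

lemma usc_on_add_continuous:
  assumes v: "usc_on S v" and f: "continuous_on S f"
  shows "usc_on S (\<lambda>x. v x + f x)"
  unfolding usc_on_def
proof (intro ballI allI impI)
  fix x c assume x: "x \<in> S" and c: "v x + f x < c"
  define e where "e = (c - v x - f x) / 2"
  have e: "e > 0" using c by (simp add: e_def)
  have "\<forall>\<^sub>F y in at x within S. v y < v x + e" using v x e by (auto simp: usc_on_def)
  moreover have "\<forall>\<^sub>F y in at x within S. dist (f y) (f x) < e"
    using f x e by (auto simp: continuous_on_def tendsto_iff)
  ultimately show "\<forall>\<^sub>F y in at x within S. v y + f y < c"
    by eventually_elim (auto simp: e_def dist_real_def field_simps abs_if split: if_splits)
qed

lemma usc_on_compose:
  assumes v: "usc_on S v" and f: "continuous_on T f" "f ` T \<subseteq> S"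
  shows "usc_on T (\<lambda>x. v (f x))"
  unfolding usc_on_def
proof (intro ballI allI impI)
  fix x c assume x: "x \<in> T" and c: "v (f x) < c"
  have "\<forall>\<^sub>F y in at (f x) within S. v y < c" using v x f c by (auto simp: usc_on_def)
  then obtain U where U: "open U" "f x \<in> U" "\<forall>y\<in>U. y \<noteq> f x \<longrightarrow> y \<in> S \<longrightarrow> v y < c"
    unfolding eventually_at_topological by auto
  have "\<forall>\<^sub>F y in at x within T. f y \<in> U"
    using f(1) x U by (auto simp: continuous_on_def tendsto_def)
  moreover have "\<forall>\<^sub>F y in at x within T. y \<in> T" by (simp add: eventually_at_topological) blast
  ultimately show "\<forall>\<^sub>F y in at x within T. v (f y) < c"
    by eventually_elim (use U f c in \<open>auto, metis image_subset_iff\<close>)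
qed

lemma usc_on_subset: "usc_on S v \<Longrightarrow> T \<subseteq> S \<Longrightarrow> usc_on T v"
  using usc_on_compose[of S v T "\<lambda>x. x"] by (auto simp: continuous_on_id)

lemma continuous_imp_usc_on: "continuous_on S f \<Longrightarrow> usc_on S f"
  for f :: "'a::topological_space \<Rightarrow> real"
  using usc_on_add_continuous[of S "\<lambda>_. 0" f] by (simp add: usc_on_def)

text \<open>If v exceeds a chord at an intermediate point, a quadratic that is strictly concave
  along the chord and steep across it touches v from above inside a thin cylinder around the
  segment; its Hessian is negative in the direction of the chord.\<close>

lemma test_above_psd_imp_convex:
  fixes v :: "real^'n \<Rightarrow> real"
  assumes D: "open D" "convex D" and v: "usc_on D v" and test: "test_above v D (\<lambda>z p X. psd X)"
  shows "convex_on D v"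
proof (rule convex_onI)
  fix t :: real and a b :: "real^'n"
  assume t: "0 < t" "t < 1" and ab: "a \<in> D" "b \<in> D"
  define m where "m = (1 - t) *\<^sub>R a + t *\<^sub>R b"
  show "v ((1 - t) *\<^sub>R a + t *\<^sub>R b) \<le> (1 - t) * v a + t * v b"
  proof (rule ccontr)
    assume neg: "\<not> ?thesis"
    \<comment> \<open>Half of the convexity defect. One \<delta> lifts the test function above v at
      the two ends; its concavity costs \<delta> t (1 - t), at most \<delta> / 4, so v still wins at
      m.\<close>
    define \<delta> where "\<delta> = (v m - ((1 - t) * v a + t * v b)) / 2"
    have \<delta>: "\<delta> > 0" using neg by (simp add: \<delta>_def m_def)
    have vm: "v m = (1 - t) * v a + t * v b + 2 * \<delta>" by (simp add: \<delta>_def field_simps)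
    define e where "e = b - a"
    define E where "E = e \<bullet> e"
    have "a \<noteq> b"
    proof
      assume "a = b" 
      then have "m = a" by (simp add: m_def flip: scaleR_add_left)
      with vm \<open>a = b\<close> have "2 * \<delta> = 0" by (simp add: algebra_simps)
      with \<delta> show False by simp
    qed
    then have E: "E > 0" by (simp add: E_def e_def)
    \<comment> \<open>\<open>s\<close> is the coordinate along the chord, 0 at a and 1 at b, and
      \<open>q\<close> the squared distance from the line through them.\<close>
    define s where "s x = ((x - a) \<bullet> e) / E" for x
    define q where "q x = (x - a) \<bullet> (x - a) - (s x)^2 * E" for x
    have q_alt: "q x = (norm (x - (a + s x *\<^sub>R e)))^2" for x
    proof -
      have "(norm (x - (a + s x *\<^sub>R e)))^2 = (x - a) \<bullet> (x - a) - 2 * s x * ((x - a) \<bullet> e) + (s x)^2 * E"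
        unfolding power2_norm_eq_inner E_def
        by (simp add: inner_diff_left inner_diff_right inner_add_left inner_add_right inner_commute algebra_simps power2_eq_square)
      also have "(x - a) \<bullet> e = s x * E" using E by (simp add: s_def)
      finally show ?thesis by (simp add: q_def power2_eq_square)
    qed
    have seg: "a + r *\<^sub>R e \<in> closed_segment a b" if "0 \<le> r" "r \<le> 1" for r
      using that by (auto simp: in_segment e_def algebra_simps intro!: exI[of _ r])
    have "closed_segment a b \<subseteq> D" using D ab by (simp add: closed_segment_subset)
    then obtain r0 where r0: "r0 > 0" "(\<Union>x\<in>closed_segment a b. cball x r0) \<subseteq> D"
      using compact_subset_open_imp_cball_epsilon_subset[OF compact_segment D(1)] by blast
    have "\<exists>r>0. \<forall>x\<in>D. dist x c < r \<longrightarrow> v x < v c + \<delta> / 2" if c: "c \<in> D" for c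
    proof -
      have "\<forall>\<^sub>F y in at c within D. v y < v c + \<delta> / 2" using v c \<delta> by (auto simp: usc_on_def)
      then show ?thesis unfolding eventually_at using \<delta> by (metis add_less_cancel_left add.right_neutral half_gt_zero)
    qed
    then obtain r1 r2 where r12: "r1 > 0" "r2 > 0" "\<And>x. x \<in> D \<Longrightarrow> dist x a < r1 \<Longrightarrow> v x < v a + \<delta> / 2"
      "\<And>x. x \<in> D \<Longrightarrow> dist x b < r2 \<Longrightarrow> v x < v b + \<delta> / 2" using ab by metis
    define r where "r = min r0 (min (r1/2) (r2/2))"
    have r: "r > 0" "r \<le> r0" "r < r1" "r < r2" using r0 r12 by (auto simp: r_def)
    define C where "C = {x. 0 \<le> s x \<and> s x \<le> 1 \<and> q x \<le> r^2}"
    have cont_s: "continuous_on UNIV s" unfolding s_def using E by (intro continuous_intros) auto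
    have cont_q: "continuous_on UNIV q" unfolding q_def by (intro continuous_intros cont_s)
    have near: "x \<in> cball (a + s x *\<^sub>R e) r" if "q x \<le> r^2" for x
    proof -
      have "norm (x - (a + s x *\<^sub>R e)) \<le> r"
        using that r(1) unfolding q_alt by (simp add: abs_le_square_iff[symmetric])
      then show ?thesis by (simp add: dist_norm norm_minus_commute)
    qed
    have Cseg: "C \<subseteq> (\<Union>x\<in>closed_segment a b. cball x r0)"
    proof
      fix x assume x: "x \<in> C"
      then have "a + s x *\<^sub>R e \<in> closed_segment a b" "x \<in> cball (a + s x *\<^sub>R e) r0"
        using seg near[of x] r(2) by (auto simp: C_def)
      then show "x \<in> (\<Union>x\<in>closed_segment a b. cball x r0)" by blast
    qed
    then have CO: "C \<subseteq> D" using r0(2) by blast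
    have "closed C" unfolding C_def
      by (intro closed_Collect_conj closed_Collect_le continuous_on_const cont_s cont_q)
    moreover have "bounded C"
    proof -
      have "bounded (\<Union>x\<in>closed_segment a b. cball x r0)"
      proof -
        have "compact {x + y |x y. x \<in> closed_segment a b \<and> y \<in> cball 0 r0}"
          by (intro compact_sums compact_segment compact_cball)
        moreover have "(\<Union>x\<in>closed_segment a b. cball x r0) \<subseteq> {x + y |x y. x \<in> closed_segment a b \<and> y \<in> cball 0 r0}"
        proof clarify
          fix x y assume "x \<in> closed_segment a b" "y \<in> cball x r0"
          then show "\<exists>x' y'. y = x' + y' \<and> x' \<in> closed_segment a b \<and> y' \<in> cball 0 r0"
            by (intro exI[of _ x] exI[of _ "y - x"]) (simp add: dist_norm norm_minus_commute)
        qed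
        ultimately show ?thesis using bounded_subset compact_imp_bounded by blast
      qed
      then show ?thesis using Cseg bounded_subset by blast
    qed
    ultimately have compC: "compact C" by (simp add: compact_eq_bounded_closed)
    have me: "m - a = t *\<^sub>R e" by (simp add: m_def e_def algebra_simps)
    have sm: "s m = t" using E by (simp add: s_def me E_def)
    have qm: "q m = 0" by (simp add: q_def sm me E_def power2_eq_square)
    have mC: "m \<in> C" using t r by (simp add: C_def sm qm)
    obtain xM where xM: "xM \<in> C" "\<And>y. y \<in> C \<Longrightarrow> v y \<le> v xM"
      using usc_on_attains_max[OF compC _ usc_on_subset[OF v CO]] mC by blast
    define lm where "lm = min (v a) (v b)"
    \<comment> \<open>Steep enough to put the test function above the maximum of v on the lateral
      surface q = r^2.\<close>
    define K where "K = (\<bar>v xM - lm\<bar> + 1) / r^2"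
    have K: "K * r^2 = \<bar>v xM - lm\<bar> + 1" "K \<ge> 0" using r by (auto simp: K_def)
    \<comment> \<open>Cancels the part K E of the steep isotropic term along the chord and adds the
      concavity \<delta>. Together with the \<delta> in \<open>p\<close>, the test function becomes
      affine in s, plus \<delta> s (1 - s), plus K q.\<close>
    define c where "c = (\<delta> + K * E) / E^2"
    define Q where "Q = mat (2 * K) - (2 * c) *\<^sub>R outer e"
    define p where "p = ((v b - v a + \<delta>) / E) *\<^sub>R e"
    define \<phi>0 where "\<phi>0 y = (v a + \<delta>) + p \<bullet> y + y \<bullet> (Q *v y) / 2" for y
    define \<phi> where "\<phi> x = \<phi>0 (x + (- a))" for x
    have symQ: "transpose Q = Q"
      by (simp add: Q_def transpose_def vec_eq_iff mat_def outer_def mult_ac)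
    have C2\<phi>: "C2 \<phi> (\<lambda>x. p + Q *v (x + (- a))) (\<lambda>_. Q)"
      unfolding \<phi>_def \<phi>0_def by (rule C2_translate[OF C2_quadratic[OF symQ]])
    have "y \<bullet> (Q *v y) = 2 * (K * (y \<bullet> y)) - 2 * (c * (y \<bullet> e)^2)" for y
      by (simp add: Q_def matrix_vector_mult_diff_rdistrib mat_mult_vec scaleR_mult_vec outer_mult_vec inner_diff_right
          inner_commute power2_eq_square)
    moreover have "c * (y \<bullet> e)^2 = (\<delta> + K * E) * ((y \<bullet> e) / E)^2" for y
      by (simp add: c_def power_divide)
    ultimately have Qy: "y \<bullet> (Q *v y) / 2 = K * (y \<bullet> y) - (\<delta> + K * E) * ((y \<bullet> e) / E)^2" for y
      by simp
    have \<phi>: "\<phi> x = v a + \<delta> + (v b - v a) * s x + \<delta> * (s x * (1 - s x)) + K * q x" for x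
    proof -
      have alg: "v a + \<delta> + (v b - v a + \<delta>) * S + (K * Y - (\<delta> + K * E) * S^2) =
          v a + \<delta> + (v b - v a) * S + \<delta> * (S * (1 - S)) + K * (Y - S^2 * E)" for S Y :: real
        by (simp add: algebra_simps power2_eq_square)
      have 1: "(x + - a) \<bullet> e / E = s x" by (simp add: s_def)
      have "p \<bullet> (x + - a) = (v b - v a + \<delta>) * ((x + - a) \<bullet> e / E)" by (simp add: p_def inner_commute)
      then have 2: "p \<bullet> (x + - a) = (v b - v a + \<delta>) * s x" by (simp only: 1)
      show ?thesis
        unfolding \<phi>_def \<phi>0_def Qy q_def 1 2 alg by simp
    qed
    obtain z where z: "z \<in> C" "\<And>y. y \<in> C \<Longrightarrow> v y - \<phi> y \<le> v z - \<phi> z"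
    proof -
      have usc: "usc_on C (\<lambda>x. v x + - \<phi> x)"
        by (intro usc_on_add_continuous usc_on_subset[OF v CO] continuous_on_minus C2_D(6)[OF C2\<phi>])
      have ne: "C \<noteq> {}" using mC by blast
      obtain z where z: "z \<in> C" "\<And>y. y \<in> C \<Longrightarrow> v y + - \<phi> y \<le> v z + - \<phi> z"
        by (rule usc_on_attains_max[OF compC ne usc]) blast
      show thesis by (rule that[of z]) (use z in auto)
    qed
    have t4: "t * (1 - t) \<le> 1/4"
    proof -
      have "1/4 - t * (1 - t) = (t - 1/2)^2" by (simp add: power2_eq_square algebra_simps)
      then show ?thesis using zero_le_power2[of "t - 1/2"] by linarith
    qed
    have "\<phi> m = (1 - t) * v a + t * v b + \<delta> + \<delta> * (t * (1 - t))"
      unfolding \<phi> sm qm by (simp add: algebra_simps)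
    moreover have "\<delta> * (t * (1 - t)) \<le> \<delta> * (1/4)" using t4 \<delta> by (intro mult_left_mono) auto
    ultimately have "v m - \<phi> m > 0" using vm \<delta> by linarith
    then have pos: "v z - \<phi> z > 0" using z(2)[OF mC] by simp
    have zO: "z \<in> D" using z CO by blast
    have zC: "0 \<le> s z" "s z \<le> 1" "q z \<le> r^2" "q z \<ge> 0" using z(1) by (auto simp: C_def q_alt)
    have pz: "\<delta> * (s z * (1 - s z)) \<ge> 0" "K * q z \<ge> 0" using \<delta> zC K(2) by auto
    have "s z \<noteq> 0"
    proof
      assume s0: "s z = 0"
      then have "dist z a \<le> r" using near[OF zC(3)] by (simp add: dist_commute)
      then have "v z < v a + \<delta> / 2" using r12(3)[OF zO] r(3) by simp
      moreover have "\<phi> z \<ge> v a + \<delta>" using pz unfolding \<phi> by (simp add: s0)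
      ultimately show False using pos \<delta> by simp
    qed
    moreover have "s z \<noteq> 1"
    proof
      assume s0: "s z = 1"
      then have "dist z b \<le> r" using near[OF zC(3)] by (simp add: dist_commute e_def)
      then have "v z < v b + \<delta> / 2" using r12(4)[OF zO] r(4) by simp
      moreover have "\<phi> z \<ge> v b + \<delta>" using pz unfolding \<phi> by (simp add: s0)
      ultimately show False using pos \<delta> by simp
    qed
    moreover have "q z \<noteq> r^2"
    proof
      assume qz: "q z = r^2"
      have "(v b - v a) * s z + v a \<ge> lm"
      proof -
        have "(v b - v a) * s z + v a = (1 - s z) * v a + s z * v b" by (simp add: algebra_simps)
        also have "\<dots> \<ge> (1 - s z) * lm + s z * lm" using zC by (intro add_mono mult_left_mono) (auto simp: lm_def)
        finally show ?thesis by (simp add: algebra_simps)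
      qed
      then have "\<phi> z \<ge> lm + \<delta> + \<bar>v xM - lm\<bar> + 1" using pz(1) K(1) unfolding \<phi> qz by linarith
      then have "v z - \<phi> z \<le> 0" using xM(2)[OF z(1)] \<delta> by linarith
      then show False using pos by simp
    qed
    ultimately have zint: "z \<in> {x. 0 < s x \<and> s x < 1 \<and> q x < r^2}" using zC by auto
    have "open {x. 0 < s x \<and> s x < 1 \<and> q x < r^2}"
      by (intro open_Collect_conj open_Collect_less continuous_on_const cont_s cont_q)
    then have "\<forall>\<^sub>F y in at z. y \<in> {x. 0 < s x \<and> s x < 1 \<and> q x < r^2}"
      using zint by (intro eventually_at_in_open')
    then have "\<forall>\<^sub>F y in at z. v y - \<phi> y \<le> v z - \<phi> z"
      by eventually_elim (rule z(2), auto simp: C_def)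
    then have "psd Q" using test zO C2\<phi> unfolding test_above_def by blast
    then have "0 \<le> e \<bullet> (Q *v e) / 2" by (simp add: psd_def)
    also have "e \<bullet> (Q *v e) / 2 = - \<delta>" unfolding Qy using E by (simp add: E_def[symmetric])
    finally show False using \<delta> by simp
  qed
qed (rule D(2))

section \<open>Moments of the Gaussian\<close>

lemma lborel_prod_Basis:
  fixes f :: "'a::euclidean_space \<Rightarrow> real \<Rightarrow> real"
  assumes f: "\<And>b. b \<in> Basis \<Longrightarrow> integrable lborel (f b)"
  shows "integrable lborel (\<lambda>x. \<Prod>b\<in>Basis. f b (x \<bullet> b))"
    "(\<integral>x. (\<Prod>b\<in>Basis. f b (x \<bullet> b)) \<partial>lborel) = (\<Prod>b\<in>Basis. \<integral>x. f b x \<partial>lborel)"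
proof -
  interpret product_sigma_finite "\<lambda>_::'a. lborel :: real measure" by standard
  have [measurable]: "f b \<in> borel_measurable borel" if "b \<in> Basis" for b
    using borel_measurable_integrable[OF f[OF that]] by simp
  have m: "(\<lambda>f. \<Sum>b\<in>Basis. f b *\<^sub>R b) \<in> (\<Pi>\<^sub>M b\<in>(Basis::'a set). lborel) \<rightarrow>\<^sub>M borel" by measurable
  have m2: "(\<lambda>x. \<Prod>b\<in>Basis. f b (x \<bullet> b)) \<in> borel_measurable borel" by measurable
  have eq: "(\<Prod>b\<in>Basis. f b ((\<Sum>b'\<in>Basis. g b' *\<^sub>R b') \<bullet> b)) = (\<Prod>b\<in>Basis. f b (g b))" for g :: "'a \<Rightarrow> real"
    by (intro prod.cong refl) simp
  show "integrable lborel (\<lambda>x. \<Prod>b\<in>Basis. f b (x \<bullet> b))"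
    by (subst lborel_eq, subst integrable_distr_eq[OF m m2])
      (simp add: eq product_integrable_prod[OF finite_Basis f])
  show "(\<integral>x. (\<Prod>b\<in>Basis. f b (x \<bullet> b)) \<partial>lborel) = (\<Prod>b\<in>Basis. \<integral>x. f b x \<partial>lborel)"
    by (subst lborel_eq, subst integral_distr[OF m m2])
      (simp add: eq product_integral_prod[OF finite_Basis f])
qed

lemma lborel_prod_vec:
  fixes f :: "'n::finite \<Rightarrow> real \<Rightarrow> real"
  assumes f: "\<And>i. integrable lborel (f i)"
  shows "integrable lborel (\<lambda>x::real^'n. \<Prod>i\<in>UNIV. f i (x $ i))"
    "(\<integral>x. (\<Prod>i\<in>UNIV. f i ((x::real^'n) $ i)) \<partial>lborel) = (\<Prod>i\<in>UNIV. \<integral>x. f i x \<partial>lborel)"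
proof -
  let ?a = "\<lambda>i::'n. axis i (1::real)"
  have inj: "inj ?a" by (auto simp: inj_def axis_eq_axis)
  have B: "Basis = range ?a" by (auto simp: Basis_vec_def)
  let ?F = "\<lambda>b. f (inv ?a b)"
  have F: "?F (?a i) = f i" for i by (simp add: inv_f_f[OF inj])
  have "integrable lborel (?F b)" for b using f by simp
  note * = lborel_prod_Basis[of ?F, OF this]
  have eq: "(\<Prod>b\<in>Basis. ?F b (x \<bullet> b)) = (\<Prod>i\<in>UNIV. f i (x $ i))" for x :: "real^'n"
    unfolding B by (subst prod.reindex[OF inj]) (simp add: F inner_axis)
  have eq2: "(\<Prod>b\<in>(Basis::(real^'n) set). \<integral>x. ?F b x \<partial>lborel) = (\<Prod>i\<in>UNIV. \<integral>x. f i x \<partial>lborel)"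
    unfolding B by (subst prod.reindex[OF inj]) (simp add: F)
  show "integrable lborel (\<lambda>x::real^'n. \<Prod>i\<in>UNIV. f i (x $ i))" using *(1) unfolding eq .
  show "(\<integral>x. (\<Prod>i\<in>UNIV. f i ((x::real^'n) $ i)) \<partial>lborel) = (\<Prod>i\<in>UNIV. \<integral>x. f i x \<partial>lborel)" 
    using *(2) unfolding eq eq2 .
qed

text \<open>Kept as a product over coordinates because moments then factor; the radial form is
  \<open>gauss_density_eq\<close>.\<close>

definition gauss_density :: "real^'n \<Rightarrow> real" where
  "gauss_density \<xi> = (\<Prod>i\<in>UNIV. std_normal_density (\<xi> $ i))"

lemma gauss_density_nonneg: "0 \<le> gauss_density \<xi>"
  unfolding gauss_density_def by (intro prod_nonneg) simp

lemma gauss_density_eq: "gauss_density (\<xi> :: real^'n) = (1 / sqrt (2 * pi)) ^ CARD('n) * exp (- (\<xi> \<bullet> \<xi>) / 2)"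
proof -
  have "gauss_density \<xi> = (\<Prod>i\<in>(UNIV :: 'n set). 1 / sqrt (2 * pi)) * (\<Prod>i\<in>UNIV. exp (- ((\<xi> $ i)^2) / 2))"
    unfolding gauss_density_def std_normal_density_def by (rule prod.distrib)
  also have "(\<Prod>i\<in>UNIV. exp (- ((\<xi> $ i)^2) / 2)) = exp (\<Sum>i\<in>UNIV. - ((\<xi> $ i)^2) / 2)"
    by (simp add: exp_sum)
  also have "(\<Sum>i\<in>UNIV. - ((\<xi> $ i)^2) / 2) = - (\<xi> \<bullet> \<xi>) / 2"
    by (simp add: inner_vec_def power2_eq_square sum_negf sum_divide_distrib)
  finally show ?thesis by simp
qed

lemma gauss_density_measurable [measurable]: "gauss_density \<in> borel_measurable borel"
  unfolding gauss_density_def by measurable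

lemma gauss_moment:
  fixes m :: "'n::finite \<Rightarrow> nat"
  shows "integrable lborel (\<lambda>\<xi>::real^'n. gauss_density \<xi> * (\<Prod>i\<in>UNIV. (\<xi> $ i) ^ m i))"
    "(\<integral>\<xi>. gauss_density (\<xi>::real^'n) * (\<Prod>i\<in>UNIV. (\<xi> $ i) ^ m i) \<partial>lborel) =
      (\<Prod>i\<in>UNIV. \<integral>x. std_normal_density x * x ^ m i \<partial>lborel)"
  using lborel_prod_vec[of "\<lambda>i x. std_normal_density x * x ^ m i", OF integrable_std_normal_moment]
  by (simp_all add: gauss_density_def prod.distrib)

lemma gauss_integral:
  "integrable lborel (gauss_density :: real^'n \<Rightarrow> real)" "(\<integral>\<xi>. gauss_density (\<xi>::real^'n) \<partial>lborel) = 1"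
  using gauss_moment[of "\<lambda>_::'n. 0"] by simp_all

text \<open>One exponent function covers i = j and i \<noteq> j alike, so that the general product
  formula yields second and fourth moments.\<close>

lemma two_exponents:
  fixes \<xi> :: "real^'n"
  shows "\<xi> $ i * \<xi> $ j = (\<Prod>k\<in>UNIV. (\<xi> $ k) ^ ((if k = i then 1 else 0) + (if k = j then 1 else 0)))"
proof -
  have "(\<Prod>k\<in>UNIV. (\<xi> $ k) ^ (if k = i then 1 else 0)) = \<xi> $ i" for i
  proof -
    have "(\<Prod>k\<in>UNIV. (\<xi> $ k) ^ (if k = i then 1 else 0)) = (\<Prod>k\<in>UNIV. if k = i then \<xi> $ k else 1)"
      by (intro prod.cong) auto
    then show ?thesis by simp
  qed
  then show ?thesis by (simp only: power_add prod.distrib)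
qed

lemma gauss_second_moment:
  "integrable lborel (\<lambda>\<xi>::real^'n. gauss_density \<xi> * (\<xi> $ i * \<xi> $ j))"
  "(\<integral>\<xi>. gauss_density (\<xi>::real^'n) * (\<xi> $ i * \<xi> $ j) \<partial>lborel) = (if i = j then 1 else 0)"
proof -
  let ?m = "\<lambda>k. (if k = i then 1 else 0) + (if k = j then 1 else (0::nat))"
  note * = gauss_moment[of ?m, folded two_exponents]
  show "integrable lborel (\<lambda>\<xi>::real^'n. gauss_density \<xi> * (\<xi> $ i * \<xi> $ j))" by (rule *)
  have 1: "(\<integral>x. std_normal_density x * x ^ 1 \<partial>lborel) = 0"
    using integral_std_normal_moment_odd[of 0] by simp
  have 2: "(\<integral>x. std_normal_density x * x ^ 2 \<partial>lborel) = 1"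
    using integral_std_normal_moment_even[of 1] by (simp add: fact_2)
  show "(\<integral>\<xi>. gauss_density (\<xi>::real^'n) * (\<xi> $ i * \<xi> $ j) \<partial>lborel) = (if i = j then 1 else 0)"
  proof (cases "i = j")
    case True
    have "(\<integral>x. std_normal_density x * x ^ ?m k \<partial>lborel) = 1" for k
      using True 2 by (cases "k = i") (auto simp: numeral_2_eq_2)
    then have "(\<Prod>k\<in>UNIV. \<integral>x. std_normal_density x * x ^ ?m k \<partial>lborel) = 1" by (simp only: prod.neutral_const)
    then show ?thesis using * True by simp
  next
    case False
    have "(\<integral>x. std_normal_density x * x ^ ?m i \<partial>lborel) = 0" using False 1 by simp
    then have "(\<Prod>k\<in>UNIV. \<integral>x. std_normal_density x * x ^ ?m k \<partial>lborel) = 0" by (intro prod_zero) auto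
    then show ?thesis using * False by simp
  qed
qed

lemma gauss_quadratic_moment:
  fixes Q :: "real^'n^'n"
  shows "integrable lborel (\<lambda>\<xi>::real^'n. gauss_density \<xi> * (\<xi> \<bullet> (Q *v \<xi>)))"
    "(\<integral>\<xi>. gauss_density (\<xi>::real^'n) * (\<xi> \<bullet> (Q *v \<xi>)) \<partial>lborel) = trace Q"
proof -
  have eq: "gauss_density \<xi> * (\<xi> \<bullet> (Q *v \<xi>)) = (\<Sum>i\<in>UNIV. \<Sum>j\<in>UNIV. Q $ i $ j * (gauss_density \<xi> * (\<xi> $ i * \<xi> $ j)))" for \<xi>
    by (simp add: inner_vec_def matrix_vector_mult_def sum_distrib_left mult_ac)
  show "integrable lborel (\<lambda>\<xi>::real^'n. gauss_density \<xi> * (\<xi> \<bullet> (Q *v \<xi>)))"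
    unfolding eq by (intro Bochner_Integration.integrable_sum integrable_mult_right gauss_second_moment)
  have "(\<integral>\<xi>. gauss_density (\<xi>::real^'n) * (\<xi> \<bullet> (Q *v \<xi>)) \<partial>lborel) = (\<Sum>i\<in>UNIV. \<Sum>j\<in>UNIV. Q $ i $ j * (if i = j then 1 else 0))"
    unfolding eq
    by (subst Bochner_Integration.integral_sum, intro Bochner_Integration.integrable_sum integrable_mult_right gauss_second_moment,
        subst Bochner_Integration.integral_sum, intro integrable_mult_right gauss_second_moment)
      (simp add: gauss_second_moment)
  also have "\<dots> = trace Q" by (simp add: trace_def if_distrib cong: if_cong)
  finally show "(\<integral>\<xi>. gauss_density (\<xi>::real^'n) * (\<xi> \<bullet> (Q *v \<xi>)) \<partial>lborel) = trace Q" .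
qed

text \<open>Fourth moments absorb everything far from the centre: a quantity bounded by a multiple
  of |sqrt (2 t) \<xi>|^4 contributes only order t^2 to a Gaussian average.\<close>

lemma gauss_fourth_moment: "integrable lborel (\<lambda>\<xi>::real^'n. gauss_density \<xi> * (norm \<xi>)^4)"
proof -
  have "(norm \<xi>)^4 = (\<Sum>i\<in>UNIV. \<Sum>j\<in>UNIV. (\<xi> $ i * \<xi> $ j) * (\<xi> $ i * \<xi> $ j))" for \<xi> :: "real^'n"
  proof -
    have "(norm \<xi>)^4 = ((norm \<xi>)^2)^2" by simp
    also have "\<dots> = (\<xi> \<bullet> \<xi>)^2" by (simp add: power2_norm_eq_inner)
    also have "\<dots> = (\<Sum>i\<in>UNIV. \<Sum>j\<in>UNIV. (\<xi> $ i * \<xi> $ i) * (\<xi> $ j * \<xi> $ j))"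
      by (simp only: inner_vec_def inner_real_def power2_eq_square sum_product)
    finally show ?thesis by (simp add: mult_ac)
  qed
  then have eq: "gauss_density \<xi> * (norm \<xi>)^4 = (\<Sum>i\<in>UNIV. \<Sum>j\<in>UNIV. gauss_density \<xi> * ((\<xi> $ i * \<xi> $ j) * (\<xi> $ i * \<xi> $ j)))" for \<xi> :: "real^'n"
    by (simp only: sum_distrib_left)
  show ?thesis unfolding eq
    unfolding two_exponents prod.distrib[symmetric] power_add[symmetric]
    by (intro Bochner_Integration.integrable_sum gauss_moment)
qed

lemma lborel_integral_affine:
  fixes f :: "'a::euclidean_space \<Rightarrow> real" and t :: 'a
  assumes c: "c \<noteq> 0" and [measurable]: "f \<in> borel_measurable borel"
  shows "integrable lborel (\<lambda>x. f (t + c *\<^sub>R x)) \<longleftrightarrow> integrable lborel f"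
    "(\<integral>x. f (t + c *\<^sub>R x) \<partial>lborel) * \<bar>c\<bar> ^ DIM('a) = (\<integral>x. f x \<partial>lborel)"
proof -
  have m: "(\<lambda>x. t + c *\<^sub>R x) \<in> lborel \<rightarrow>\<^sub>M (borel :: 'a measure)" by measurable
  have *: "integrable lborel f \<longleftrightarrow> integrable (distr lborel borel (\<lambda>x. t + c *\<^sub>R x)) (\<lambda>x. \<bar>c\<bar> ^ DIM('a) *\<^sub>R f x)"
    by (subst lborel_affine[OF c, of t]) (subst integrable_density, auto)
  have **: "(\<integral>x. f x \<partial>lborel) = (\<integral>x. \<bar>c\<bar> ^ DIM('a) *\<^sub>R f x \<partial>(distr lborel borel (\<lambda>x. t + c *\<^sub>R x)))"
    by (subst lborel_affine[OF c, of t]) (subst integral_density, auto)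
  show "integrable lborel (\<lambda>x. f (t + c *\<^sub>R x)) \<longleftrightarrow> integrable lborel f"
    unfolding * by (subst integrable_distr_eq[OF m]) (use c in auto)
  show "(\<integral>x. f (t + c *\<^sub>R x) \<partial>lborel) * \<bar>c\<bar> ^ DIM('a) = (\<integral>x. f x \<partial>lborel)"
    unfolding ** by (subst integral_distr[OF m]) auto
qed

lemma lborel_integral_reflect:
  fixes f :: "'a::euclidean_space \<Rightarrow> real"
  assumes [measurable]: "f \<in> borel_measurable borel"
  shows "integrable lborel (\<lambda>x. f (t - x)) \<longleftrightarrow> integrable lborel f" "(\<integral>x. f (t - x) \<partial>lborel) = (\<integral>x. f x \<partial>lborel)"
  using lborel_integral_affine[of "-1" f t] by simp_all

section \<open>The heat flow as a test function\<close>

lemma integrable_compact_support: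
  fixes f :: "'a::euclidean_space \<Rightarrow> real"
  assumes f: "continuous_on UNIV f" and z: "\<And>y. y \<notin> cbox a b \<Longrightarrow> f y = 0"
  shows "integrable lborel f" "(\<integral>y. f y \<partial>lborel) = integral (cbox a b) f"
proof -
  have eq: "(\<lambda>x. indicator (cbox a b) x *\<^sub>R f x) = f" using z by (auto simp: fun_eq_iff indicator_def)
  have s: "set_integrable lborel (cbox a b) f"
    unfolding set_integrable_def
    by (intro borel_integrable_compact compact_cbox continuous_on_subset[OF f]) simp
  show "integrable lborel f" using s unfolding set_integrable_def eq .
  show "(\<integral>y. f y \<partial>lborel) = integral (cbox a b) f"
    using set_borel_integral_eq_integral(2)[OF s] unfolding set_lebesgue_integral_def eq .
qed

text \<open>The derivative falls on the kernel alone, so continuity of u is enough.\<close>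

lemma GDERIV_parametric_integral:
  fixes k :: "real^'n \<Rightarrow> real"
  assumes k: "\<And>x. GDERIV k x :> g x" and g: "continuous_on UNIV g" and u: "continuous_on UNIV u"
  shows "GDERIV (\<lambda>x. integral (cbox a b) (\<lambda>y. k (x - y) * u y)) x :> integral (cbox a b) (\<lambda>y. u y *\<^sub>R g (x - y))"
proof -
  have kc: "continuous_on UNIV k"
    by (intro continuous_at_imp_continuous_on ballI has_derivative_continuous[OF k[unfolded gderiv_def]])
  have cont: "continuous_on (cbox a b) (\<lambda>y. u y *\<^sub>R g (x - y))" for x
    by (intro continuous_intros continuous_on_compose2[OF g] continuous_on_subset[OF u]) auto
  have der: "((\<lambda>x. k (x - y) * u y) has_derivative blinfun_inner_right (u y *\<^sub>R g (x - y))) (at x within UNIV)" for x y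
  proof -
    have "((\<lambda>x. x - y) has_derivative (\<lambda>h. h)) (at x)" by (auto intro!: derivative_eq_intros)
    then have "((\<lambda>x. k (x - y)) has_derivative (\<lambda>h. h \<bullet> g (x - y))) (at x)"
      using has_derivative_compose[OF _ k[unfolded gderiv_def]] by blast
    then have "((\<lambda>x. k (x - y) * u y) has_derivative (\<lambda>h. (h \<bullet> g (x - y)) * u y)) (at x)"
      by (rule has_derivative_mult_left)
    then show ?thesis by (rule has_derivative_eq_rhs) (simp add: fun_eq_iff inner_commute mult.commute)
  qed
  have "((\<lambda>x. integral (cbox a b) (\<lambda>y. k (x - y) * u y)) has_derivative
      integral (cbox a b) (\<lambda>y. blinfun_inner_right (u y *\<^sub>R g (x - y)))) (at x within UNIV)"
  proof (rule leibniz_rule[OF der])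
    show "(\<lambda>y. k (x - y) * u y) integrable_on cbox a b" for x
      by (intro integrable_continuous continuous_intros continuous_on_compose2[OF kc] continuous_on_subset[OF u]) auto
    show "continuous_on (UNIV \<times> cbox a b) (\<lambda>(x, y). blinfun_inner_right (u y *\<^sub>R g (x - y)))"
      unfolding split_beta
      by (intro continuous_intros continuous_on_compose2[OF g] continuous_on_compose2[OF u]) auto
  qed auto
  moreover have "integral (cbox a b) (\<lambda>y. blinfun_inner_right (u y *\<^sub>R g (x - y))) =
      blinfun_inner_right (integral (cbox a b) (\<lambda>y. u y *\<^sub>R g (x - y)))"
    using integral_linear[OF integrable_continuous[OF cont] bounded_linear_blinfun_inner_right]
    by (simp add: o_def)
  ultimately show ?thesis unfolding gderiv_def
    by (auto elim!: has_derivative_eq_rhs simp: fun_eq_iff inner_commute)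
qed

lemma integral_vec_nth:
  fixes f :: "'a::euclidean_space \<Rightarrow> 'b::euclidean_space^'n"
  assumes "continuous_on (cbox a b) f"
  shows "integral (cbox a b) f $ i = integral (cbox a b) (\<lambda>y. f y $ i)"
  using integral_linear[OF integrable_continuous[OF assms] bounded_linear_vec_nth, of i] by (simp add: o_def)

text \<open>Differentiation under the integral twice, the second time for each component of the
  gradient.\<close>

lemma C2_parametric_integral:
  fixes k u :: "real^'n \<Rightarrow> real"
  assumes k: "C2 k G H" and u: "continuous_on UNIV u"
  shows "C2 (\<lambda>x. integral (cbox a b) (\<lambda>y. k (x - y) * u y))
    (\<lambda>x. integral (cbox a b) (\<lambda>y. u y *\<^sub>R G (x - y))) (\<lambda>x. integral (cbox a b) (\<lambda>y. u y *\<^sub>R H (x - y)))"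
proof -
  have cG: "continuous_on S (\<lambda>y. u y *\<^sub>R G (x - y))" for x S
    by (intro continuous_intros continuous_on_compose2[OF C2_D(5)[OF k, of UNIV]] continuous_on_subset[OF u]) auto
  have cH: "continuous_on S (\<lambda>y. u y *\<^sub>R H (x - y))" for x S
    by (intro continuous_intros continuous_on_compose2[OF C2_D(4)[OF k, of UNIV]] continuous_on_subset[OF u]) auto
  have cHi: "continuous_on S (\<lambda>y. u y *\<^sub>R H (x - y) $ i)" for x S i
    by (intro continuous_intros continuous_on_compose2[OF C2_D(4)[OF k, of UNIV]] continuous_on_subset[OF u]) auto
  have G: "GDERIV (\<lambda>x. G x $ i) x :> H x $ i" for x i
  proof -
    have "((\<lambda>x. G x $ i) has_derivative (\<lambda>h. (H x *v h) $ i)) (at x)"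
      by (intro bounded_linear.has_derivative[OF bounded_linear_vec_nth] C2_D(2)[OF k])
    then show ?thesis by (simp add: gderiv_def matrix_vector_mult_def inner_vec_def mult.commute)
  qed
  have "continuous_on UNIV (\<lambda>x. H x $ i)" for i by (intro continuous_intros C2_D(4)[OF k])
  then have 1: "GDERIV (\<lambda>x. integral (cbox a b) (\<lambda>y. G (x - y) $ i * u y)) x :>
      integral (cbox a b) (\<lambda>y. u y *\<^sub>R H (x - y) $ i)" for i x
    by (intro GDERIV_parametric_integral G u)
  have comp: "((\<lambda>x. integral (cbox a b) (\<lambda>y. u y *\<^sub>R G (x - y)) $ i) has_derivative
      (\<lambda>h. (integral (cbox a b) (\<lambda>y. u y *\<^sub>R H (x - y)) *v h) $ i)) (at x)" for x i
  proof -
    have "((\<lambda>x. integral (cbox a b) (\<lambda>y. u y *\<^sub>R G (x - y)) $ i) has_derivative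
       (\<lambda>h. h \<bullet> integral (cbox a b) (\<lambda>y. u y *\<^sub>R H (x - y) $ i))) (at x)"
      using 1[of i x] unfolding gderiv_def by (simp add: integral_vec_nth[OF cG] mult.commute)
    moreover have "h \<bullet> integral (cbox a b) (\<lambda>y. u y *\<^sub>R H (x - y) $ i) =
        (integral (cbox a b) (\<lambda>y. u y *\<^sub>R H (x - y)) *v h) $ i" for h
      by (simp add: matrix_vector_mult_def inner_vec_def mult.commute integral_vec_nth[OF cH] integral_vec_nth[OF cHi])
    ultimately show ?thesis by simp
  qed
  have "((\<lambda>x. integral (cbox a b) (\<lambda>y. u y *\<^sub>R G (x - y))) has_derivative
      (\<lambda>h. integral (cbox a b) (\<lambda>y. u y *\<^sub>R H (x - y)) *v h)) (at x)" for x
  proof (subst has_derivative_componentwise_within, rule ballI)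
    fix e :: "real^'n" assume "e \<in> Basis"
    then obtain i where e: "e = axis i 1" by (auto simp: Basis_vec_def)
    show "((\<lambda>x. integral (cbox a b) (\<lambda>y. u y *\<^sub>R G (x - y)) \<bullet> e) has_derivative
      (\<lambda>h. (integral (cbox a b) (\<lambda>y. u y *\<^sub>R H (x - y)) *v h) \<bullet> e)) (at x)"
      using comp[of i x] by (simp add: e inner_axis)
  qed
  moreover have "transpose (integral (cbox a b) (\<lambda>y. u y *\<^sub>R H (x - y))) = integral (cbox a b) (\<lambda>y. u y *\<^sub>R H (x - y))" for x
  proof -
    have "H y $ i $ j = H y $ j $ i" for y i j
      using arg_cong[OF C2_D(3)[OF k, of y], of "\<lambda>X. X $ i $ j"] by (simp add: transpose_def)
    then show ?thesis
      by (simp add: vec_eq_iff transpose_def integral_vec_nth[OF cH] integral_vec_nth[OF cHi])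
  qed
  moreover have "continuous_on UNIV (\<lambda>x. integral (cbox a b) (\<lambda>y. u y *\<^sub>R H (x - y)))"
  proof (rule integral_continuous_on_param)
    show "continuous_on (UNIV \<times> cbox a b) (\<lambda>(x, y). u y *\<^sub>R H (x - y))"
      unfolding split_beta
      by (intro continuous_intros continuous_on_compose2[OF C2_D(4)[OF k, of UNIV]] continuous_on_compose2[OF u]) auto
  qed
  ultimately show ?thesis
    using GDERIV_parametric_integral[OF C2_D(1)[OF k] C2_D(5)[OF k] u] by (auto simp: C2_def)
qed

text \<open>The factor 2 under the root normalises the flow to the equation with the full Laplacian.
  The form as an expectation is the one in which \<xi> can be paired with -\<xi>.\<close>

definition heat :: "(real^'n \<Rightarrow> real) \<Rightarrow> real^'n \<Rightarrow> real \<Rightarrow> real" where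
  "heat u y t = (\<integral>\<xi>. gauss_density \<xi> * u (y - sqrt (2 * t) *\<^sub>R \<xi>) \<partial>lborel)"

lemma gauss_density_continuous: "continuous_on S (gauss_density :: real^'n \<Rightarrow> real)"
  unfolding gauss_density_eq by (intro continuous_intros) auto

text \<open>The substitution z = y - sqrt (2 t) \<xi> moves y and t from u into the kernel, over a
  box independent of both, so smoothness becomes a matter of the kernel.\<close>

lemma heat_kernel_formula:
  fixes u :: "real^'n \<Rightarrow> real"
  assumes u: "continuous_on UNIV u" and z: "\<And>y. y \<notin> cbox a b \<Longrightarrow> u y = 0" and t: "t > 0"
  shows "heat u y t = (1 / sqrt (4 * pi * t)) ^ CARD('n) *
    integral (cbox a b) (\<lambda>z. exp (- ((y - z) \<bullet> (y - z)) / (4 * t)) * u z)"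
proof -
  define r where "r = sqrt (2 * t)"
  have r: "r > 0" "r^2 = 2 * t" using t by (auto simp: r_def)
  let ?f = "\<lambda>\<xi>. gauss_density \<xi> * u (y - r *\<^sub>R \<xi>)"
  have cf: "continuous_on UNIV ?f"
    by (intro continuous_intros gauss_density_continuous continuous_on_compose2[OF u]) auto
  then have "?f \<in> borel_measurable borel" by (rule borel_measurable_continuous_onI)
  then have "(\<integral>x. ?f ((1/r) *\<^sub>R y + (- 1/r) *\<^sub>R x) \<partial>lborel) * \<bar>- 1/r\<bar> ^ DIM(real^'n) = (\<integral>x. ?f x \<partial>lborel)"
    by (intro lborel_integral_affine) (use r in auto)
  moreover have "?f ((1/r) *\<^sub>R y + (- 1/r) *\<^sub>R x) = gauss_density ((1/r) *\<^sub>R (y - x)) * u x" for x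
    using r by (simp add: algebra_simps scaleR_add_right)
  ultimately have "heat u y t = (\<integral>x. gauss_density ((1/r) *\<^sub>R (y - x)) * u x \<partial>lborel) * (1/r) ^ CARD('n)"
    using r by (simp add: heat_def r_def[symmetric])
  also have "(\<integral>x. gauss_density ((1/r) *\<^sub>R (y - x)) * u x \<partial>lborel) =
      integral (cbox a b) (\<lambda>x. gauss_density ((1/r) *\<^sub>R (y - x)) * u x)"
    by (rule integrable_compact_support)
      (auto simp: z intro!: continuous_intros u continuous_on_compose2[OF gauss_density_continuous[of UNIV]])
  also have "(\<lambda>x. gauss_density ((1/r) *\<^sub>R (y - x)) * u x) =
      (\<lambda>x. (1 / sqrt (2 * pi)) ^ CARD('n) * (exp (- ((y - x) \<bullet> (y - x)) / (4 * t)) * u x))"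
  proof
    fix x
    have "((1/r) *\<^sub>R (y - x)) \<bullet> ((1/r) *\<^sub>R (y - x)) = ((y - x) \<bullet> (y - x)) / (2 * t)"
      using r(2) by (simp add: power2_eq_square)
    then show "gauss_density ((1/r) *\<^sub>R (y - x)) * u x =
        (1 / sqrt (2 * pi)) ^ CARD('n) * (exp (- ((y - x) \<bullet> (y - x)) / (4 * t)) * u x)"
      unfolding gauss_density_eq by simp
  qed
  also have "integral (cbox a b) \<dots> = (1 / sqrt (2 * pi)) ^ CARD('n) *
     integral (cbox a b) (\<lambda>x. exp (- ((y - x) \<bullet> (y - x)) / (4 * t)) * u x)"
    by (rule integral_mult_right)
  also have "\<dots> * (1/r) ^ CARD('n) = ((1 / sqrt (2 * pi)) * (1 / r)) ^ CARD('n) *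
     integral (cbox a b) (\<lambda>x. exp (- ((y - x) \<bullet> (y - x)) / (4 * t)) * u x)"
    by (simp only: power_mult_distrib mult_ac)
  also have "(1 / sqrt (2 * pi)) * (1 / r) = 1 / sqrt (4 * pi * t)"
    unfolding r_def by (simp add: real_sqrt_mult[symmetric] mult_ac)
  finally show ?thesis .
qed

lemma heat_continuous:
  fixes u :: "real^'n \<Rightarrow> real"
  assumes u: "continuous_on UNIV u" and z: "\<And>y. y \<notin> cbox a b \<Longrightarrow> u y = 0"
  shows "continuous_on (UNIV \<times> {0<..}) (\<lambda>(y, t). heat u y t)"
proof -
  have "continuous_on (UNIV \<times> {0<..}) (\<lambda>p::(real^'n) \<times> real. (1 / sqrt (4 * pi * snd p)) ^ CARD('n) *
    integral (cbox a b) (\<lambda>z. exp (- ((fst p - z) \<bullet> (fst p - z)) / (4 * snd p)) * u z))"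
  proof (intro continuous_on_mult integral_continuous_on_param)
    show "continuous_on (UNIV \<times> {0<..}) (\<lambda>p::(real^'n) \<times> real. (1 / sqrt (4 * pi * snd p)) ^ CARD('n))"
      by (intro continuous_intros) auto
    show "continuous_on ((UNIV \<times> {0<..}) \<times> cbox a b)
        (\<lambda>(p, z). exp (- ((fst p - z) \<bullet> (fst p - z)) / (4 * snd p)) * u z)"
      unfolding split_beta
      by (intro continuous_intros continuous_on_compose2[OF u]) auto
  qed
  then show ?thesis
    by (rule continuous_on_eq) (use heat_kernel_formula[OF u z] in auto)
qed

text \<open>Differentiating in time gives the factor |y - z|^2 / (4 t^2) from the exponential and -
  n / (2 t) from the normalisation; the trace of the Hessian of the kernel produces the same two
  terms.\<close>

lemma heat_equation:
  fixes u :: "real^'n \<Rightarrow> real"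
  assumes u: "continuous_on UNIV u" and z: "\<And>y. y \<notin> cbox a b \<Longrightarrow> u y = 0" and t: "t > 0"
  obtains G H where "C2 (\<lambda>y. heat u y t) G H" "\<And>y. DERIV (\<lambda>s. heat u y s) t :> trace (H y)"
proof -
  define c where "c s = (1 / sqrt (4 * pi * s)) ^ CARD('n)" for s
  define \<psi> where "\<psi> r = exp (- r / (4 * t))" for r
  define k where "k x = \<psi> (x \<bullet> x)" for x :: "real^'n"
  define Gk where "Gk x = (2 * (- 1 / (4 * t) * \<psi> (x \<bullet> x))) *\<^sub>R x" for x :: "real^'n"
  define Hk where "Hk x = mat (2 * (- 1 / (4 * t) * \<psi> (x \<bullet> x))) + (4 * (1 / (4 * t)^2 * \<psi> (x \<bullet> x))) *\<^sub>R outer x" for x :: "real^'n"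
  have C2k: "C2 k Gk Hk"
    unfolding k_def Gk_def Hk_def
  proof (rule C2_radial)
    show "DERIV \<psi> r :> - 1 / (4 * t) * \<psi> r" for r
      unfolding \<psi>_def using t by (auto intro!: derivative_eq_intros)
    show "DERIV (\<lambda>r. - 1 / (4 * t) * \<psi> r) r :> 1 / (4 * t)^2 * \<psi> r" for r
      unfolding \<psi>_def using t by (auto intro!: derivative_eq_intros simp: power2_eq_square)
    show "continuous_on UNIV (\<lambda>r. 1 / (4 * t)^2 * \<psi> r)"
      unfolding \<psi>_def by (intro continuous_intros) (use t in auto)
  qed
  have form: "heat u y s = c s * integral (cbox a b) (\<lambda>z. exp (- ((y - z) \<bullet> (y - z)) / (4 * s)) * u z)" if "s > 0" for y s
    using heat_kernel_formula[OF u z that] by (simp add: c_def)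
  have heat_k: "heat u y t = c t * integral (cbox a b) (\<lambda>z. k (y - z) * u z)" for y
    using form[OF t] by (simp add: k_def \<psi>_def)
  define G where "G y = c t *\<^sub>R integral (cbox a b) (\<lambda>z. u z *\<^sub>R Gk (y - z))" for y
  define H where "H y = c t *\<^sub>R integral (cbox a b) (\<lambda>z. u z *\<^sub>R Hk (y - z))" for y
  have C2: "C2 (\<lambda>y. heat u y t) G H"
    unfolding heat_k G_def H_def by (rule C2_scale[OF C2_parametric_integral[OF C2k u]])
  have cHk: "continuous_on (cbox a b) (\<lambda>z. u z *\<^sub>R Hk (y - z))" for y
    by (intro continuous_intros continuous_on_compose2[OF C2_D(4)[OF C2k, of UNIV]] continuous_on_subset[OF u]) auto
  have bl: "bounded_linear (trace :: real^'n^'n \<Rightarrow> real)"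
    unfolding trace_def linear_conv_bounded_linear[symmetric]
    by (rule linearI) (simp_all add: sum.distrib sum_distrib_left)
  have trHk: "trace (Hk x) = k x * ((x \<bullet> x) / (4 * t^2) - CARD('n) / (2 * t))" for x
  proof -
    have "trace (outer x) = x \<bullet> x" by (simp add: trace_def outer_def inner_vec_def)
    moreover have "trace (mat a :: real^'n^'n) = CARD('n) * a" for a :: real by (simp add: trace_def mat_def)
    moreover have "trace (A + s *\<^sub>R B) = trace A + s * trace B" for A B :: "real^'n^'n" and s
      by (simp add: trace_def sum.distrib sum_distrib_left)
    ultimately show ?thesis
      unfolding Hk_def using t by (simp add: k_def field_simps power2_eq_square)
  qed
  have trH: "trace (H y) = c t * integral (cbox a b) (\<lambda>z. k (y - z) * (((y - z) \<bullet> (y - z)) / (4 * t^2) - CARD('n) / (2 * t)) * u z)" for y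
  proof -
    have "trace (H y) = c t * trace (integral (cbox a b) (\<lambda>z. u z *\<^sub>R Hk (y - z)))"
      using linear_scale[OF bounded_linear.linear[OF bl]] by (simp add: H_def)
    also have "trace (integral (cbox a b) (\<lambda>z. u z *\<^sub>R Hk (y - z))) = integral (cbox a b) (\<lambda>z. trace (u z *\<^sub>R Hk (y - z)))"
      using integral_linear[OF integrable_continuous[OF cHk] bl] by (simp add: o_def)
    also have "(\<lambda>z. trace (u z *\<^sub>R Hk (y - z))) = (\<lambda>z. k (y - z) * (((y - z) \<bullet> (y - z)) / (4 * t^2) - CARD('n) / (2 * t)) * u z)"
      by (simp add: linear_scale[OF bounded_linear.linear[OF bl]] trHk mult_ac)
    finally show ?thesis .
  qed
  have "DERIV (\<lambda>s. heat u y s) t :> trace (H y)" for y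
  proof -
    define W where "W s = integral (cbox a b) (\<lambda>z. exp (- ((y - z) \<bullet> (y - z)) / (4 * s)) * u z)" for s
    define W' where "W' = integral (cbox a b) (\<lambda>z. exp (- ((y - z) \<bullet> (y - z)) / (4 * t)) * (((y - z) \<bullet> (y - z)) / (4 * t^2)) * u z)"
    have "((\<lambda>s. W s) has_field_derivative W') (at t within {0<..})"
      unfolding W_def W'_def
    proof (rule leibniz_rule_field_derivative)
      fix s :: real and z :: "real^'n" assume s: "s \<in> {0<..}"
      show "((\<lambda>s. exp (- ((y - z) \<bullet> (y - z)) / (4 * s)) * u z) has_field_derivative
          exp (- ((y - z) \<bullet> (y - z)) / (4 * s)) * (((y - z) \<bullet> (y - z)) / (4 * s^2)) * u z) (at s within {0<..})"
        using s by (auto intro!: derivative_eq_intros simp: power2_eq_square field_simps)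
      show "(\<lambda>z. exp (- ((y - z) \<bullet> (y - z)) / (4 * s)) * u z) integrable_on cbox a b"
        by (intro integrable_continuous continuous_intros continuous_on_subset[OF u]) (use s in auto)
    next
      show "continuous_on ({0<..} \<times> cbox a b)
         (\<lambda>(s, z). exp (- ((y - z) \<bullet> (y - z)) / (4 * s)) * (((y - z) \<bullet> (y - z)) / (4 * s^2)) * u z)"
        unfolding split_beta by (intro continuous_intros continuous_on_compose2[OF u]) auto
    qed (use t in auto)
    then have W: "DERIV W t :> W'" using t by (simp add: at_within_open[of t "{0<..}"])
    have c: "DERIV c t :> c t * (- CARD('n) / (2 * t))"
    proof -
      let ?a = "\<lambda>s. 1 / sqrt (4 * pi * s)"
      have "DERIV ?a t :> - (1 / (2 * t)) * ?a t"
      proof -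
        have "sqrt (4 * pi * t) > 0" "sqrt (4 * pi * t) * sqrt (4 * pi * t) = 4 * pi * t" using t by auto
        moreover have "\<not> pi * t < 0" using mult_pos_pos[OF pi_gt_zero t] by linarith
        ultimately show ?thesis
          using t by (auto intro!: derivative_eq_intros simp: field_simps)
      qed
      then have "DERIV (\<lambda>s. ?a s ^ CARD('n)) t :> real CARD('n) * (- (1 / (2 * t)) * ?a t * ?a t ^ (CARD('n) - Suc 0))"
        by (rule DERIV_power)
      moreover have "real CARD('n) * (- (1 / (2 * t)) * ?a t * ?a t ^ (CARD('n) - Suc 0)) = c t * (- CARD('n) / (2 * t))"
      proof -
        have "?a t * ?a t ^ (CARD('n) - Suc 0) = c t"
          unfolding c_def using power_minus_mult[of "CARD('n)" "?a t"] by (simp only: zero_less_card_finite mult.commute One_nat_def)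
        moreover have "real CARD('n) * (- (1 / (2 * t)) * x * y) = (x * y) * (- CARD('n) / (2 * t))" for x y :: real
          by simp
        ultimately show ?thesis by metis
      qed
      ultimately show ?thesis unfolding c_def by simp
    qed
    have "DERIV (\<lambda>s. c s * W s) t :> c t * (- CARD('n) / (2 * t)) * W t + W' * c t"
      by (rule DERIV_mult[OF c W])
    moreover have "c t * (- CARD('n) / (2 * t)) * W t + W' * c t = trace (H y)"
    proof -
      have i1: "(\<lambda>z. exp (- ((y - z) \<bullet> (y - z)) / (4 * t)) * u z) integrable_on cbox a b"
        and i2: "(\<lambda>z. exp (- ((y - z) \<bullet> (y - z)) / (4 * t)) * (((y - z) \<bullet> (y - z)) / (4 * t^2)) * u z) integrable_on cbox a b"
        by (intro integrable_continuous continuous_intros continuous_on_subset[OF u]; use t in auto)+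
      define E where "E z = exp (- ((y - z) \<bullet> (y - z)) / (4 * t))" for z
      define R where "R z = ((y - z) \<bullet> (y - z)) / (4 * t^2)" for z
      have "k (y - z) * (R z - CARD('n) / (2 * t)) * u z = E z * R z * u z + (- CARD('n) / (2 * t)) * (E z * u z)" for z
      proof -
        have "k (y - z) = E z" by (simp add: k_def \<psi>_def E_def)
        then show ?thesis by (simp add: left_diff_distrib right_diff_distrib)
      qed
      then have "trace (H y) = c t * integral (cbox a b) (\<lambda>z. E z * R z * u z + (- CARD('n) / (2 * t)) * (E z * u z))"
        unfolding trH R_def[symmetric] by simp
      also have "integral (cbox a b) (\<lambda>z. E z * R z * u z + (- CARD('n) / (2 * t)) * (E z * u z)) =
          integral (cbox a b) (\<lambda>z. E z * R z * u z) + integral (cbox a b) (\<lambda>z. (- CARD('n) / (2 * t)) * (E z * u z))"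
        by (intro integral_add integrable_on_mult_right i1[folded E_def] i2[folded E_def R_def])
      also have "integral (cbox a b) (\<lambda>z. (- CARD('n) / (2 * t)) * (E z * u z)) = (- CARD('n) / (2 * t)) * W t"
        unfolding W_def E_def by (rule integral_mult_right)
      also have "integral (cbox a b) (\<lambda>z. E z * R z * u z) = W'" by (simp only: W'_def E_def R_def)
      finally have "trace (H y) = c t * (W' + (- CARD('n) / (2 * t)) * W t)" .
      then show ?thesis by (simp add: algebra_simps)
    qed
    ultimately have "DERIV (\<lambda>s. c s * W s) t :> trace (H y)" by simp
    then show ?thesis
      by (rule DERIV_cong_ev[THEN iffD1, rotated -1, OF _ refl _ refl])
        (use t form in \<open>auto simp: W_def eventually_nhds intro!: exI[of _ "{0<..}"]\<close>)
  qed
  with C2 show thesis by (rule that)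
qed

section \<open>Lower bounds for the heat evolution of a subsolution\<close>

lemma C2_norm_square:
  "C2 (\<lambda>x::real^'n. (x - b) \<bullet> (x - b)) (\<lambda>x. 2 *\<^sub>R (x - b)) (\<lambda>_. mat 2)"
proof -
  have "transpose (mat 2 :: real^'n^'n) = mat 2" by (simp add: transpose_def mat_def vec_eq_iff)
  from C2_translate[OF C2_quadratic[OF this, of 0 0], of "- b"]
  show ?thesis by (simp add: mat_mult_vec)
qed

lemma trace_plus: "trace (A + B) = trace A + trace (B :: real^'n^'n)"
  by (simp add: trace_def sum.distrib)

lemma trace_scaleR: "trace (s *\<^sub>R B) = s * trace (B :: real^'n^'n)"
  by (simp add: trace_def sum_distrib_left)

lemma trace_mat: "trace (mat a :: real^'n^'n) = CARD('n) * a" for a :: real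
  by (simp add: trace_def mat_def)

text \<open>The expectation of |\<xi>|^4, a constant depending on the dimension only; the type
  argument carries the dimension.\<close>

definition gauss_m4 :: "'n::finite itself \<Rightarrow> real" where
  "gauss_m4 _ = (\<integral>\<xi>. gauss_density (\<xi>::real^'n) * (norm \<xi>)^4 \<partial>lborel)"

lemma gauss_m4_nonneg: "0 \<le> gauss_m4 TYPE('n::finite)"
  unfolding gauss_m4_def by (intro integral_nonneg_AE AE_I2) (simp add: gauss_density_nonneg)

lemma integrable_gauss_bounded:
  fixes h :: "real^'n \<Rightarrow> real"
  assumes h: "continuous_on UNIV h" and B: "\<And>\<xi>. \<bar>h \<xi>\<bar> \<le> B"
  shows "integrable lborel (\<lambda>\<xi>. gauss_density \<xi> * h \<xi>)"
proof (rule Bochner_Integration.integrable_bound)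
  show "integrable lborel (\<lambda>\<xi>::real^'n. B * gauss_density \<xi>)"
    by (intro integrable_mult_right gauss_integral)
  have [measurable]: "h \<in> borel_measurable borel" using h by (rule borel_measurable_continuous_onI)
  show "(\<lambda>\<xi>. gauss_density \<xi> * h \<xi>) \<in> borel_measurable lborel" by measurable
  have "0 \<le> B" using B[of 0] by linarith
  then show "AE \<xi> in lborel. norm (gauss_density \<xi> * h \<xi>) \<le> norm (B * gauss_density \<xi>)"
    using B by (intro AE_I2) (simp add: abs_mult gauss_density_nonneg mult.commute[of B] mult_left_mono)
qed

text \<open>Pairing \<xi> with -\<xi> gives the bound as long as the displacement stays within d.
  Beyond d, u y \<le> M is paid for by M (|displacement| / d)^4, whose expectation is of order
  t^2.\<close>

lemma heat_midpoint_lower_bound: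
  fixes u :: "real^'n \<Rightarrow> real"
  assumes u: "continuous_on UNIV u" "\<And>y. 0 \<le> u y" "\<And>y. u y \<le> M"
    and d: "d > 0" and mid: "\<And>s. norm s \<le> d \<Longrightarrow> 2 * u y \<le> u (y + s) + u (y - s)" and t: "t > 0"
  shows "u y \<le> heat u y t + 4 * gauss_m4 TYPE('n) * M / d^4 * t^2"
proof -
  define r where "r = sqrt (2 * t)"
  have r: "r > 0" "r^2 = 2 * t" using t by (auto simp: r_def)
  have r4: "r^4 = 4 * t^2" using r(2) power_mult[of r 2 2] by (simp add: power_mult_distrib)
  have M: "0 \<le> M" using u(2,3) order_trans by blast
  have c1: "continuous_on UNIV (\<lambda>\<xi>. u (y - r *\<^sub>R \<xi>))" "continuous_on UNIV (\<lambda>\<xi>. u (y + r *\<^sub>R \<xi>))"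
    by (intro continuous_on_compose2[OF u(1)] continuous_intros; simp)+
  have i1: "integrable lborel (\<lambda>\<xi>. gauss_density \<xi> * u (y - r *\<^sub>R \<xi>))"
    and i2: "integrable lborel (\<lambda>\<xi>. gauss_density \<xi> * u (y + r *\<^sub>R \<xi>))"
    by (intro integrable_gauss_bounded[where B=M] c1; simp add: u)+
  have "(\<lambda>\<xi>. gauss_density \<xi> * u (y + r *\<^sub>R \<xi>)) \<in> borel_measurable borel"
    using i2 by simp
  from lborel_integral_reflect(2)[OF this, of 0]
  have refl: "(\<integral>\<xi>. gauss_density \<xi> * u (y + r *\<^sub>R \<xi>) \<partial>lborel) = heat u y t"
    by (simp add: heat_def r_def gauss_density_eq)
  define K where "K = 2 * M * r^4 / d^4"
  have K: "K \<ge> 0" using M d by (simp add: K_def)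
  have "gauss_density \<xi> * (2 * u y) - K * (gauss_density \<xi> * (norm \<xi>)^4) \<le>
      gauss_density \<xi> * u (y - r *\<^sub>R \<xi>) + gauss_density \<xi> * u (y + r *\<^sub>R \<xi>)" for \<xi>
  proof -
    have "2 * u y - K * (norm \<xi>)^4 \<le> u (y - r *\<^sub>R \<xi>) + u (y + r *\<^sub>R \<xi>)"
    proof (cases "norm (r *\<^sub>R \<xi>) \<le> d")
      case True
      have "0 \<le> K * (norm \<xi>)^4" using K by simp
      then show ?thesis using mid[OF True] by linarith
    next
      case False
      then have "d^4 \<le> (norm (r *\<^sub>R \<xi>))^4" using d by (intro power_mono) auto
      then have "d^4 \<le> r^4 * (norm \<xi>)^4" using r by (simp add: power_mult_distrib)
      then have "2 * M * 1 \<le> 2 * M * (r^4 * (norm \<xi>)^4 / d^4)"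
        using M d by (intro mult_left_mono) (auto simp: field_simps)
      then have "2 * M \<le> K * (norm \<xi>)^4" by (simp add: K_def mult_ac)
      then show ?thesis using u(2)[of "y - r *\<^sub>R \<xi>"] u(2)[of "y + r *\<^sub>R \<xi>"] u(3)[of y] by linarith
    qed
    from mult_left_mono[OF this gauss_density_nonneg[of \<xi>]] show ?thesis by (simp add: algebra_simps)
  qed
  moreover have "integrable lborel (\<lambda>\<xi>::real^'n. gauss_density \<xi> * (2 * u y) - K * (gauss_density \<xi> * (norm \<xi>)^4))"
    by (intro Bochner_Integration.integrable_diff integrable_mult_left integrable_mult_right gauss_integral gauss_fourth_moment)
  moreover have "integrable lborel (\<lambda>\<xi>. gauss_density \<xi> * u (y - r *\<^sub>R \<xi>) + gauss_density \<xi> * u (y + r *\<^sub>R \<xi>))"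
    by (intro Bochner_Integration.integrable_add i1 i2)
  ultimately have "(\<integral>\<xi>. gauss_density (\<xi>::real^'n) * (2 * u y) - K * (gauss_density \<xi> * (norm \<xi>)^4) \<partial>lborel) \<le>
     (\<integral>\<xi>. gauss_density \<xi> * u (y - r *\<^sub>R \<xi>) + gauss_density \<xi> * u (y + r *\<^sub>R \<xi>) \<partial>lborel)"
    by (auto intro: Bochner_Integration.integral_mono)
  also have "\<dots> = 2 * heat u y t"
  proof -
    have "(\<integral>\<xi>. gauss_density \<xi> * u (y - r *\<^sub>R \<xi>) \<partial>lborel) = heat u y t" by (simp add: heat_def r_def)
    then show ?thesis unfolding Bochner_Integration.integral_add[OF i1 i2] refl by simp
  qed
  also have "(\<integral>\<xi>. gauss_density (\<xi>::real^'n) * (2 * u y) - K * (gauss_density \<xi> * (norm \<xi>)^4) \<partial>lborel) =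
      2 * u y - K * gauss_m4 TYPE('n)"
    by (subst Bochner_Integration.integral_diff)
      (auto simp: gauss_m4_def gauss_integral intro!: integrable_mult_left integrable_mult_right gauss_integral gauss_fourth_moment)
  finally have "u y \<le> heat u y t + K / 2 * gauss_m4 TYPE('n)" by simp
  moreover have "K / 2 * gauss_m4 TYPE('n) = 4 * gauss_m4 TYPE('n) * M / d^4 * t^2"
    unfolding K_def r4 by (simp add: mult_ac)
  ultimately show ?thesis by (simp only:)
qed

text \<open>Maximum principle on a cylinder: $u + c\,q - K t^2$ is compared with the heat evolution of $u$, which is a smooth
  test function at positive times. The midpoint convexity makes the comparison hold on the lateral boundary and for small times.\<close>

lemma heat_lower_bound:
  fixes u :: "real^'n \<Rightarrow> real"
  assumes u: "continuous_on UNIV u" "\<And>y. 0 \<le> u y" "\<And>y. u y \<le> M" and z: "\<And>y. y \<notin> cbox a b \<Longrightarrow> u y = 0"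
    and d: "d > 0" and mid: "\<And>y s. y \<in> cball y0 d \<Longrightarrow> norm s \<le> d \<Longrightarrow> 2 * u y \<le> u (y + s) + u (y - s)"
    and c: "c \<ge> 0" and test: "test_above u (ball y0 d) (\<lambda>z p X. c \<le> trace X)" and t: "t > 0"
  shows "u y0 + c * (t - CARD('n) / d^2 * t^2) - (4 * gauss_m4 TYPE('n) * M / d^4 + 1) * t^2 \<le> heat u y0 t"
proof (rule ccontr)
  assume neg: "\<not> ?thesis"
  \<comment> \<open>Half the Laplacian 2 n / d^2 of |y - y0|^2 / d^2. With this value the time
    derivative of A s^2 exactly offsets the Laplacian of the cut-off term in
    \<open>q\<close>.\<close>
  define A where "A = CARD('n) / d^2"
  define K0 where "K0 = 4 * gauss_m4 TYPE('n) * M / d^4"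
  \<comment> \<open>\<open>K0\<close> pays for the error in
    \<open>heat_midpoint_lower_bound\<close>; the extra 1 makes the differential inequality
    strict.\<close>
  define K where "K = K0 + 1"
  have M: "0 \<le> M" using u(2,3) order_trans by blast
  have K: "K \<ge> 1" using M d gauss_m4_nonneg[where 'n='n] by (simp add: K_def K0_def)
  define q where "q y s = s * (1 - ((y - y0) \<bullet> (y - y0)) / d^2) - A * s^2" for y s
  define D where "D y s = u y + c * q y s - heat u y s - K * s^2" for y s
  define m where "m = D y0 t"
  have "D y0 t = u y0 + c * (t - A * t^2) - K * t^2 - heat u y0 t" by (simp add: D_def q_def)
  then have m: "m > 0" using neg by (simp add: m_def A_def K_def K0_def)
  have bound: "D y s \<le> c * q y s" if "y \<in> cball y0 d" "s > 0" for y s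
  proof -
    have "u y \<le> heat u y s + K0 * s^2"
      unfolding K0_def using that by (intro heat_midpoint_lower_bound u d mid)
    moreover have "K * s^2 = K0 * s^2 + s^2" by (simp add: K_def algebra_simps)
    ultimately show ?thesis unfolding D_def using zero_le_power2[of s] by linarith
  qed
  have A: "A \<ge> 0" by (simp add: A_def)
  have q_le: "q y s \<le> s" if "s > 0" for y s
  proof -
    have "0 \<le> s * (((y - y0) \<bullet> (y - y0)) / d^2)" "0 \<le> A * s^2" using that A by auto
    then show ?thesis by (simp add: q_def algebra_simps)
  qed
  \<comment> \<open>A positive starting time at which \<open>D\<close> is still below
    \<open>m\<close>: continuity of the heat flow has been established for positive times.\<close>
  define s0 where "s0 = min (t / 2) (m / (2 * (c + 1)))"
  have "s0 > 0" using t m c by (simp add: s0_def)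
  moreover have "s0 \<le> t / 2" unfolding s0_def by (rule min.cobounded1)
  ultimately have s0: "s0 > 0" "s0 < t" using t by auto
  have cs0: "c * s0 < m"
  proof -
    have "c * s0 \<le> c * (m / (2 * (c + 1)))" using c by (intro mult_left_mono) (auto simp: s0_def)
    also have "\<dots> \<le> m / 2" using c m by (simp add: field_simps)
    finally show ?thesis using m by simp
  qed
  let ?S = "cball y0 d \<times> {s0..t}"
  have "continuous_on ?S (\<lambda>(y, s). D y s)"
  proof -
    have "continuous_on ?S (\<lambda>(y, s). heat u y s)"
      by (rule continuous_on_subset[OF heat_continuous[OF u(1) z]]) (use s0 in auto)
    then have "continuous_on ?S (\<lambda>p. heat u (fst p) (snd p))" by (simp add: split_beta)
    moreover have "continuous_on ?S (\<lambda>p. u (fst p))"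
      by (intro continuous_on_compose2[OF u(1)] continuous_intros) auto
    ultimately show ?thesis unfolding D_def q_def split_beta 
      by (intro continuous_intros) (use d in auto)
  qed
  moreover have "compact ?S" "?S \<noteq> {}" using s0 d by (auto intro: compact_Times)
  ultimately obtain p where p: "p \<in> ?S" "\<And>p'. p' \<in> ?S \<Longrightarrow> (\<lambda>(y, s). D y s) p' \<le> (\<lambda>(y, s). D y s) p"
    using continuous_attains_sup[of ?S "\<lambda>(y, s). D y s"] by blast
  obtain y1 t1 where pe: "p = (y1, t1)" by (cases p)
  have y1: "y1 \<in> cball y0 d" and t1: "s0 \<le> t1" "t1 \<le> t" using p(1) pe by auto
  have max: "D y s \<le> D y1 t1" if "y \<in> cball y0 d" "s0 \<le> s" "s \<le> t" for y s
    using p(2)[of "(y, s)"] that pe by auto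
  have Dpos: "D y1 t1 \<ge> m" unfolding m_def by (rule max) (use d s0 in auto)
  have t1pos: "t1 > 0" using s0 t1 by simp
  have "t1 \<noteq> s0"
  proof
    assume "t1 = s0"
    then have "D y1 t1 \<le> c * s0" using bound[OF y1 t1pos] q_le[OF t1pos, of y1] c 
      by (meson mult_left_mono order_trans)
    then show False using Dpos cs0 by simp
  qed
  then have t1s0: "s0 < t1" using t1 by simp
  have "dist y0 y1 \<noteq> d"
  proof
    assume eq: "dist y0 y1 = d"
    have "(y1 - y0) \<bullet> (y1 - y0) = d^2"
      using eq by (simp add: dist_norm norm_minus_commute power2_norm_eq_inner[symmetric])
    then have "q y1 t1 = - A * t1^2" using d by (simp add: q_def)
    then have "q y1 t1 \<le> 0" using A by simp
    then have "c * q y1 t1 \<le> 0" using c by (simp add: mult_nonneg_nonpos)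
    then show False using bound[OF y1 t1pos] Dpos m by simp
  qed
  then have y1b: "y1 \<in> ball y0 d" using y1 by simp
  obtain G H where C: "C2 (\<lambda>y. heat u y t1) G H" and Ht: "\<And>y. DERIV (\<lambda>s. heat u y s) t1 :> trace (H y)"
    using heat_equation[OF u(1) z t1pos] by blast
  define \<zeta> where "\<zeta> = 1 - ((y1 - y0) \<bullet> (y1 - y0)) / d^2"
  have "DERIV (\<lambda>s. D y1 s) t1 :> c * (\<zeta> - 2 * A * t1) - trace (H y1) - 2 * K * t1"
    unfolding D_def q_def \<zeta>_def
    by (rule derivative_eq_intros Ht refl)+ (simp add: algebra_simps)
  \<comment> \<open>The maximum may sit at the final time t, so only earlier times are compared, and
    the time derivative is non-negative rather than zero.\<close>
  moreover have "0 \<le> c * (\<zeta> - 2 * A * t1) - trace (H y1) - 2 * K * t1"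
  proof (rule ccontr)
    assume "\<not> ?thesis"
    then obtain h where h: "h > 0" "\<And>e. e > 0 \<Longrightarrow> e < h \<Longrightarrow> D y1 t1 < D y1 (t1 - e)"
      using DERIV_neg_dec_left[OF calculation] by (auto simp: not_le)
    define e where "e = min (h/2) (t1 - s0)"
    have "e > 0" "e < h" "t1 - e \<ge> s0" using h(1) t1s0 by (auto simp: e_def)
    then show False using h(2)[of e] max[OF y1, of "t1 - e"] t1 by simp
  qed
  ultimately have time: "trace (H y1) \<le> c * (\<zeta> - 2 * A * t1) - 2 * K * t1" by simp
  let ?\<phi> = "\<lambda>y. heat u y t1 + (c * t1 / d^2) * ((y - y0) \<bullet> (y - y0))"
  have C\<phi>: "C2 ?\<phi> (\<lambda>y. G y + (c * t1 / d^2) *\<^sub>R (2 *\<^sub>R (y - y0))) (\<lambda>y. H y + (c * t1 / d^2) *\<^sub>R mat 2)"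
    by (intro C2_add C C2_scale C2_norm_square)
  have \<phi>D: "u y - ?\<phi> y = D y t1 - c * t1 + c * A * t1^2 + K * t1^2" for y
  proof -
    have "c * (t1 * (1 - X / d^2) - A * t1^2) = c * t1 - (c * t1 / d^2) * X - c * A * t1^2" for X
      by (simp add: algebra_simps)
    then show ?thesis unfolding D_def q_def by simp
  qed
  have "\<forall>\<^sub>F y in at y1. y \<in> ball y0 d"
    by (intro eventually_at_in_open' y1b open_ball)
  then have "\<forall>\<^sub>F y in at y1. u y - ?\<phi> y \<le> u y1 - ?\<phi> y1"
    unfolding \<phi>D by eventually_elim (use max t1 in auto)
  then have "c \<le> trace (H y1 + (c * t1 / d^2) *\<^sub>R mat 2)"
    using test C\<phi> y1b unfolding test_above_def by blast
  then have "c \<le> trace (H y1) + 2 * c * A * t1"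
    by (simp add: trace_plus trace_scaleR trace_mat A_def mult_ac)
  then have "c \<le> c * \<zeta> - 2 * K * t1" using time by (simp add: algebra_simps)
  moreover have "c * \<zeta> \<le> c * 1" using c by (intro mult_left_mono) (auto simp: \<zeta>_def)
  moreover have "K * t1 > 0" using K t1pos by simp
  ultimately show False by linarith
qed

section \<open>Mollification\<close>

lemma DERIV_pos_part_square: "DERIV (\<lambda>x. x * max 0 x) x :> 2 * max 0 (x::real)"
proof -
  consider "x < 0" | "x = 0" | "x > 0" by linarith
  then show ?thesis
  proof cases
    case 1
    have "DERIV (\<lambda>_. 0) x :> 2 * max 0 x" using 1 by simp
    then show ?thesis
      by (rule has_field_derivative_transform_within_open[of _ _ _ "{..<0}"]) (use 1 in auto)
  next
    case 2
    have "((\<lambda>h. max 0 h) \<longlongrightarrow> 0) (at (0::real))" 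
      using tendsto_max[OF tendsto_const tendsto_ident_at, of 0 0 UNIV] by simp
    moreover have "\<forall>\<^sub>F h in at (0::real). max 0 h = (h * max 0 h - 0) / h"
      by (simp add: eventually_at_filter)
    ultimately have "((\<lambda>h. (h * max 0 h - 0) / h) \<longlongrightarrow> 0) (at (0::real))"
      by (rule Lim_transform_eventually)
    then show ?thesis using 2 by (simp add: has_field_derivative_iff)
  next
    case 3
    have "DERIV (\<lambda>x. x * x) x :> 2 * max 0 x" using 3 by (auto intro!: derivative_eq_intros)
    then show ?thesis
      by (rule has_field_derivative_transform_within_open[of _ _ _ "{0<..}"]) (use 3 in auto)
  qed
qed

lemma DERIV_pos_part_cube: "DERIV (\<lambda>x. x * (x * max 0 x)) x :> 3 * (x * max 0 (x::real))"
  using DERIV_mult[OF DERIV_ident DERIV_pos_part_square[of x]] by (simp add: algebra_simps)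

text \<open>Class C^2 is the regularity asked of the mollified function. Evenness makes linear
  functions average to zero and makes mollification increase midpoint convex functions.\<close>

definition mollifier :: "real \<Rightarrow> (real^'n \<Rightarrow> real) \<Rightarrow> (real^'n \<Rightarrow> real^'n) \<Rightarrow> (real^'n \<Rightarrow> real^'n^'n) \<Rightarrow> bool" where
  "mollifier \<eta> \<rho> G H \<longleftrightarrow> C2 \<rho> G H \<and> (\<forall>x. 0 \<le> \<rho> x) \<and> (\<forall>x. \<rho> (- x) = \<rho> x) \<and>
     (\<forall>x. \<eta> \<le> norm x \<longrightarrow> \<rho> x = 0) \<and> (\<integral>x. \<rho> x \<partial>lborel) = 1"

lemma cball_subset_cbox_symmetric: "cball (0::real^'n) r \<subseteq> cbox (\<chi> i. - r) (\<chi> i. r)"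
proof
  fix x :: "real^'n" assume "x \<in> cball 0 r"
  then have "\<bar>x $ i\<bar> \<le> r" for i using component_le_norm_cart[of x i] by simp
  then show "x \<in> cbox (\<chi> i. - r) (\<chi> i. r)" by (auto simp: mem_box_cart abs_le_iff) (metis minus_le_iff)
qed

text \<open>The profile is the cube of the positive part of \<eta>^2 - |x|^2; the cube is the lowest
  integer power of a positive part that is twice continuously differentiable.\<close>

lemma mollifier_exists:
  assumes \<eta>: "\<eta> > 0"
  obtains \<rho> G H where "mollifier \<eta> (\<rho> :: real^'n \<Rightarrow> real) G H"
proof -
  define \<psi> where "\<psi> r = (\<eta>^2 - r) * ((\<eta>^2 - r) * max 0 (\<eta>^2 - r))" for r :: real
  define \<psi>' where "\<psi>' r = - (3 * ((\<eta>^2 - r) * max 0 (\<eta>^2 - r)))" for r :: real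
  define \<psi>'' where "\<psi>'' r = 6 * max 0 (\<eta>^2 - r)" for r :: real
  have sub: "DERIV (\<lambda>r. \<eta>^2 - r) r :> - 1" for r by (auto intro!: derivative_eq_intros)
  have "DERIV \<psi> r :> \<psi>' r" for r
    unfolding \<psi>_def \<psi>'_def using DERIV_chain2[OF DERIV_pos_part_cube sub] by simp
  moreover have "DERIV \<psi>' r :> \<psi>'' r" for r
    unfolding \<psi>''_def \<psi>'_def using DERIV_minus[OF DERIV_cmult[OF DERIV_chain2[OF DERIV_pos_part_square sub], of 3]] by simp
  moreover have "continuous_on UNIV \<psi>''" unfolding \<psi>''_def by (intro continuous_intros)
  ultimately obtain G H where C: "C2 (\<lambda>x::real^'n. \<psi> (x \<bullet> x)) G H" using C2_radial[of \<psi> \<psi>' \<psi>''] by blast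
  define k where "k x = \<psi> (x \<bullet> x)" for x :: "real^'n"
  have k0: "0 \<le> k x" for x by (simp add: k_def \<psi>_def max_def)
  have kz: "k x = 0" if "\<eta> \<le> norm x" for x
  proof -
    have "\<eta>^2 \<le> (norm x)^2" using that \<eta> by (intro power_mono) auto
    then show ?thesis by (simp add: k_def \<psi>_def power2_norm_eq_inner)
  qed
  let ?a = "(\<chi> i. - \<eta>) :: real^'n" and ?b = "(\<chi> i. \<eta>) :: real^'n"
  have out: "k x = 0" if "x \<notin> cbox ?a ?b" for x
    using that cball_subset_cbox_symmetric[of \<eta>] by (intro kz) force
  have kc: "continuous_on UNIV k" unfolding k_def by (rule C2_D(6)[OF C])
  note int = integrable_compact_support[OF kc out]
  define I where "I = (\<integral>x. k x \<partial>lborel)"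
  have "I \<ge> 0" unfolding I_def using k0 by simp
  moreover have "I \<noteq> 0"
  proof
    assume "I = 0"
    then have "integral (cbox ?a ?b) k = 0" using int(2) by (simp add: I_def)
    then have "(k has_integral 0) (cbox ?a ?b)"
      using integrable_continuous[OF continuous_on_subset[OF kc subset_UNIV], of ?a ?b] by (metis integrable_integral)
    moreover have "box ?a ?b \<noteq> {}" using \<eta> by (simp add: interval_ne_empty_cart)
    moreover have "0 \<in> cbox ?a ?b" using \<eta> by (simp add: mem_box_cart)
    ultimately have "k 0 = 0"
      using has_integral_0_cbox_imp_0[of ?a ?b k] continuous_on_subset[OF kc] k0 by blast
    then show False using \<eta> by (simp add: k_def \<psi>_def)
  qed
  ultimately have I: "I > 0" by simp
  have "mollifier \<eta> (\<lambda>x. (1 / I) * k x) (\<lambda>x. (1 / I) *\<^sub>R G x) (\<lambda>x. (1 / I) *\<^sub>R H x)"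
    unfolding mollifier_def
  proof (intro conjI allI impI)
    show "C2 (\<lambda>x. (1 / I) * k x) (\<lambda>x. (1 / I) *\<^sub>R G x) (\<lambda>x. (1 / I) *\<^sub>R H x)"
      unfolding k_def by (rule C2_scale[OF C])
    show "(\<integral>x. (1 / I) * k x \<partial>lborel) = 1" using I int(1) by (simp add: I_def[symmetric])
  qed (use I k0 kz in \<open>auto simp: k_def\<close>)
  then show thesis by (rule that)
qed

lemma mollifier_D:
  assumes "mollifier \<eta> \<rho> G H"
  shows "C2 \<rho> G H" "0 \<le> \<rho> x" "\<rho> (- x) = \<rho> x" "\<eta> \<le> norm x \<Longrightarrow> \<rho> x = 0" "(\<integral>x. \<rho> x \<partial>lborel) = 1"
    "continuous_on S \<rho>"
  using assms C2_D(6)[of \<rho> G H S] by (auto simp: mollifier_def)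

section \<open>Averages against a mollifier\<close>

definition average :: "(real^'n \<Rightarrow> real) \<Rightarrow> (real^'n \<Rightarrow> real) \<Rightarrow> real" where
  "average \<rho> f = (\<integral>s. \<rho> s * f s \<partial>lborel)"

lemma mollifier_integrable:
  fixes f :: "real^'n \<Rightarrow> real"
  assumes m: "mollifier \<eta> \<rho> G H" and f: "continuous_on UNIV f"
  shows "integrable lborel (\<lambda>s. \<rho> s * f s)"
proof (rule integrable_compact_support(1))
  show "continuous_on UNIV (\<lambda>s. \<rho> s * f s)" by (intro continuous_intros f mollifier_D(6)[OF m])
  fix s :: "real^'n" assume s: "s \<notin> cbox (\<chi> i. - \<eta>) (\<chi> i. \<eta>)"
  then have "\<eta> \<le> norm s" using cball_subset_cbox_symmetric[of \<eta>] by force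
  then show "\<rho> s * f s = 0" using mollifier_D(4)[OF m] by simp
qed

lemma average_mono:
  assumes m: "mollifier \<eta> \<rho> G H" and f: "continuous_on UNIV f" "continuous_on UNIV g"
    and le: "\<And>s. norm s < \<eta> \<Longrightarrow> f s \<le> g s"
  shows "average \<rho> f \<le> average \<rho> g"
  unfolding average_def
proof (intro Bochner_Integration.integral_mono mollifier_integrable[OF m] f)
  show "\<rho> s * f s \<le> \<rho> s * g s" for s
    using le[of s] mollifier_D(2)[OF m, of s] mollifier_D(4)[OF m, of s]
    by (cases "norm s < \<eta>") (auto intro: mult_left_mono)
qed

lemma average_add:
  assumes m: "mollifier \<eta> \<rho> G H" and f: "continuous_on UNIV f" "continuous_on UNIV g"
  shows "average \<rho> (\<lambda>s. f s + g s) = average \<rho> f + average \<rho> g"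
  using Bochner_Integration.integral_add[OF mollifier_integrable[OF m f(1)] mollifier_integrable[OF m f(2)]]
  by (simp add: average_def distrib_left)

lemma average_cmult: "average \<rho> (\<lambda>s. c * f s) = c * average \<rho> f"
  by (simp add: average_def mult.left_commute)

lemma average_const:
  assumes m: "mollifier \<eta> \<rho> G H"
  shows "average \<rho> (\<lambda>s. c) = c"
  using mollifier_D(5)[OF m] by (simp add: average_def)

lemma average_reflect:
  assumes m: "mollifier \<eta> \<rho> G H" and f: "continuous_on UNIV f"
  shows "average \<rho> (\<lambda>s. f (- s)) = average \<rho> f"
proof -
  have "(\<lambda>s. \<rho> s * f s) \<in> borel_measurable borel" using mollifier_integrable[OF m f] by simp
  from lborel_integral_reflect(2)[OF this, of 0] show ?thesis by (simp add: average_def mollifier_D(3)[OF m])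
qed

lemma average_linear:
  assumes m: "mollifier \<eta> \<rho> G H"
  shows "average \<rho> (\<lambda>s. p \<bullet> s) = 0"
proof -
  have "average \<rho> (\<lambda>s. p \<bullet> (- s)) = average \<rho> (\<lambda>s. p \<bullet> s)"
    by (rule average_reflect[OF m]) (intro continuous_intros)
  moreover have "average \<rho> (\<lambda>s. p \<bullet> (- s)) = (-1) * average \<rho> (\<lambda>s. p \<bullet> s)"
    by (subst average_cmult[symmetric]) simp
  ultimately show ?thesis by simp
qed

definition conv :: "(real^'n \<Rightarrow> real) \<Rightarrow> (real^'n \<Rightarrow> real) \<Rightarrow> real^'n \<Rightarrow> real" where
  "conv \<rho> V x = average \<rho> (\<lambda>s. V (x - s))"

lemma continuous_on_translates:
  fixes V :: "real^'n \<Rightarrow> real"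
  assumes "continuous_on UNIV V"
  shows "continuous_on S (\<lambda>s. V (x - s))" "continuous_on S (\<lambda>s. V (x + s))"
  by (intro continuous_on_compose2[OF assms] continuous_intros; simp)+

lemma conv_C2:
  fixes V :: "real^'n \<Rightarrow> real"
  assumes m: "mollifier \<eta> \<rho> G H" and V: "continuous_on UNIV V" and z: "\<And>y. y \<notin> cbox a b \<Longrightarrow> V y = 0"
  obtains G' H' where "C2 (conv \<rho> V) G' H'"
proof -
  have "conv \<rho> V x = integral (cbox a b) (\<lambda>y. \<rho> (x - y) * V y)" for x
  proof -
    have "(\<lambda>s. \<rho> s * V (x - s)) \<in> borel_measurable borel"
      using mollifier_integrable[OF m continuous_on_translates(1)[OF V]] by simp
    from lborel_integral_reflect(2)[OF this, of x]
    have "conv \<rho> V x = (\<integral>y. \<rho> (x - y) * V y \<partial>lborel)" by (simp add: conv_def average_def)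
    also have "\<dots> = integral (cbox a b) (\<lambda>y. \<rho> (x - y) * V y)"
      by (rule integrable_compact_support)
        (auto simp: z intro!: continuous_intros V continuous_on_compose2[OF mollifier_D(6)[OF m, of UNIV]])
    finally show ?thesis .
  qed
  then have "conv \<rho> V = (\<lambda>x. integral (cbox a b) (\<lambda>y. \<rho> (x - y) * V y))" by blast
  with C2_parametric_integral[OF mollifier_D(1)[OF m] V, of a b] show thesis by (simp only: that)
qed

text \<open>Since the mollifier is even, V (x + s) and V (x - s) have the same average, and their
  sum dominates 2 V x.\<close>

lemma conv_ge_self:
  fixes V :: "real^'n \<Rightarrow> real"
  assumes m: "mollifier \<eta> \<rho> G H" and V: "continuous_on UNIV V"
    and mid: "\<And>s. norm s < \<eta> \<Longrightarrow> 2 * V x \<le> V (x + s) + V (x - s)"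
  shows "V x \<le> conv \<rho> V x"
proof -
  note c = continuous_on_translates[OF V]
  have "average \<rho> (\<lambda>s. 2 * V x) \<le> average \<rho> (\<lambda>s. V (x + s) + V (x - s))"
    by (intro average_mono[OF m] mid continuous_intros c)
  also have "\<dots> = average \<rho> (\<lambda>s. V (x + s)) + conv \<rho> V x"
    unfolding conv_def by (intro average_add[OF m] c)
  also have "average \<rho> (\<lambda>s. V (x + s)) = conv \<rho> V x"
    using average_reflect[OF m c(1)[of _ x]] by (simp add: conv_def)
  finally show ?thesis by (simp add: average_const[OF m])
qed

lemma conv_midpoint:
  fixes V :: "real^'n \<Rightarrow> real"
  assumes m: "mollifier \<eta> \<rho> G H" and V: "continuous_on UNIV V"
    and mid: "\<And>y. y \<in> cball x \<eta> \<Longrightarrow> 2 * V y \<le> V (y + s) + V (y - s)"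
  shows "2 * conv \<rho> V x \<le> conv \<rho> V (x + s) + conv \<rho> V (x - s)"
proof -
  note c = continuous_on_translates(1)[OF V]
  have "average \<rho> (\<lambda>\<sigma>. 2 * V (x - \<sigma>)) \<le> average \<rho> (\<lambda>\<sigma>. V (x + s - \<sigma>) + V (x - s - \<sigma>))"
  proof (intro average_mono[OF m] continuous_intros c)
    fix \<sigma> :: "real^'n" assume "norm \<sigma> < \<eta>"
    then show "2 * V (x - \<sigma>) \<le> V (x + s - \<sigma>) + V (x - s - \<sigma>)"
      using mid[of "x - \<sigma>"] by (simp add: dist_norm algebra_simps)
  qed
  then show ?thesis
    by (simp add: average_cmult conv_def average_add[OF m c c])
qed

lemma conv_bounds:
  fixes V :: "real^'n \<Rightarrow> real"
  assumes m: "mollifier \<eta> \<rho> G H" and V: "continuous_on UNIV V"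
    and b: "\<And>s. norm s < \<eta> \<Longrightarrow> A \<le> V (x - s)" "\<And>s. norm s < \<eta> \<Longrightarrow> V (x - s) \<le> B"
  shows "A \<le> conv \<rho> V x" "conv \<rho> V x \<le> B"
proof -
  note c = continuous_on_translates(1)[OF V]
  have "average \<rho> (\<lambda>s. A) \<le> average \<rho> (\<lambda>s. V (x - s))" "average \<rho> (\<lambda>s. V (x - s)) \<le> average \<rho> (\<lambda>s. B)"
    by (intro average_mono[OF m] continuous_intros c b; assumption)+
  then show "A \<le> conv \<rho> V x" "conv \<rho> V x \<le> B" by (simp_all add: average_const[OF m] conv_def)
qed

section \<open>From linear operators to the determinant of the mollification\<close>

lemma gauss_first_moment:
  fixes p :: "real^'n"
  shows "integrable lborel (\<lambda>\<xi>. gauss_density \<xi> * (p \<bullet> \<xi>))" "(\<integral>\<xi>. gauss_density \<xi> * (p \<bullet> \<xi>) \<partial>lborel) = 0"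
proof -
  have one: "\<xi> $ i = (\<Prod>k\<in>UNIV. (\<xi> $ k) ^ (if k = i then 1 else 0))" for \<xi> :: "real^'n" and i
  proof -
    have "(\<Prod>k\<in>UNIV. (\<xi> $ k) ^ (if k = i then 1 else 0)) = (\<Prod>k\<in>UNIV. if k = i then \<xi> $ k else 1)"
      by (intro prod.cong) auto
    then show ?thesis by simp
  qed
  have "integrable lborel (\<lambda>\<xi>::real^'n. gauss_density \<xi> * \<xi> $ i)" for i
    unfolding one[of _ i] by (rule gauss_moment)
  moreover have "gauss_density \<xi> * (p \<bullet> \<xi>) = (\<Sum>i\<in>UNIV. p $ i * (gauss_density \<xi> * \<xi> $ i))" for \<xi>
    by (simp add: inner_vec_def sum_distrib_left mult_ac)
  ultimately show int: "integrable lborel (\<lambda>\<xi>. gauss_density \<xi> * (p \<bullet> \<xi>))" by simp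
  then have "(\<lambda>\<xi>. gauss_density \<xi> * (p \<bullet> \<xi>)) \<in> borel_measurable borel" by simp
  from lborel_integral_reflect(2)[OF this, of 0]
  show "(\<integral>\<xi>. gauss_density \<xi> * (p \<bullet> \<xi>) \<partial>lborel) = 0" by (simp add: gauss_density_eq)
qed

text \<open>A test function \<phi> for V o B is carried to \<phi> o C, with C the inverse of B; this
  tests V, and its Hessian changes by the congruence with C.\<close>

lemma test_above_linear:
  fixes V :: "real^'n \<Rightarrow> real" and B C :: "real^'n^'n"
  assumes inv: "B ** C = mat 1" "C ** B = mat 1" and test: "test_above V S P"
    and S: "\<And>z. z \<in> S' \<Longrightarrow> B *v z \<in> S"
    and P: "\<And>z p X. z \<in> S' \<Longrightarrow> P (B *v z) p (transpose C ** X ** C) \<Longrightarrow> P' X"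
  shows "test_above (\<lambda>y. V (B *v y)) S' (\<lambda>z p X. P' X)"
  unfolding test_above_def
proof (intro allI impI ballI)
  fix \<phi> G H z
  assume \<phi>: "C2 \<phi> G H" and z: "z \<in> S'" and ev: "\<forall>\<^sub>F y in at z. V (B *v y) - \<phi> y \<le> V (B *v z) - \<phi> z"
  have CB: "C *v (B *v y) = y" "B *v (C *v y) = y" for y by (simp_all add: matrix_vector_mul_assoc inv)
  from C2_affine_comp[OF \<phi>, of 0 C]
  have \<phi>C: "C2 (\<lambda>y. \<phi> (C *v y)) (\<lambda>y. transpose C *v G (C *v y)) (\<lambda>y. transpose C ** H (C *v y) ** C)" by simp
  have "eventually (\<lambda>y. V (B *v y) - \<phi> y \<le> V (B *v z) - \<phi> z) (nhds z)"
    using ev by (simp add: eventually_nhds_conv_at)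
  moreover have "filterlim (\<lambda>y. C *v y) (nhds z) (nhds (B *v z))"
    using continuous_on_eq_continuous_at[of UNIV "\<lambda>y. C *v y"] matrix_vector_mult_linear_continuous_on[of UNIV C] CB(1)[of z]
    by (metis UNIV_I isCont_def open_UNIV tendsto_at_iff_tendsto_nhds)
  ultimately have "eventually (\<lambda>y. V (B *v (C *v y)) - \<phi> (C *v y) \<le> V (B *v z) - \<phi> z) (nhds (B *v z))"
    by (rule eventually_compose_filterlim)
  then have "\<forall>\<^sub>F y in at (B *v z). V y - \<phi> (C *v y) \<le> V (B *v z) - \<phi> (C *v (B *v z))"
    by (simp add: CB eventually_nhds_conv_at)
  then have "P (B *v z) (transpose C *v G (C *v (B *v z))) (transpose C ** H (C *v (B *v z)) ** C)"
    using test \<phi>C S[OF z] unfolding test_above_def by blast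
  then show "P' (H z)" using P[OF z] by (simp only: CB)
qed

text \<open>For V o B the operator becomes the Laplacian, which is the case of
  \<open>heat_lower_bound\<close>. Since B stretches by at most \<beta>, radius \<eta> / \<beta> in
  the new variables stays within radius \<eta> in the old ones.\<close>

lemma heat_lower_bound_linear:
  fixes V :: "real^'n \<Rightarrow> real" and B C :: "real^'n^'n"
  assumes V: "continuous_on UNIV V" "\<And>y. 0 \<le> V y" "\<And>y. V y \<le> M" and z: "\<And>y. y \<notin> cbox a b \<Longrightarrow> V y = 0"
    and inv: "B ** C = mat 1" "C ** B = mat 1" and \<beta>: "\<beta> > 0" "\<And>s. norm (B *v s) \<le> norm s * \<beta>"
    and \<eta>: "\<eta> > 0" and mid: "\<And>y' s. y' \<in> cball y \<eta> \<Longrightarrow> norm s \<le> \<eta> \<Longrightarrow> 2 * V y' \<le> V (y' + s) + V (y' - s)"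
    and c: "c \<ge> 0" and test: "test_above V (ball y \<eta>) (\<lambda>z p X. c \<le> trace (transpose B ** X ** B))" and t: "t > 0"
  shows "V y + c * (t - CARD('n) / (\<eta> / \<beta>)^2 * t^2) - (4 * gauss_m4 TYPE('n) * M / (\<eta> / \<beta>)^4 + 1) * t^2 \<le>
    (\<integral>\<xi>. gauss_density \<xi> * V (y - sqrt (2 * t) *\<^sub>R (B *v \<xi>)) \<partial>lborel)"
proof -
  define d where "d = \<eta> / \<beta>"
  define y0 where "y0 = C *v y"
  have CB: "C *v (B *v y) = y" "B *v (C *v y) = y" for y by (simp_all add: matrix_vector_mul_assoc inv)
  have Bs: "norm (B *v s) \<le> \<eta>" if "norm s \<le> d" for s
  proof -
    have "norm s * \<beta> \<le> d * \<beta>" using that \<beta> by simp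
    then show ?thesis using \<beta>(2)[of s] \<beta>(1) by (simp add: d_def)
  qed
  have Bs': "norm (B *v s) < \<eta>" if "norm s < d" for s
  proof -
    have "norm s * \<beta> < d * \<beta>" using that \<beta> by simp
    then show ?thesis using \<beta>(2)[of s] \<beta>(1) by (simp add: d_def)
  qed
  let ?u = "\<lambda>y. V (B *v y)"
  have "bounded ((\<lambda>y. C *v y) ` cbox a b)"
    by (intro compact_imp_bounded compact_continuous_image matrix_vector_mult_linear_continuous_on compact_cbox)
  then obtain a' b' where ab': "(\<lambda>y. C *v y) ` cbox a b \<subseteq> cbox a' b'" using bounded_subset_cbox_symmetric by meson
  have "?u y0 + c * (t - CARD('n) / d^2 * t^2) - (4 * gauss_m4 TYPE('n) * M / d^4 + 1) * t^2 \<le> heat ?u y0 t"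
  proof (rule heat_lower_bound)
    show "continuous_on UNIV ?u" 
      by (rule continuous_on_compose2[OF V(1) matrix_vector_mult_linear_continuous_on]) auto
    show "?u y' = 0" if "y' \<notin> cbox a' b'" for y'
      using that ab' CB(1)[of y'] by (intro z) (metis image_subset_iff)
    show "2 * ?u y' \<le> ?u (y' + s) + ?u (y' - s)" if y': "y' \<in> cball y0 d" and s: "norm s \<le> d" for y' s
    proof -
      have "dist y (B *v y') = norm (B *v (y0 - y'))" by (simp add: y0_def dist_norm matrix_vector_mult_diff_distrib CB)
      also have "\<dots> \<le> \<eta>" using y' by (intro Bs) (simp add: dist_norm)
      finally show ?thesis
        using mid[of "B *v y'" "B *v s"] Bs[OF s]
        by (simp add: matrix_vector_mult_diff_distrib matrix_vector_right_distrib)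
    qed
    show "test_above ?u (ball y0 d) (\<lambda>z p X. c \<le> trace X)"
    proof (rule test_above_linear[OF inv test])
      fix z assume z: "z \<in> ball y0 d"
      have "dist y (B *v z) = norm (B *v (y0 - z))" by (simp add: y0_def dist_norm matrix_vector_mult_diff_distrib CB)
      also have "\<dots> < \<eta>" using z by (intro Bs') (simp add: dist_norm)
      finally show "B *v z \<in> ball y \<eta>" by simp
    next
      fix X :: "real^'n^'n"
      have t1: "transpose B ** transpose C = mat 1"
        by (simp add: matrix_transpose_mul[symmetric] inv transpose_mat)
      have "transpose B ** (transpose C ** X ** C) ** B = (transpose B ** transpose C) ** X ** (C ** B)"
        by (simp only: matrix_mul_assoc)
      also have "\<dots> = X" by (simp add: t1 inv)
      finally show "c \<le> trace (transpose B ** (transpose C ** X ** C) ** B) \<Longrightarrow> c \<le> trace X" by simp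
    qed
  qed (use V c t \<eta> \<beta> in \<open>auto simp: d_def\<close>)
  moreover have "heat ?u y0 t = (\<integral>\<xi>. gauss_density \<xi> * V (y - sqrt (2 * t) *\<^sub>R (B *v \<xi>)) \<partial>lborel)"
    by (simp add: heat_def matrix_vector_mult_diff_distrib matrix_vector_mult_scaleR CB y0_def)
  moreover have "?u y0 = V y" by (simp add: y0_def CB)
  ultimately show ?thesis by (simp only: d_def)
qed

text \<open>Second-order expansion under the Gaussian average: the linear term has mean zero, and
  the quadratic term contributes t times a trace because half the squared step size is t.
  \<open>K\<close> does not depend on t, so its term still vanishes in the limit after division by
  t.\<close>

lemma gauss_taylor_upper:
  fixes f :: "real^'n \<Rightarrow> real" and B :: "real^'n^'n"
  assumes C: "C2 f G H" and f: "\<And>y. 0 \<le> f y" "\<And>y. f y \<le> M" and H: "\<And>\<xi>. 0 \<le> \<xi> \<bullet> (H x *v \<xi>)"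
    and \<beta>: "\<beta> > 0" "\<And>s. norm (B *v s) \<le> norm s * \<beta>" and e: "e > 0"
  obtains K where "\<And>t. t > 0 \<Longrightarrow> (\<integral>\<xi>. gauss_density \<xi> * f (x - sqrt (2 * t) *\<^sub>R (B *v \<xi>)) \<partial>lborel) \<le>
    f x + t * (trace (transpose B ** H x ** B) + 2 * e * trace (transpose B ** B)) + K * t^2"
proof -
  obtain \<delta> where \<delta>: "\<delta> > 0" "\<And>s. norm s < \<delta> \<Longrightarrow> \<bar>f (x + s) - f x - G x \<bullet> s - s \<bullet> (H x *v s) / 2\<bar> \<le> e * (norm s)^2"
    using C2_taylor[OF C e, of x] by blast
  \<comment> \<open>Makes the estimate global: for |s| \<ge> \<delta> both the bound M on f and the
    linear term are dominated by multiples of |s|^4.\<close>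
  define N where "N = M / \<delta>^4 + norm (G x) / \<delta>^3"
  have M: "0 \<le> M" using f order_trans by blast
  have N: "N \<ge> 0" using M \<delta> by (simp add: N_def)
  have pw: "f (x + s) \<le> f x + G x \<bullet> s + s \<bullet> (H x *v s) / 2 + e * (norm s)^2 + N * (norm s)^4" for s
  proof (cases "norm s < \<delta>")
    case True
    have "0 \<le> N * (norm s)^4" using N by simp
    then show ?thesis using \<delta>(2)[OF True] by linarith
  next
    case False
    then have "\<delta> \<le> norm s" by simp
    then have p: "\<delta>^4 \<le> (norm s)^4" "\<delta>^3 \<le> (norm s)^3" using \<delta> by (auto intro: power_mono)
    have "M * 1 \<le> M * ((norm s)^4 / \<delta>^4)" using p \<delta> M by (intro mult_left_mono) auto
    moreover have "norm (G x) * norm s * 1 \<le> norm (G x) * norm s * ((norm s)^3 / \<delta>^3)"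
      using p \<delta> by (intro mult_left_mono) auto
    moreover have "norm (G x) * norm s * ((norm s)^3 / \<delta>^3) = norm (G x) / \<delta>^3 * (norm s)^4"
      by (simp add: power_numeral_reduce mult_ac)
    moreover have "N * (norm s)^4 = M * ((norm s)^4 / \<delta>^4) + norm (G x) / \<delta>^3 * (norm s)^4"
      by (simp add: N_def distrib_right)
    ultimately have "M + norm (G x) * norm s \<le> N * (norm s)^4" by linarith
    moreover have "- (G x \<bullet> s) \<le> norm (G x) * norm s" using Cauchy_Schwarz_ineq2[of "G x" s] by linarith
    moreover have "0 \<le> e * (norm s)^2" using e by simp
    moreover have "0 \<le> s \<bullet> (H x *v s) / 2" using H by simp
    ultimately show ?thesis using f(1)[of x] f(2)[of "x + s"] by linarith
  qed
  let ?A = "transpose B ** H x ** B" and ?D = "transpose B ** B"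
  define K where "K = 4 * N * \<beta>^4 * gauss_m4 TYPE('n)"
  have "(\<integral>\<xi>. gauss_density \<xi> * f (x - sqrt (2 * t) *\<^sub>R (B *v \<xi>)) \<partial>lborel) \<le>
    f x + t * (trace ?A + 2 * e * trace ?D) + K * t^2" if t: "t > 0" for t
  proof -
    define r where "r = sqrt (2 * t)"
    have r: "r > 0" "r^2 = 2 * t" using t by (auto simp: r_def)
    have r4: "r^4 = 4 * t^2" using r(2) power_mult[of r 2 2] by (simp add: power_mult_distrib)
    define p where "p = (- r) *\<^sub>R (transpose B *v G x)"
    have adj: "(B *v h) \<bullet> g = h \<bullet> (transpose B *v g)" for h g :: "real^'n"
      by (metis dot_lmul_matrix inner_commute transpose_matrix_vector)
    have pt: "f (x - r *\<^sub>R (B *v \<xi>)) \<le> f x + p \<bullet> \<xi> + t * (\<xi> \<bullet> (?A *v \<xi>)) + 2 * e * t * (\<xi> \<bullet> (?D *v \<xi>)) + (4 * N * \<beta>^4 * t^2) * (norm \<xi>)^4" for \<xi>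
    proof -
      define s where "s = (- r) *\<^sub>R (B *v \<xi>)"
      have 1: "G x \<bullet> s = p \<bullet> \<xi>"
        by (simp add: s_def p_def adj inner_commute[of "G x"] inner_commute[of "transpose B *v G x"] del: transpose_matrix_vector)
      have "s \<bullet> (H x *v s) = r^2 * ((B *v \<xi>) \<bullet> (H x *v (B *v \<xi>)))"
        unfolding s_def matrix_vector_mult_scaleR by (simp add: power2_eq_square)
      also have "(B *v \<xi>) \<bullet> (H x *v (B *v \<xi>)) = \<xi> \<bullet> (?A *v \<xi>)"
        unfolding adj by (simp add: matrix_vector_mul_assoc matrix_mul_assoc del: transpose_matrix_vector)
      finally have 2: "s \<bullet> (H x *v s) / 2 = t * (\<xi> \<bullet> (?A *v \<xi>))" by (simp add: r)
      have "(norm s)^2 = r^2 * ((B *v \<xi>) \<bullet> (B *v \<xi>))"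
        by (simp add: s_def power_mult_distrib power2_norm_eq_inner)
      also have "(B *v \<xi>) \<bullet> (B *v \<xi>) = \<xi> \<bullet> (?D *v \<xi>)"
        unfolding adj by (simp add: matrix_vector_mul_assoc del: transpose_matrix_vector)
      finally have 3: "e * (norm s)^2 = 2 * e * t * (\<xi> \<bullet> (?D *v \<xi>))" by (simp add: r)
      have "norm s \<le> r * (norm \<xi> * \<beta>)" using \<beta>(2)[of \<xi>] r by (simp add: s_def)
      then have "(norm s)^4 \<le> (r * (norm \<xi> * \<beta>))^4" by (intro power_mono) auto
      also have "\<dots> = 4 * t^2 * \<beta>^4 * (norm \<xi>)^4" by (simp add: power_mult_distrib r4 mult_ac)
      finally have "N * (norm s)^4 \<le> N * (4 * t^2 * \<beta>^4 * (norm \<xi>)^4)" using N by (rule mult_left_mono)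
      then have 4: "N * (norm s)^4 \<le> (4 * N * \<beta>^4 * t^2) * (norm \<xi>)^4" by (simp add: mult_ac)
      have 5: "x - r *\<^sub>R (B *v \<xi>) = x + s" by (simp add: s_def)
      show ?thesis unfolding 5 using pw[of s] 1 2 3 4 by linarith
    qed
    let ?g = "\<lambda>\<xi>. (f x * gauss_density \<xi> + gauss_density \<xi> * (p \<bullet> \<xi>)) + (t * (gauss_density \<xi> * (\<xi> \<bullet> (?A *v \<xi>))) +
        2 * e * t * (gauss_density \<xi> * (\<xi> \<bullet> (?D *v \<xi>)))) + (4 * N * \<beta>^4 * t^2) * (gauss_density \<xi> * (norm \<xi>)^4)"
    note ints = gauss_integral gauss_first_moment gauss_quadratic_moment gauss_fourth_moment
    have cf: "continuous_on UNIV (\<lambda>\<xi>. f (x - r *\<^sub>R (B *v \<xi>)))"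
      by (intro continuous_on_compose2[OF C2_D(6)[OF C, of UNIV]] continuous_intros matrix_vector_mult_linear_continuous_on) auto
    have "(\<integral>\<xi>. gauss_density \<xi> * f (x - r *\<^sub>R (B *v \<xi>)) \<partial>lborel) \<le> (\<integral>\<xi>. ?g \<xi> \<partial>lborel)"
    proof (rule Bochner_Integration.integral_mono)
      show "integrable lborel (\<lambda>\<xi>. gauss_density \<xi> * f (x - r *\<^sub>R (B *v \<xi>)))"
        by (rule integrable_gauss_bounded[OF cf, of M]) (simp add: f)
      show "integrable lborel ?g"
        by (intro Bochner_Integration.integrable_add integrable_mult_right ints)
      fix \<xi>
      show "gauss_density \<xi> * f (x - r *\<^sub>R (B *v \<xi>)) \<le> ?g \<xi>"
        using mult_left_mono[OF pt[of \<xi>] gauss_density_nonneg[of \<xi>]] by (simp add: algebra_simps)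
    qed
    also have "(\<integral>\<xi>. ?g \<xi> \<partial>lborel) = (f x * 1 + 0) + (t * trace ?A + 2 * e * t * trace ?D) + (4 * N * \<beta>^4 * t^2) * gauss_m4 TYPE('n)"
      by (subst Bochner_Integration.integral_add Bochner_Integration.integral_mult_right,
          (intro Bochner_Integration.integrable_add integrable_mult_right ints)+)+
        (simp add: ints gauss_m4_def)
    also have "\<dots> = f x + t * (trace ?A + 2 * e * trace ?D) + K * t^2"
      by (simp add: K_def algebra_simps)
    finally show ?thesis by (simp only: r_def)
  qed
  then show thesis by (rule that)
qed

text \<open>M \<rho>(s) times the Gaussian density is an integrable majorant; exchanging the order
  of integration shows that mollification commutes with the Gaussian average.\<close>

lemma gauss_conv_Fubini:
  fixes V :: "real^'n \<Rightarrow> real" and B :: "real^'n^'n"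
  assumes m: "mollifier \<eta> \<rho> G H" and V: "continuous_on UNIV V" "\<And>y. 0 \<le> V y" "\<And>y. V y \<le> M"
  shows "integrable lborel (\<lambda>s. \<rho> s * (\<integral>\<xi>. gauss_density \<xi> * V (x - s - r *\<^sub>R (B *v \<xi>)) \<partial>lborel))"
    "(\<integral>s. \<rho> s * (\<integral>\<xi>. gauss_density \<xi> * V (x - s - r *\<^sub>R (B *v \<xi>)) \<partial>lborel) \<partial>lborel) =
     (\<integral>\<xi>. gauss_density \<xi> * conv \<rho> V (x - r *\<^sub>R (B *v \<xi>)) \<partial>lborel)"
proof -
  let ?F = "\<lambda>s \<xi>. \<rho> s * (gauss_density \<xi> * V (x - s - r *\<^sub>R (B *v \<xi>)))"
  have ig: "integrable lborel (\<lambda>\<xi>::real^'n. gauss_density \<xi>)" "integrable lborel \<rho>"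
    using gauss_integral(1) mollifier_integrable[OF m, of "\<lambda>_. 1"] by auto
  have M: "0 \<le> M" using V order_trans by blast
  have i1: "integrable (lborel \<Otimes>\<^sub>M lborel) (\<lambda>(s, \<xi>::real^'n). M * (\<rho> s * gauss_density \<xi>))"
  proof (rule lborel_pair.Fubini_integrable)
    have [measurable]: "\<rho> \<in> borel_measurable borel" using ig by simp
    show "(\<lambda>(s, \<xi>::real^'n). M * (\<rho> s * gauss_density \<xi>)) \<in> borel_measurable (lborel \<Otimes>\<^sub>M lborel)" by measurable
    have "(\<integral>\<xi>. norm (case (s, \<xi>::real^'n) of (s, \<xi>) \<Rightarrow> M * (\<rho> s * gauss_density \<xi>)) \<partial>lborel) = M * \<rho> s" for s
      using M mollifier_D(2)[OF m, of s] by (simp add: abs_mult gauss_density_nonneg gauss_integral)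
    then show "integrable lborel (\<lambda>s. \<integral>\<xi>. norm (case (s, \<xi>::real^'n) of (s, \<xi>) \<Rightarrow> M * (\<rho> s * gauss_density \<xi>)) \<partial>lborel)"
      using ig(2) by simp
    show "AE s in lborel. integrable lborel (\<lambda>\<xi>::real^'n. case (s, \<xi>) of (s, \<xi>) \<Rightarrow> M * (\<rho> s * gauss_density \<xi>))"
      using ig(1) by simp
  qed
  have "continuous_on UNIV (\<lambda>p. \<rho> (fst p) * (gauss_density (snd p) * V (x - fst p - r *\<^sub>R (B *v snd p))))"
    by (intro continuous_intros continuous_on_compose2[OF mollifier_D(6)[OF m, of UNIV]]
        continuous_on_compose2[OF gauss_density_continuous[of UNIV]] continuous_on_compose2[OF V(1)]
        continuous_on_compose2[OF matrix_vector_mult_linear_continuous_on[of UNIV B]]) auto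
  then have "(\<lambda>p. \<rho> (fst p) * (gauss_density (snd p) * V (x - fst p - r *\<^sub>R (B *v snd p)))) \<in> borel_measurable borel"
    by (rule borel_measurable_continuous_onI)
  then have meas: "case_prod ?F \<in> borel_measurable (lborel \<Otimes>\<^sub>M lborel)"
    by (simp add: lborel_prod case_prod_unfold)
  have int: "integrable (lborel \<Otimes>\<^sub>M lborel) (case_prod ?F)"
  proof (rule Bochner_Integration.integrable_bound[OF i1 meas], rule AE_I2)
    fix p :: "(real^'n) \<times> (real^'n)"
    obtain s \<xi> where p: "p = (s, \<xi>)" by (cases p)
    have "?F s \<xi> \<le> \<rho> s * (gauss_density \<xi> * M)"
      by (intro mult_left_mono V gauss_density_nonneg mollifier_D(2)[OF m])
    then show "norm (case_prod ?F p) \<le> norm (case p of (s, \<xi>) \<Rightarrow> M * (\<rho> s * gauss_density \<xi>))"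
      using M V(2) mollifier_D(2)[OF m, of s] gauss_density_nonneg[of \<xi>] by (simp add: p abs_mult mult_ac)
  qed
  show "integrable lborel (\<lambda>s. \<rho> s * (\<integral>\<xi>. gauss_density \<xi> * V (x - s - r *\<^sub>R (B *v \<xi>)) \<partial>lborel))"
    using lborel_pair.integrable_fst[OF int] by simp
  have "(\<integral>s. \<rho> s * (\<integral>\<xi>. gauss_density \<xi> * V (x - s - r *\<^sub>R (B *v \<xi>)) \<partial>lborel) \<partial>lborel) = (\<integral>s. (\<integral>\<xi>. ?F s \<xi> \<partial>lborel) \<partial>lborel)"
    by simp
  also have "\<dots> = (\<integral>\<xi>. (\<integral>s. ?F s \<xi> \<partial>lborel) \<partial>lborel)"
    by (rule lborel_pair.Fubini_integral[OF int, symmetric])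
  also have "(\<lambda>\<xi>. \<integral>s. ?F s \<xi> \<partial>lborel) = (\<lambda>\<xi>. gauss_density \<xi> * conv \<rho> V (x - r *\<^sub>R (B *v \<xi>)))"
  proof
    fix \<xi>
    have "(\<integral>s. ?F s \<xi> \<partial>lborel) = (\<integral>s. gauss_density \<xi> * (\<rho> s * V (x - r *\<^sub>R (B *v \<xi>) - s)) \<partial>lborel)"
      by (simp add: mult_ac diff_diff_eq add.commute)
    then show "(\<integral>s. ?F s \<xi> \<partial>lborel) = gauss_density \<xi> * conv \<rho> V (x - r *\<^sub>R (B *v \<xi>))"
      by (simp add: conv_def average_def)
  qed
  finally show "(\<integral>s. \<rho> s * (\<integral>\<xi>. gauss_density \<xi> * V (x - s - r *\<^sub>R (B *v \<xi>)) \<partial>lborel) \<partial>lborel) =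
     (\<integral>\<xi>. gauss_density \<xi> * conv \<rho> V (x - r *\<^sub>R (B *v \<xi>)) \<partial>lborel)" .
qed

lemma le_of_le_add_small:
  fixes a b K :: real
  assumes "\<And>t. t > 0 \<Longrightarrow> a \<le> b + K * t"
  shows "a \<le> b"
proof (rule ccontr)
  assume ab: "\<not> a \<le> b"
  define t where "t = (a - b) / (2 * (\<bar>K\<bar> + 1))"
  have t: "t > 0" using ab unfolding t_def by (intro divide_pos_pos) auto
  have "K * t \<le> (\<bar>K\<bar> + 1) * t" using t by (intro mult_right_mono) auto
  also have "\<dots> = (a - b) / 2" using abs_ge_zero[of K] by (simp add: t_def field_simps)
  finally have "2 * (K * t) \<le> a - b" by simp
  moreover have "b < a" using ab by simp
  ultimately show False using assms[OF t] by simp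
qed

text \<open>The heat estimate for V, averaged over translates, bounds the Gaussian average of the
  mollification from below, and Taylor expansion bounds it from above. Dividing by t gives the trace
  inequality for every B of determinant one, and the infimum formula returns the determinant. Radius
  2 \<eta> is \<eta> for the support of \<rho> plus \<eta> for the heat estimate.\<close>

lemma mollified_det:
  fixes V :: "real^'n \<Rightarrow> real"
  assumes m: "mollifier \<eta> \<rho> G\<rho> H\<rho>" and V: "continuous_on UNIV V" "\<And>y. 0 \<le> V y" "\<And>y. V y \<le> M" 
    and z: "\<And>y. y \<notin> cbox a b \<Longrightarrow> V y = 0" and \<eta>: "\<eta> > 0"
    and mid: "\<And>y s. y \<in> cball x (2 * \<eta>) \<Longrightarrow> norm s \<le> \<eta> \<Longrightarrow> 2 * V y \<le> V (y + s) + V (y - s)"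
    and k: "k \<ge> 0" and test: "test_above V (ball x (2 * \<eta>)) (\<lambda>z p X. psd X \<and> k ^ CARD('n) \<le> det X)"
    and C: "C2 (conv \<rho> V) G H"
  shows "psd (H x)" "k ^ CARD('n) \<le> det (H x)"
proof -
  let ?f = "conv \<rho> V"
  have mid2: "2 * ?f x \<le> ?f (x + s) + ?f (x - s)" if "norm s \<le> \<eta>" for s
    using \<eta> by (intro conv_midpoint[OF m V(1)] mid that) auto
  have Hpos: "0 \<le> \<xi> \<bullet> (H x *v \<xi>)" for \<xi>
  proof (rule le_of_le_add_small)
    fix e :: real assume e: "e > 0"
    obtain \<delta> where \<delta>: "\<delta> > 0" "\<And>s. norm s < \<delta> \<Longrightarrow> \<bar>?f (x + s) - ?f x - G x \<bullet> s - s \<bullet> (H x *v s) / 2\<bar> \<le> e * (norm s)^2"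
      using C2_taylor[OF C e, of x] by blast
    define \<tau> where "\<tau> = min \<delta> \<eta> / (2 * (norm \<xi> + 1))"
    have \<tau>: "\<tau> > 0" using \<delta> \<eta> by (auto simp: \<tau>_def intro!: divide_pos_pos add_nonneg_pos)
    have "norm (\<tau> *\<^sub>R \<xi>) \<le> \<tau> * (norm \<xi> + 1)" using \<tau> by (simp add: mult_left_mono)
    also have "\<dots> = min \<delta> \<eta> / 2" by (simp add: \<tau>_def field_simps add_nonneg_eq_0_iff)
    finally have n: "norm (\<tau> *\<^sub>R \<xi>) < \<delta>" "norm (\<tau> *\<^sub>R \<xi>) \<le> \<eta>" using \<delta> \<eta> by (auto simp: min_def split: if_splits)
    have "?f (x + \<tau> *\<^sub>R \<xi>) + ?f (x - \<tau> *\<^sub>R \<xi>) - 2 * ?f x \<le> (\<tau> *\<^sub>R \<xi>) \<bullet> (H x *v (\<tau> *\<^sub>R \<xi>)) + 2 * e * (norm (\<tau> *\<^sub>R \<xi>))^2"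
      using \<delta>(2)[OF n(1)] \<delta>(2)[of "- (\<tau> *\<^sub>R \<xi>)"] n(1)
      by (simp add: abs_le_iff linear_neg[OF matrix_vector_mul_linear])
    also have "\<dots> = \<tau>^2 * (\<xi> \<bullet> (H x *v \<xi>) + 2 * (norm \<xi>)^2 * e)"
      unfolding matrix_vector_mult_scaleR by (simp add: power2_eq_square algebra_simps)
    finally have "0 \<le> \<tau>^2 * (\<xi> \<bullet> (H x *v \<xi>) + 2 * (norm \<xi>)^2 * e)" using mid2[OF n(2)] by linarith
    then show "0 \<le> \<xi> \<bullet> (H x *v \<xi>) + 2 * (norm \<xi>)^2 * e" using \<tau> by (simp add: zero_le_mult_iff)
  qed
  then show psd: "psd (H x)" using C2_D(3)[OF C] by (simp add: psd_def sym_matrices_def)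
  show "k ^ CARD('n) \<le> det (H x)"
  proof (rule det_ge_of_trace_congruence[OF psd k])
    fix B :: "real^'n^'n" assume B: "det B = 1"
    then have "invertible B" by (simp add: invertible_det_nz)
    then obtain Bi where inv: "B ** Bi = mat 1" "Bi ** B = mat 1" unfolding invertible_def by blast
    obtain \<beta> where \<beta>: "\<beta> > 0" "\<And>s. norm (B *v s) \<le> norm s * \<beta>"
      using bounded_linear.pos_bounded[OF matrix_vector_mul_bounded_linear[of B]] by blast
    define c where "c = CARD('n) * k"
    have c: "c \<ge> 0" using k by (simp add: c_def)
    \<comment> \<open>For each fixed B the determinant inequality implies the linear one, by
      \<open>det_le_trace_congruence\<close>.\<close>
    have ctest: "test_above V (ball y \<eta>) (\<lambda>z p X. c \<le> trace (transpose B ** X ** B))" if y: "y \<in> cball x \<eta>" for y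
      unfolding test_above_def
    proof (intro allI impI ballI)
      fix \<phi> G' H' z
      assume *: "C2 \<phi> G' H'" "z \<in> ball y \<eta>" "\<forall>\<^sub>F w in at z. V w - \<phi> w \<le> V z - \<phi> z"
      have "dist x z \<le> dist x y + dist y z" by (rule dist_triangle)
      then have "z \<in> ball x (2 * \<eta>)" using *(2) y by auto
      then have X: "psd (H' z)" "k ^ CARD('n) \<le> det (H' z)" using test * unfolding test_above_def by blast+
      have "k = root CARD('n) (k ^ CARD('n))" using k by (simp add: real_root_power_cancel)
      also have "\<dots> \<le> root CARD('n) (det (H' z))" using X by simp
      finally have "c \<le> CARD('n) * root CARD('n) (det (H' z))" by (simp add: c_def)
      also have "\<dots> \<le> trace (transpose B ** H' z ** B)" by (rule det_le_trace_congruence[OF X(1) B])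
      finally show "c \<le> trace (transpose B ** H' z ** B)" .
    qed
    define A1 where "A1 = CARD('n) / (\<eta> / \<beta>)^2"
    define K1 where "K1 = 4 * gauss_m4 TYPE('n) * M / (\<eta> / \<beta>)^4 + 1"
    have low: "V (x - s) + (c * (t - A1 * t^2) - K1 * t^2) \<le>
        (\<integral>\<xi>. gauss_density \<xi> * V (x - s - sqrt (2 * t) *\<^sub>R (B *v \<xi>)) \<partial>lborel)" if "norm s < \<eta>" "t > 0" for s t
    proof -
      have "V (x - s) + c * (t - A1 * t^2) - K1 * t^2 \<le>
        (\<integral>\<xi>. gauss_density \<xi> * V (x - s - sqrt (2 * t) *\<^sub>R (B *v \<xi>)) \<partial>lborel)"
        unfolding A1_def K1_def
      proof (rule heat_lower_bound_linear[OF V z inv \<beta> \<eta> _ c ctest \<open>t > 0\<close>])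
        fix y' s' :: "real^'n" assume y': "y' \<in> cball (x - s) \<eta>" and s': "norm s' \<le> \<eta>"
        have "dist x y' \<le> dist x (x - s) + dist (x - s) y'" by (rule dist_triangle)
        then have "y' \<in> cball x (2 * \<eta>)" using y' that by (auto simp: dist_norm)
        then show "2 * V y' \<le> V (y' + s') + V (y' - s')" using s' by (rule mid)
      qed (use that in \<open>auto simp: dist_norm\<close>)
      then show ?thesis by simp
    qed
    show "CARD('n) * k \<le> trace (transpose B ** H x ** B)"
    proof (fold c_def, rule le_of_le_add_small)
      \<comment> \<open>The limit in t is taken for fixed e, because the constant \<open>K\<close>
        depends on e; e tends to 0 afterwards.\<close>
      fix e :: real assume e: "e > 0"
      have fb: "0 \<le> ?f y" "?f y \<le> M" for y by (rule conv_bounds[OF m V(1)]; rule V)+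
      obtain K where K: "\<And>t. t > 0 \<Longrightarrow> (\<integral>\<xi>. gauss_density \<xi> * ?f (x - sqrt (2 * t) *\<^sub>R (B *v \<xi>)) \<partial>lborel) \<le>
          ?f x + t * (trace (transpose B ** H x ** B) + 2 * e * trace (transpose B ** B)) + K * t^2"
        using gauss_taylor_upper[OF C fb Hpos \<beta> e] by blast
      have "c \<le> trace (transpose B ** H x ** B) + 2 * e * trace (transpose B ** B)"
      proof (rule le_of_le_add_small)
        fix t :: real assume t: "t > 0"
        define q where "q = c * (t - A1 * t^2) - K1 * t^2"
        have cV: "continuous_on UNIV (\<lambda>s. V (x - s) + q)" 
          by (intro continuous_intros continuous_on_translates V)
        have "?f x + q = average \<rho> (\<lambda>s. V (x - s) + q)"
          using average_add[OF m continuous_on_translates(1)[OF V(1)], of "\<lambda>_. q" x]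
          by (simp add: average_const[OF m] conv_def)
        also have "\<dots> \<le> (\<integral>s. \<rho> s * (\<integral>\<xi>. gauss_density \<xi> * V (x - s - sqrt (2 * t) *\<^sub>R (B *v \<xi>)) \<partial>lborel) \<partial>lborel)"
          unfolding average_def
        proof (rule Bochner_Integration.integral_mono[OF mollifier_integrable[OF m cV] gauss_conv_Fubini(1)[OF m V]])
          fix s
          show "\<rho> s * (V (x - s) + q) \<le> \<rho> s * (\<integral>\<xi>. gauss_density \<xi> * V (x - s - sqrt (2 * t) *\<^sub>R (B *v \<xi>)) \<partial>lborel)"
            using low[of s t] t mollifier_D(2)[OF m, of s] mollifier_D(4)[OF m, of s]
            by (cases "norm s < \<eta>") (auto simp: q_def intro!: mult_left_mono)
        qed
        also have "\<dots> = (\<integral>\<xi>. gauss_density \<xi> * ?f (x - sqrt (2 * t) *\<^sub>R (B *v \<xi>)) \<partial>lborel)"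
          by (rule gauss_conv_Fubini(2)[OF m V])
        also have "\<dots> \<le> ?f x + t * (trace (transpose B ** H x ** B) + 2 * e * trace (transpose B ** B)) + K * t^2"
          by (rule K[OF t])
        finally have "t * c \<le> t * (trace (transpose B ** H x ** B) + 2 * e * trace (transpose B ** B) + (K + c * A1 + K1) * t)"
          by (simp add: q_def algebra_simps power2_eq_square)
        then show "c \<le> trace (transpose B ** H x ** B) + 2 * e * trace (transpose B ** B) + (K + c * A1 + K1) * t"
          using t by simp
      qed
      then show "c \<le> trace (transpose B ** H x ** B) + (2 * trace (transpose B ** B)) * e" by (simp add: mult_ac)
    qed
  qed
qed

section \<open>Gradients at touching points\<close>

lemma gderiv_norm_le:
  fixes p :: "'a::euclidean_space"
  assumes g: "GDERIV f x :> p" and d: "d > 0" and le: "\<And>s. norm s < d \<Longrightarrow> f (x + s) \<le> f x + q \<bullet> s + L * norm s"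
  shows "norm (p - q) \<le> L"
proof (cases "p = q")
  case True
  define e where "e = d / 2"
  obtain b :: 'a where b: "b \<in> Basis" by (meson ex_in_conv nonempty_Basis)
  show ?thesis
  proof -
    have "0 \<le> L"
    proof (rule le_of_le_add_small)
      fix t :: real assume t: "t > 0"
      obtain d' where d': "d' > 0" "\<And>y. norm (y - x) < d' \<Longrightarrow> norm (f y - f x - (y - x) \<bullet> p) \<le> t * norm (y - x)"
        using g t unfolding gderiv_def has_derivative_at_alt by blast
      define r where "r = min d d' / 2"
      have r: "r > 0" "r < d" "r < d'" using d d' by (auto simp: r_def)
      have n: "norm (r *\<^sub>R b) = r" using b r by simp
      have "norm (f (x + r *\<^sub>R b) - f x - (r *\<^sub>R b) \<bullet> p) \<le> t * r" using d'(2)[of "x + r *\<^sub>R b"] n r by simp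
      moreover have "f (x + r *\<^sub>R b) \<le> f x + q \<bullet> (r *\<^sub>R b) + L * r" using le[of "r *\<^sub>R b"] n r by simp
      ultimately have "0 \<le> L * r + t * r" using True by (simp add: inner_commute)
      then have "0 \<le> (L + t) * r" by (simp add: algebra_simps)
      then show "0 \<le> L + 1 * t" using r by (simp add: zero_le_mult_iff)
    qed
    then show ?thesis using True by simp
  qed
next
  case False
  define n where "n = norm (p - q)"
  have n: "n > 0" using False by (simp add: n_def)
  show ?thesis
  proof (rule le_of_le_add_small)
    fix t :: real assume t: "t > 0"
    obtain d' where d': "d' > 0" "\<And>y. norm (y - x) < d' \<Longrightarrow> norm (f y - f x - (y - x) \<bullet> p) \<le> t * norm (y - x)"
      using g t unfolding gderiv_def has_derivative_at_alt by blast
    define r where "r = min d d' / (2 * n)"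
    have r: "r > 0" "r * n < d" "r * n < d'" using d d' n by (auto simp: r_def)
    \<comment> \<open>A step along p - q, where the slope p exceeds the slope q by |p - q|; the
      one-sided bound limits this excess by L.\<close>
    let ?s = "r *\<^sub>R (p - q)"
    have ns: "norm ?s = r * n" using r by (simp add: n_def)
    have 1: "norm (f (x + ?s) - f x - ?s \<bullet> p) \<le> t * (r * n)" using d'(2)[of "x + ?s"] ns r by simp
    have 2: "f (x + ?s) \<le> f x + q \<bullet> ?s + L * (r * n)" using le[of ?s] ns r by simp
    have "?s \<bullet> p - q \<bullet> ?s = r * n^2"
      by (simp add: n_def power2_norm_eq_inner inner_diff_left inner_diff_right inner_commute algebra_simps)
    then have "r * n^2 \<le> L * (r * n) + t * (r * n)" using 1 2 by (simp add: abs_le_iff)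
    then have "(r * n) * n \<le> (r * n) * (L + 1 * t)" by (simp add: power2_eq_square algebra_simps)
    then show "norm (p - q) \<le> L + 1 * t" using r n by (simp add: n_def[symmetric])
  qed
qed

text \<open>Step from z a little way in the direction opposite to z'. The touching function bounds V
  there from above to first order, and convexity along the line through that point, z and z' turns
  this into a lower bound at z'.\<close>

lemma convex_touching_subgradient:
  fixes V :: "'a::euclidean_space \<Rightarrow> real"
  assumes V: "convex_on U V" "open U" and g: "GDERIV \<phi> z :> q" and z: "z \<in> U" "z' \<in> U"
    and touch: "\<forall>\<^sub>F y in at z. V y - \<phi> y \<le> V z - \<phi> z"
  shows "V z + q \<bullet> (z' - z) \<le> V z'"
proof (rule le_of_le_add_small)
  fix t :: real assume t: "t > 0"
  let ?w = "z' - z"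
  obtain d where d: "d > 0" "\<And>y. norm (y - z) < d \<Longrightarrow> norm (\<phi> y - \<phi> z - (y - z) \<bullet> q) \<le> t * norm (y - z)"
    using g t unfolding gderiv_def has_derivative_at_alt by blast
  obtain d2 where d2: "d2 > 0" "\<And>y. y \<noteq> z \<Longrightarrow> dist y z < d2 \<Longrightarrow> V y - \<phi> y \<le> V z - \<phi> z"
    using touch unfolding eventually_at by auto
  obtain d3 where d3: "d3 > 0" "ball z d3 \<subseteq> U" using V(2) z(1) open_contains_ball by blast
  define r where "r = min d (min d2 d3) / (2 * (norm ?w + 1))"
  have r: "r > 0" using d d2 d3 by (auto simp: r_def intro!: divide_pos_pos add_nonneg_pos)
  have "r * norm ?w \<le> r * (norm ?w + 1)" using r by simp
  also have "\<dots> = min d (min d2 d3) / 2" by (simp add: r_def field_simps add_nonneg_eq_0_iff)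
  finally have rw: "r * norm ?w < d" "r * norm ?w < d2" "r * norm ?w < d3" using d d2 d3 
    by (auto simp: min_def split: if_splits)
  let ?y = "z - r *\<^sub>R ?w"
  have ny: "norm (?y - z) = r * norm ?w" using r by (simp del: norm_minus_commute)
  have yU: "?y \<in> U" using d3(2) rw(3) ny by (auto simp: dist_norm norm_minus_commute)
  have "V ?y \<le> V z + (\<phi> ?y - \<phi> z)"
  proof (cases "?y = z")
    case False
    then show ?thesis using d2(2)[of ?y] rw(2) ny by (simp add: dist_norm)
  next
    case True
    show ?thesis unfolding True by simp
  qed
  also have "\<phi> ?y - \<phi> z \<le> - r * (?w \<bullet> q) + t * (r * norm ?w)"
    using d(2)[of ?y] rw(1) ny by (simp add: abs_le_iff algebra_simps)
  finally have 1: "V ?y \<le> V z - r * (?w \<bullet> q) + t * (r * norm ?w)" by simp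
  have "z = (1 / (1 + r)) *\<^sub>R ?y + (r / (1 + r)) *\<^sub>R z'"
  proof -
    have "(1 + r) *\<^sub>R z = ?y + r *\<^sub>R z'" by (simp add: algebra_simps)
    then have "(1 / (1 + r)) *\<^sub>R ((1 + r) *\<^sub>R z) = (1 / (1 + r)) *\<^sub>R (?y + r *\<^sub>R z')" by simp
    then show ?thesis using r by (simp add: scaleR_add_right)
  qed
  moreover have "1 - r / (1 + r) = 1 / (1 + r)" using r by (simp add: field_simps)
  ultimately have "V z \<le> (1 / (1 + r)) * V ?y + (r / (1 + r)) * V z'"
    using convex_onD[OF V(1), of "r / (1 + r)" ?y z'] yU z r by simp
  then have "(1 + r) * V z \<le> (1 + r) * ((1 / (1 + r)) * V ?y + (r / (1 + r)) * V z')"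
    using r by (intro mult_left_mono) auto
  also have "\<dots> = V ?y + r * V z'" using r by (simp add: distrib_left)
  finally have "(1 + r) * V z \<le> V ?y + r * V z'" .
  then have "r * V z \<le> r * (V z' - ?w \<bullet> q + t * norm ?w)" using 1 by (simp add: algebra_simps)
  then have "V z \<le> V z' - ?w \<bullet> q + t * norm ?w" using r by simp
  then show "V z + q \<bullet> ?w \<le> V z' + norm ?w * t" by (simp add: inner_commute mult.commute)
qed

text \<open>Lets a function known only on a compact set enter Gaussian averages, which range over
  the whole space. Tietze's theorem is applied on K together with the exterior of a large ball,
  where the value 0 is prescribed.\<close>

lemma compact_support_extension:
  fixes f :: "real^'n \<Rightarrow> real"
  assumes K: "compact K" and f: "continuous_on K f" "\<And>x. x \<in> K \<Longrightarrow> 0 \<le> f x" "\<And>x. x \<in> K \<Longrightarrow> f x \<le> M" and M: "0 \<le> M"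
  obtains g a b where "continuous_on UNIV g" "\<And>x. 0 \<le> g x" "\<And>x. g x \<le> M" "\<And>x. x \<in> K \<Longrightarrow> g x = f x"
    "\<And>x. x \<notin> cbox a b \<Longrightarrow> g x = 0"
proof -
  obtain R where R: "R > 0" "\<And>x. x \<in> K \<Longrightarrow> norm x < R"
    using compact_imp_bounded[OF K] bounded_pos_less by blast
  let ?T = "{x::real^'n. R \<le> norm x}"
  have clT: "closed ?T" by (intro closed_Collect_le continuous_intros)
  have dis: "K \<inter> ?T = {}" using R by force
  let ?f = "\<lambda>x. if x \<in> K then f x else 0"
  have "continuous_on (K \<union> ?T) ?f"
    by (intro continuous_on_cases compact_imp_closed[OF K] clT f continuous_on_const) (use dis in auto)
  moreover have "closedin (top_of_set UNIV) (K \<union> ?T)"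
    using compact_imp_closed[OF K] clT by (simp add: closed_Un)
  moreover have "?f x \<in> cbox 0 M" if "x \<in> K \<union> ?T" for x using f M by simp
  ultimately obtain g where g: "continuous_on UNIV g" "\<And>x. x \<in> K \<union> ?T \<Longrightarrow> g x = ?f x" "\<And>x. x \<in> UNIV \<Longrightarrow> g x \<in> cbox 0 M"
    using Tietze_closed_interval_1[of "K \<union> ?T" ?f UNIV 0 M] M by blast
  show thesis
  proof (rule that[of g "\<chi> i. - R" "\<chi> i. R"])
    fix x :: "real^'n" assume "x \<notin> cbox (\<chi> i. - R) (\<chi> i. R)"
    then have "x \<in> ?T" using cball_subset_cbox_symmetric[of R] by force
    then show "g x = 0" using g(2)[of x] dis by auto
  next
    show "0 \<le> g x" "g x \<le> M" for x using g(3)[of x] by auto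
    show "g x = f x" if "x \<in> K" for x using g(2)[of x] that by simp
  qed (rule g)
qed

section \<open>Comparison of a convex subsolution with a supersolution\<close>

text \<open>\<open>F\<close> is the right-hand side of the strict subsolution and \<open>Gf\<close>
  that of the supersolution. The gap \<delta> is available only for gradients of norm at most L,
  which is why \<open>grad\<close> bounds the gradient at the doubled maximum through one function
  or the other. The supersolution is tested only where W < V, the region in which a contradiction is
  sought.\<close>

lemma comparison_convex:
  fixes V W :: "real^'n \<Rightarrow> real" and F Gf :: "real^'n \<Rightarrow> real^'n \<Rightarrow> real"
  assumes K: "compact K" and U: "open U" "K \<subseteq> U" and conv: "convex_on U V"
    and test: "test_above V U (\<lambda>z p X. psd X \<and> F z p \<le> det X)"
    and F: "continuous_on (U \<times> UNIV) (\<lambda>(z, p). F z p)"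
    and W: "usc_on K (\<lambda>x. - W x)"
    and super: "\<And>\<phi> G H y. C2 \<phi> G H \<Longrightarrow> y \<in> K \<Longrightarrow> W y < V y \<Longrightarrow> (\<And>y'. y' \<in> K \<Longrightarrow> W y - \<phi> y \<le> W y' - \<phi> y') \<Longrightarrow>
      psd (H y) \<Longrightarrow> det (H y) \<le> Gf y (G y)"
    and grad: "L-lipschitz_on U V \<or> (\<forall>\<phi> G H y. C2 \<phi> G H \<longrightarrow> y \<in> K \<longrightarrow> W y < V y \<longrightarrow>
      (\<forall>y'\<in>K. W y - \<phi> y \<le> W y' - \<phi> y') \<longrightarrow> norm (G y) \<le> L)"
    and L: "0 \<le> L" and \<delta>: "\<delta> > 0" "\<And>y p. y \<in> K \<Longrightarrow> norm p \<le> L \<Longrightarrow> Gf y p + \<delta> \<le> F y p"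
    and Gf: "\<And>y p. y \<in> K \<Longrightarrow> 0 \<le> Gf y p"
    and x0: "x0 \<in> K"
  shows "V x0 \<le> W x0"
proof (rule ccontr)
  assume neg: "\<not> ?thesis"
  define \<theta> where "\<theta> = (V x0 - W x0) / 2"
  have \<theta>: "\<theta> > 0" using neg by (simp add: \<theta>_def)
  obtain e0 where e0: "e0 > 0" "(\<Union>x\<in>K. cball x e0) \<subseteq> U"
    using compact_subset_open_imp_cball_epsilon_subset[OF K U] by blast
  \<comment> \<open>Closed neighbourhoods of K with decreasing margins: V is used on
    \<open>N e0\<close>, midpoint convexity with steps up to e0 / 4 on \<open>N (3/4 * e0)\<close>,
    and the doubled maximum is sought over \<open>N (e0/2)\<close>.\<close>
  define N where "N r = (\<Union>x\<in>K. cball x r)" for r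
  have Nc: "compact (N r)" for r
  proof -
    have "N r = {x + y |x y. x \<in> K \<and> y \<in> cball 0 r}"
    proof (intro equalityI subsetI)
      fix z assume "z \<in> N r"
      then obtain x where "x \<in> K" "dist x z \<le> r" by (auto simp: N_def)
      then show "z \<in> {x + y |x y. x \<in> K \<and> y \<in> cball 0 r}"
        by (intro CollectI exI[of _ x] exI[of _ "z - x"]) (auto simp: dist_norm norm_minus_commute)
    next
      fix z assume "z \<in> {x + y |x y. x \<in> K \<and> y \<in> cball 0 r}"
      then obtain x y where "x \<in> K" "norm y \<le> r" "z = x + y" by auto
      then show "z \<in> N r" by (auto simp: N_def dist_norm intro!: bexI[of _ x])
    qed
    then show ?thesis using compact_sums[OF K compact_cball[of 0 r]] by simp
  qed
  have N_near: "z \<in> N r" if a: "y \<in> N s" "dist y z \<le> t" "s + t \<le> r" for y z r s t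
  proof -
    obtain x where x: "x \<in> K" "dist x y \<le> s" using a(1) by (auto simp: N_def)
    have "dist x z \<le> r" using dist_triangle[of x z y] x a by linarith
    then show ?thesis using x by (auto simp: N_def)
  qed
  have KN: "y \<in> N 0" if "y \<in> K" for y using that by (auto simp: N_def)
  have NU: "N e0 \<subseteq> U" using e0 by (simp add: N_def)
  have Ncont: "continuous_on (N e0) V"
    using convex_on_continuous[OF U(1) conv] NU continuous_on_subset by blast
  have Vcont: "continuous_on U V" by (rule convex_on_continuous[OF U(1) conv])
  have x0N: "x0 \<in> N e0" using x0 e0 by (auto simp: N_def intro!: bexI[of _ x0])
  obtain xm where xm: "xm \<in> N e0" "\<And>y. y \<in> N e0 \<Longrightarrow> V xm \<le> V y"
    using continuous_attains_inf[OF Nc _ Ncont] x0N by blast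
  obtain xM where xM: "xM \<in> N e0" "\<And>y. y \<in> N e0 \<Longrightarrow> V y \<le> V xM"
    using continuous_attains_sup[OF Nc _ Ncont] x0N by blast
  \<comment> \<open>Subtracting the minimum makes the extension non-negative and bounded by the
    oscillation \<open>M\<close>, as the heat estimates demand.\<close>
  define mV where "mV = V xm"
  define M where "M = V xM - mV"
  have M: "0 \<le> M" using xm xM by (simp add: M_def mV_def)
  have cV0: "continuous_on (N e0) (\<lambda>x. V x - mV)" by (intro continuous_intros Ncont)
  obtain V' a b where V': "continuous_on UNIV V'" "\<And>y. 0 \<le> V' y" "\<And>y. V' y \<le> M"
      "\<And>x. x \<in> N e0 \<Longrightarrow> V' x = V x - mV" "\<And>y. y \<notin> cbox a b \<Longrightarrow> V' y = 0"
    using compact_support_extension[OF Nc cV0 _ _ M] xm xM by (auto simp: M_def mV_def)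
  have mid: "2 * V' y \<le> V' (y + s) + V' (y - s)" if "y \<in> N (3/4 * e0)" "norm s \<le> e0 / 4" for y s
  proof -
    have yN: "y \<in> N e0" by (rule N_near[OF that(1), of _ 0]) (use e0 in auto)
    have sN: "y + s \<in> N e0" "y - s \<in> N e0" by (rule N_near[OF that(1), of _ "e0/4"]; use that e0 in \<open>simp add: dist_norm\<close>)+
    have "V ((1 - 1/2) *\<^sub>R (y + s) + (1/2) *\<^sub>R (y - s)) \<le> (1 - 1/2) * V (y + s) + (1/2) * V (y - s)"
      by (rule convex_onD[OF conv]) (use sN NU in auto)
    also have "(1 - 1/2) *\<^sub>R (y + s) + (1/2) *\<^sub>R (y - s) = y"
      by (simp add: algebra_simps flip: scaleR_add_left)
    finally show ?thesis using V'(4)[OF yN] V'(4)[OF sN(1)] V'(4)[OF sN(2)] by simp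
  qed
  obtain yw where yw: "yw \<in> K" "\<And>y. y \<in> K \<Longrightarrow> - W y \<le> - W yw"
    using usc_on_attains_max[OF K _ W] x0 by blast
  define mW where "mW = W yw - mV"
  define B where "B = M + \<bar>mW\<bar> + 1"
  have B: "B > 0" using M by (simp add: B_def)
  have "uniformly_continuous_on (N e0 \<times> cball 0 (L + 1)) (\<lambda>(z, p). F z p)"
    by (intro compact_uniformly_continuous continuous_on_subset[OF F] compact_Times Nc compact_cball) (use NU in auto)
  then obtain \<omega> where \<omega>: "\<omega> > 0" "\<And>a b. a \<in> N e0 \<times> cball 0 (L + 1) \<Longrightarrow> b \<in> N e0 \<times> cball 0 (L + 1) \<Longrightarrow> dist b a < \<omega> \<Longrightarrow>
      dist ((\<lambda>(z, p). F z p) b) ((\<lambda>(z, p). F z p) a) < \<delta> / 2"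
    unfolding uniformly_continuous_on_def using \<delta>(1) by (meson half_gt_zero)
  have "uniformly_continuous_on (N e0) V" by (intro compact_uniformly_continuous Ncont Nc)
  then obtain \<omega>2 where \<omega>2: "\<omega>2 > 0" "\<And>a b. a \<in> N e0 \<Longrightarrow> b \<in> N e0 \<Longrightarrow> dist b a < \<omega>2 \<Longrightarrow> dist (V b) (V a) < \<theta>"
    unfolding uniformly_continuous_on_def using \<theta> by meson
  \<comment> \<open>The target for |x - y|: small against the room e0 and against both moduli of
    continuity.\<close>
  define \<tau> where "\<tau> = min (e0 / 4) (min (\<omega> / 4) (\<omega>2 / 2))"
  have \<tau>: "\<tau> > 0" "\<tau> \<le> e0 / 4" "\<tau> \<le> \<omega> / 4" "\<tau> \<le> \<omega>2 / 2" using e0 \<omega> \<omega>2 by (auto simp: \<tau>_def)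
  \<comment> \<open>The penalty at the maximum will be at most B, so that |x - y|^2 \<le> 2
    \<epsilon> B = \<tau>^2.\<close>
  define \<epsilon> where "\<epsilon> = \<tau>^2 / (2 * B)"
  have \<epsilon>: "\<epsilon> > 0" "2 * \<epsilon> * B = \<tau>^2" using \<tau> B by (auto simp: \<epsilon>_def)
  \<comment> \<open>Chosen after \<epsilon>: the last entry keeps the gradient error 13 \<eta> /
    \<epsilon> below both 1 and \<omega> / 2.\<close>
  define \<eta> where "\<eta> = min (min (e0 / 16) (min (\<omega> / 16) (\<omega>2 / 4))) (\<epsilon> * min 1 \<omega> / 32)"
  have \<eta>: "\<eta> > 0" "\<eta> \<le> e0 / 16" "\<eta> \<le> \<omega> / 16" "\<eta> \<le> \<omega>2 / 4" "\<eta> \<le> \<epsilon> * min 1 \<omega> / 32"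
    using e0 \<omega> \<omega>2 \<epsilon> by (auto simp: \<eta>_def)
  have \<eta>\<epsilon>: "13 * \<eta> / \<epsilon> < 1" "13 * \<eta> / \<epsilon> < \<omega> / 2"
  proof -
    have "\<eta> \<le> \<epsilon> * (min 1 \<omega> / 32)" using \<eta>(5) by simp
    then have "\<eta> / \<epsilon> \<le> min 1 \<omega> / 32" using \<epsilon>(1) by (simp only: pos_divide_le_eq mult.commute)
    moreover have "min 1 \<omega> \<le> 1" "min 1 \<omega> \<le> \<omega>" "13 * \<eta> / \<epsilon> = 13 * (\<eta> / \<epsilon>)" by auto
    ultimately show "13 * \<eta> / \<epsilon> < 1" "13 * \<eta> / \<epsilon> < \<omega> / 2" using \<omega>(1) by linarith+
  qed
  obtain \<rho> G\<rho> H\<rho> where m: "mollifier \<eta> (\<rho> :: real^'n \<Rightarrow> real) G\<rho> H\<rho>" using mollifier_exists[OF \<eta>(1)] by blast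
  obtain G H where C: "C2 (conv \<rho> V') G H" using conv_C2[OF m V'(1) V'(5)] by blast
  let ?f = "conv \<rho> V'"
  have fM: "?f y \<le> M" for y by (rule conv_bounds(2)[OF m V'(1), of 0]; rule V')
  have fge: "V' y \<le> ?f y" if "y \<in> N (3/4 * e0)" for y
    by (rule conv_ge_self[OF m V'(1)], rule mid[OF that]) (use \<eta> in auto)
  define W' where "W' y = W y - mV" for y
  have W'low: "mW \<le> W' y" if "y \<in> K" for y using yw(2)[OF that] by (simp add: mW_def W'_def)
  \<comment> \<open>x ranges over a larger set than y. Since |x - y| \<le> \<tau> \<le> e0 / 4 at
    the maximum, x has room to vary, while W is evaluated on K only.\<close>
  define \<Phi> where "\<Phi> p = - W (snd p) + (?f (fst p) - (norm (fst p - snd p))^2 / (2 * \<epsilon>))" for p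
  have "usc_on (N (e0/2) \<times> K) \<Phi>"
    unfolding \<Phi>_def
  proof (rule usc_on_add_continuous)
    show "usc_on (N (e0/2) \<times> K) (\<lambda>p. - W (snd p))"
      by (rule usc_on_compose[OF W continuous_on_snd[OF continuous_on_id]]) auto
    show "continuous_on (N (e0/2) \<times> K) (\<lambda>p. ?f (fst p) - (norm (fst p - snd p))^2 / (2 * \<epsilon>))"
      by (intro continuous_intros continuous_on_compose2[OF C2_D(6)[OF C, of UNIV]]) (use \<epsilon> in auto)
  qed
  moreover have "compact (N (e0/2) \<times> K)" by (intro compact_Times Nc K)
  moreover have x00: "(x0, x0) \<in> N (e0/2) \<times> K" using x0 e0 by (auto simp: N_def intro!: bexI[of _ x0])
  ultimately obtain pp where pp: "pp \<in> N (e0/2) \<times> K" "\<And>q. q \<in> N (e0/2) \<times> K \<Longrightarrow> \<Phi> q \<le> \<Phi> pp"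
    using usc_on_attains_max[of "N (e0/2) \<times> K" \<Phi>] by blast
  obtain x y where ppe: "pp = (x, y)" by (cases pp)
  have xN: "x \<in> N (e0/2)" and yK: "y \<in> K" using pp(1) ppe by auto
  have max: "?f x' - W' y' - (norm (x' - y'))^2 / (2 * \<epsilon>) \<le> ?f x - W' y - (norm (x - y))^2 / (2 * \<epsilon>)"
    if "x' \<in> N (e0/2)" "y' \<in> K" for x' y'
    using pp(2)[of "(x', y')"] that by (simp add: \<Phi>_def ppe W'_def)
  have "x0 \<in> N (3/4 * e0)" by (rule N_near[OF KN[OF x0], of _ 0]) (use e0 in auto)
  then have "V x0 - mV \<le> ?f x0" using fge V'(4)[OF x0N] by force
  then have big: "2 * \<theta> \<le> ?f x - W' y - (norm (x - y))^2 / (2 * \<epsilon>)"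
    using max[of x0 x0] x00 x0 by (simp add: \<theta>_def W'_def)
  have xy: "norm (x - y) \<le> \<tau>"
  proof -
    have "(norm (x - y))^2 / (2 * \<epsilon>) \<le> B"
      using big fM[of x] W'low[OF yK] \<theta> unfolding B_def by linarith
    then have "(norm (x - y))^2 \<le> \<tau>^2" using \<epsilon> by (simp add: field_simps)
    then show ?thesis using \<tau>(1) by (simp add: power2_le_iff_abs_le)
  qed
  have near_y: "z \<in> N r" if "dist y z \<le> r" for z r using that yK by (auto simp: N_def)
  have near_x: "z \<in> N r" if "dist x z + \<tau> \<le> r" for z r
    using dist_triangle[of y z x] that xy norm_minus_commute[of x y] by (intro near_y) (simp add: dist_norm)
  have yN: "y \<in> N e0" using e0 by (intro near_y) auto
  have quad: "(norm (x - y))^2 / (2 * \<epsilon>) \<ge> 0" using \<epsilon> by simp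
  \<comment> \<open>Moves the comparison to the single point y: of the surplus 2 \<theta> one
    \<theta> is lost, and W y < V y remains.\<close>
  have "?f x \<le> V y - mV + \<theta>"
  proof (rule conv_bounds(2)[OF m V'(1), of "-M"])
    show "- M \<le> V' (x - s)" for s using V'(2)[of "x - s"] M by linarith
    fix s :: "real^'n" assume s: "norm s < \<eta>"
    have xs: "x - s \<in> N e0" using s \<eta>(2) \<tau>(2) e0 by (intro near_x) (simp add: dist_norm)
    have "dist (x - s) y \<le> norm (x - y) + norm s"
      using norm_triangle_ineq4[of "x - y" s] by (simp add: dist_norm algebra_simps)
    then have "dist (x - s) y < \<omega>2" using xy s \<eta>(4) \<tau>(4) \<omega>2(1) by simp
    then have "dist (V (x - s)) (V y) < \<theta>" using \<omega>2(2)[OF yN xs] by simp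
    then show "V' (x - s) \<le> V y - mV + \<theta>" using V'(4)[OF xs] by (simp add: dist_real_def)
  qed
  then have WV: "W y < V y" using big quad \<theta> by (simp add: W'_def)
  let ?\<phi> = "\<lambda>z. ?f (z + (x - y))"
  have C\<phi>: "C2 ?\<phi> (\<lambda>z. G (z + (x - y))) (\<lambda>z. H (z + (x - y)))" by (rule C2_translate[OF C])
  \<comment> \<open>Moving x and y together leaves the penalty unchanged.\<close>
  have touch: "W y - ?\<phi> y \<le> W z - ?\<phi> z" if z: "z \<in> K" for z
  proof -
    have "z + (x - y) \<in> N (e0/2)"
      by (rule N_near[OF KN[OF z], of _ \<tau>]) (use xy \<tau> e0 norm_minus_commute[of x y] in \<open>auto simp: dist_norm\<close>)
    from max[OF this z] show ?thesis by (simp add: W'_def)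
  qed
  define p where "p = G x"
  have upper: "psd (H x) \<Longrightarrow> det (H x) \<le> Gf y p"
    using super[OF C\<phi> yK WV touch] by (simp add: p_def)
  have pL: "norm p \<le> L"
    using grad
  proof
    assume "\<forall>\<phi> G H y. C2 \<phi> G H \<longrightarrow> y \<in> K \<longrightarrow> W y < V y \<longrightarrow> (\<forall>y'\<in>K. W y - \<phi> y \<le> W y' - \<phi> y') \<longrightarrow> norm (G y) \<le> L"
    then have "norm (G (y + (x - y))) \<le> L" using C\<phi> yK WV touch by blast
    then show ?thesis by (simp add: p_def)
  next
    assume lip: "L-lipschitz_on U V"
    have "norm (G x - 0) \<le> L"
    proof (rule gderiv_norm_le[OF C2_D(1)[OF C]])
      show "e0 / 4 > 0" using e0 by simp
      fix s :: "real^'n" assume s: "norm s < e0 / 4"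
      note c = continuous_on_translates(1)[OF V'(1)]
      have "average \<rho> (\<lambda>\<sigma>. V' (x + s - \<sigma>)) \<le> average \<rho> (\<lambda>\<sigma>. V' (x - \<sigma>) + L * norm s)"
      proof (intro average_mono[OF m] continuous_intros c)
        fix \<sigma> :: "real^'n" assume \<sigma>: "norm \<sigma> < \<eta>"
        have n1: "x + s - \<sigma> \<in> N e0" using s \<sigma> \<eta>(2) \<tau>(2) e0 norm_triangle_ineq4[of \<sigma> s]
          by (intro near_x) (simp add: dist_norm)
        have n2: "x - \<sigma> \<in> N e0" using \<sigma> \<eta>(2) \<tau>(2) e0 by (intro near_x) (simp add: dist_norm)
        have "dist (V (x + s - \<sigma>)) (V (x - \<sigma>)) \<le> L * dist (x + s - \<sigma>) (x - \<sigma>)"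
          by (rule lipschitz_onD[OF lip]) (use n1 n2 NU in auto)
        then show "V' (x + s - \<sigma>) \<le> V' (x - \<sigma>) + L * norm s"
          using V'(4)[OF n1] V'(4)[OF n2] by (simp add: dist_norm)
      qed
      also have "\<dots> = ?f x + L * norm s"
        by (simp add: average_add[OF m c continuous_on_const] average_const[OF m] conv_def)
      finally show "?f (x + s) \<le> ?f x + 0 \<bullet> s + L * norm s" by (simp add: conv_def)
    qed
    then show ?thesis by (simp add: p_def)
  qed
  \<comment> \<open>Moving x alone: the penalty yields a paraboloid of opening 1 / \<epsilon> that
    touches the mollification from above at x.\<close>
  have expand: "?f z \<le> ?f x + ((1/\<epsilon>) *\<^sub>R (x - y)) \<bullet> (z - x) + (norm (z - x))^2 / (2 * \<epsilon>)" if "z \<in> N (e0/2)" for z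
  proof -
    have "(norm (z - y))^2 = (norm (x - y))^2 + 2 * ((x - y) \<bullet> (z - x)) + (norm (z - x))^2"
      unfolding power2_norm_eq_inner by (simp add: inner_diff_left inner_diff_right inner_commute)
    then have "(norm (z - y))^2 / (2 * \<epsilon>) = (norm (x - y))^2 / (2 * \<epsilon>) + ((x - y) \<bullet> (z - x)) / \<epsilon> + (norm (z - x))^2 / (2 * \<epsilon>)"
      by (simp add: add_divide_distrib)
    then show ?thesis using max[OF that yK] by simp
  qed
  have "norm (p - (1/\<epsilon>) *\<^sub>R (x - y)) \<le> 0"
  proof (rule le_of_le_add_small)
    fix t :: real assume t: "t > 0"
    have "norm (G x - (1/\<epsilon>) *\<^sub>R (x - y)) \<le> t"
    proof (rule gderiv_norm_le[OF C2_D(1)[OF C]])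
      show "min (e0 / 4) (2 * \<epsilon> * t) > 0" using e0 \<epsilon> t by simp
      fix s :: "real^'n" assume s: "norm s < min (e0 / 4) (2 * \<epsilon> * t)"
      have "x + s \<in> N (e0/2)" using s \<tau> by (intro near_x) (simp add: dist_norm)
      note expand[OF this]
      moreover have "(norm s)^2 / (2 * \<epsilon>) \<le> t * norm s"
      proof -
        have "norm s * norm s \<le> (2 * \<epsilon> * t) * norm s" using s by (intro mult_right_mono) auto
        then show ?thesis using \<epsilon> by (simp add: power2_eq_square field_simps)
      qed
      ultimately show "?f (x + s) \<le> ?f x + ((1/\<epsilon>) *\<^sub>R (x - y)) \<bullet> s + t * norm s" by simp
    qed
    then show "norm (p - (1/\<epsilon>) *\<^sub>R (x - y)) \<le> 0 + 1 * t" by (simp add: p_def)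
  qed
  then have p: "p = (1/\<epsilon>) *\<^sub>R (x - y)" by simp
  \<comment> \<open>V' minus the tangent plane of the mollification at x. Its mollified average at x
    vanishes, so its maximum over the \<eta>-ball is non-negative.\<close>
  define h where "h z = V' z - (?f x + p \<bullet> (z - x))" for z
  have hupper: "h z \<le> r^2 / (2 * \<epsilon>)" if "dist x z \<le> r" "r \<le> e0 / 4" for z r
  proof -
    have "z \<in> N (e0/2)" using that \<tau>(2) by (intro near_x) linarith
    moreover have "z \<in> N (3/4 * e0)" using that \<tau>(2) e0 by (intro near_x) linarith
    ultimately have "h z \<le> (norm (z - x))^2 / (2 * \<epsilon>)" using expand fge[of z] by (force simp: h_def p)
    also have "\<dots> \<le> r^2 / (2 * \<epsilon>)"
      using that \<epsilon> by (intro divide_right_mono power_mono) (auto simp: dist_norm norm_minus_commute)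
    finally show ?thesis .
  qed
  have hc: "continuous_on UNIV h" unfolding h_def by (intro continuous_intros V')
  obtain z0 where z0: "z0 \<in> cball x \<eta>" "\<And>z. z \<in> cball x \<eta> \<Longrightarrow> h z \<le> h z0"
    using continuous_attains_sup[of "cball x \<eta>" h] continuous_on_subset[OF hc] \<eta>(1) by auto
  have hz0: "h z0 \<ge> 0"
  proof -
    note c = continuous_on_translates(1)[OF V'(1)]
    have "average \<rho> (\<lambda>s. h (x - s)) \<le> average \<rho> (\<lambda>s. h z0)"
      by (intro average_mono[OF m] continuous_on_translates[OF hc] continuous_on_const z0) (simp add: dist_norm)
    moreover have "average \<rho> (\<lambda>s. h (x - s)) = 0"
    proof -
      have "(\<lambda>s. h (x - s)) = (\<lambda>s. V' (x - s) + (p \<bullet> s + - ?f x))" by (simp add: h_def fun_eq_iff)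
      then have "average \<rho> (\<lambda>s. h (x - s)) = average \<rho> (\<lambda>s. V' (x - s) + (p \<bullet> s + - ?f x))" by (simp only:)
      also have "\<dots> = average \<rho> (\<lambda>s. V' (x - s)) + average \<rho> (\<lambda>s. p \<bullet> s + - ?f x)"
        by (intro average_add[OF m c] continuous_intros)
      also have "average \<rho> (\<lambda>s. p \<bullet> s + - ?f x) = average \<rho> (\<lambda>s. p \<bullet> s) + average \<rho> (\<lambda>s. - ?f x)"
        by (intro average_add[OF m] continuous_intros)
      finally show ?thesis by (simp add: average_linear[OF m] average_const[OF m] conv_def)
    qed
    ultimately show ?thesis by (simp add: average_const[OF m])
  qed
  have hmid: "2 * h z1 \<le> h (z1 + s) + h (z1 - s)" if "z1 \<in> N (3/4 * e0)" "norm s \<le> e0 / 4" for z1 s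
    using mid[OF that] by (simp add: h_def inner_diff_right inner_add_right)
  \<comment> \<open>Reflect z through the maximum point z0, where h \<ge> 0: midpoint convexity
    gives h z \<ge> - h (2 z0 - z), and 2 z0 - z lies within 4 \<eta> of x.\<close>
  have hlower: "- (8 * \<eta>^2 / \<epsilon>) \<le> h z" if z: "dist x z \<le> 2 * \<eta>" for z
  proof -
    let ?s = "z - z0"
    have d0: "dist x z0 \<le> \<eta>" using z0 by simp
    have "norm ?s \<le> 3 * \<eta>" using dist_triangle[of z z0 x] z d0 by (simp add: dist_norm norm_minus_commute)
    then have s: "norm ?s \<le> e0 / 4" using \<eta>(1,2) by linarith
    have "z0 \<in> N (3/4 * e0)" using d0 \<eta>(2) \<tau>(2) e0 by (intro near_x) linarith
    from hmid[OF this s] have "2 * h z0 \<le> h z + h (z0 - ?s)" by simp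
    moreover have "h (z0 - ?s) \<le> (4 * \<eta>)^2 / (2 * \<epsilon>)"
    proof (rule hupper)
      have "x - (z0 - ?s) = 2 *\<^sub>R (x - z0) - (x - z)" by (simp add: algebra_simps scaleR_2)
      then have "norm (x - (z0 - ?s)) \<le> norm (2 *\<^sub>R (x - z0)) + norm (x - z)" by (metis norm_triangle_ineq4)
      then show "dist x (z0 - ?s) \<le> 4 * \<eta>" using d0 z by (simp add: dist_norm)
    qed (use \<eta> in auto)
    moreover have "(4 * \<eta>)^2 / (2 * \<epsilon>) = 8 * \<eta>^2 / \<epsilon>" by (simp add: power_mult_distrib)
    ultimately show ?thesis using hz0 by linarith
  qed
  \<comment> \<open>Half of the gap \<delta> is kept; the other half is given to the variation of F
    between (y, p) and (z, q).\<close>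
  define c where "c = Gf y p + \<delta> / 2"
  have c0: "c \<ge> 0" using Gf[OF yK, of p] \<delta>(1) by (simp add: c_def)
  define k where "k = root CARD('n) c"
  have k: "k \<ge> 0" "k ^ CARD('n) = c" using c0 by (auto simp: k_def)
  have tests: "test_above V' (ball x (2 * \<eta>)) (\<lambda>z p X. psd X \<and> k ^ CARD('n) \<le> det X)"
    unfolding test_above_def
  proof (intro allI impI ballI)
    fix \<phi> G\<phi> H\<phi> z
    assume \<phi>: "C2 \<phi> G\<phi> H\<phi>" and z: "z \<in> ball x (2 * \<eta>)" and ev: "\<forall>\<^sub>F w in at z. V' w - \<phi> w \<le> V' z - \<phi> z"
    have zx: "dist x z \<le> 2 * \<eta>" using z by simp
    have zN: "z \<in> N e0" using zx \<eta>(2) \<tau>(2) e0 by (intro near_x) linarith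
    have ballN: "w \<in> N e0" if "dist z w \<le> e0 / 4" for w
      using that dist_triangle[of x w z] zx \<eta>(2) \<tau>(2) e0 by (intro near_x) linarith
    have "\<forall>\<^sub>F w in at z. dist w z < e0 / 4" unfolding eventually_at using e0 by (intro exI[of _ "e0/4"]) auto
    then have evV: "\<forall>\<^sub>F w in at z. V w - \<phi> w \<le> V z - \<phi> z"
      using ev
    proof eventually_elim
      case (elim w)
      then have "w \<in> N e0" by (intro ballN) (simp add: dist_commute)
      then show ?case using elim(2) V'(4) zN by simp
    qed
    have "z \<in> U" using zN NU by auto
    then have *: "psd (H\<phi> z)" "F z (G\<phi> z) \<le> det (H\<phi> z)" using test \<phi> evV unfolding test_above_def by blast+
    define q where "q = G\<phi> z"
    \<comment> \<open>Step \<eta> from z in the direction q - p. The subgradient inequality gives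
      \<eta> |q - p| \<le> h w - h z, where h w \<le> 9 \<eta>^2 / (2 \<epsilon>) \<le> 5 \<eta>^2 /
      \<epsilon> and - h z \<le> 8 \<eta>^2 / \<epsilon>; this is the origin of 13.\<close>
    have qp: "norm (q - p) \<le> 13 * \<eta> / \<epsilon>"
    proof (cases "q = p")
      case False
      define w where "w = z + (\<eta> / norm (q - p)) *\<^sub>R (q - p)"
      have wz: "norm (w - z) = \<eta>" using False \<eta>(1) by (simp add: w_def)
      have wN: "w \<in> N e0" using wz \<eta>(2) e0 by (intro ballN) (simp add: dist_norm norm_minus_commute)
      have "V z + q \<bullet> (w - z) \<le> V w"
        unfolding q_def using wN NU
        by (intro convex_touching_subgradient[OF conv U(1) C2_D(1)[OF \<phi>] \<open>z \<in> U\<close> _ evV]) auto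
      then have "h z + (q - p) \<bullet> (w - z) \<le> h w"
        using V'(4)[OF zN] V'(4)[OF wN] by (simp add: h_def inner_diff_left inner_diff_right)
      moreover have "(q - p) \<bullet> (w - z) = \<eta> * norm (q - p)"
        using False by (simp add: w_def power2_norm_eq_inner[symmetric] power2_eq_square)
      moreover have "h w \<le> (3 * \<eta>)^2 / (2 * \<epsilon>)"
        using dist_triangle[of x w z] zx wz \<eta>(2) e0 by (intro hupper) (auto simp: dist_norm norm_minus_commute)
      moreover have "(3 * \<eta>)^2 / (2 * \<epsilon>) \<le> 5 * (\<eta>^2 / \<epsilon>)" using \<epsilon>(1) by (simp add: power_mult_distrib field_simps)
      ultimately have "\<eta> * norm (q - p) \<le> 13 * (\<eta>^2 / \<epsilon>)" using hlower[OF zx] by simp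
      moreover have "13 * (\<eta>^2 / \<epsilon>) = \<eta> * (13 * \<eta> / \<epsilon>)" by (simp add: power2_eq_square)
      ultimately have "\<eta> * norm (q - p) \<le> \<eta> * (13 * \<eta> / \<epsilon>)" by (simp only:)
      then show ?thesis using \<eta>(1) by (simp only: mult_le_cancel_left_pos)
    qed (use \<eta> \<epsilon> in auto)
    have qL: "norm q \<le> L + 1"
      using norm_triangle_ineq[of p "q - p"] qp pL \<eta>\<epsilon>(1) by simp
    have "dist z y \<le> 2 * \<eta> + \<tau>"
      using dist_triangle[of z y x] zx xy by (simp add: dist_norm norm_minus_commute)
    then have zy: "dist z y < \<omega> / 2" using \<eta>(3) \<tau>(3) \<omega>(1) by linarith
    have "dist (z, q) (y, p) \<le> dist z y + dist q p"
      unfolding dist_Pair_Pair by (rule sqrt_sum_squares_le_sum) auto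
    also have "\<dots> < \<omega>" using zy qp \<eta>\<epsilon>(2) by (simp add: dist_norm)
    finally have "dist (F z q) (F y p) < \<delta> / 2"
      using \<omega>(2)[of "(y, p)" "(z, q)"] yN zN qL pL by (simp)
    then have "F y p - \<delta> / 2 \<le> F z q" unfolding dist_real_def by linarith
    then have "c \<le> F z q" using \<delta>(2)[OF yK pL] by (simp add: c_def)
    then show "psd (H\<phi> z) \<and> k ^ CARD('n) \<le> det (H\<phi> z)" using * by (simp add: k q_def)
  qed
  have mid': "2 * V' z \<le> V' (z + s) + V' (z - s)" if "z \<in> cball x (2 * \<eta>)" "norm s \<le> \<eta>" for z s
  proof (rule mid)
    show "z \<in> N (3/4 * e0)" using that \<eta>(2) \<tau>(2) e0 by (intro near_x) simp
    show "norm s \<le> e0 / 4" using that \<eta>(2) e0 by simp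
  qed
  have "psd (H x)" "k ^ CARD('n) \<le> det (H x)"
    by (rule mollified_det[OF m V'(1-3) V'(5) \<eta>(1) mid' k(1) tests C]; assumption)+
  then show False using upper \<delta>(1) by (simp add: k c_def)
qed

section \<open>A strictly convex barrier\<close>

text \<open>An orthogonal map takes y to a multiple of a coordinate axis; the matrix becomes
  diagonal with at most one entry different from 1.\<close>

lemma det_rank_one_update:
  fixes y :: "real^'n"
  shows "det (mat 1 + c *\<^sub>R outer y) = 1 + c * (y \<bullet> y)"
proof -
  obtain k :: 'n where True by blast
  define b where "b = norm y *\<^sub>R axis k (1::real)"
  have "norm y = norm b" by (simp add: b_def)
  then obtain f where f: "orthogonal_transformation f" "f y = b"
    using orthogonal_transformation_exists by blast
  define Q where "Q = matrix f"
  have lin: "linear f" using f(1) by (simp add: orthogonal_transformation_linear)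
  have Q: "Q *v y = b" using fun_cong[OF matrix_vector_mul(2)[OF lin], of y] by (simp add: Q_def f(2))
  have orth: "Q ** transpose Q = mat 1"
    using f(1) by (simp add: Q_def orthogonal_transformation_matrix orthogonal_matrix_def)
  have out: "Q *v (outer y *v (transpose Q *v h)) = outer b *v h" for h
  proof -
    have "Q *v (outer y *v (transpose Q *v h)) = (y \<bullet> (transpose Q *v h)) *\<^sub>R b"
      unfolding outer_mult_vec by (simp only: matrix_vector_mult_scaleR Q)
    also have "y \<bullet> (transpose Q *v h) = b \<bullet> h"
      unfolding Q[symmetric] by (metis dot_lmul_matrix inner_commute transpose_matrix_vector)
    finally show ?thesis by (simp add: outer_mult_vec)
  qed
  have orth': "Q *v (transpose Q *v h) = h" for h
    by (simp only: matrix_vector_mul_assoc orth matrix_vector_mul_lid)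
  have "(Q ** (mat 1 + c *\<^sub>R outer y) ** transpose Q) *v h = (mat 1 + c *\<^sub>R outer b) *v h" for h
    by (simp only: matrix_vector_mul_assoc[symmetric] matrix_vector_mult_add_rdistrib scaleR_mult_vec
        matrix_vector_right_distrib matrix_vector_mult_scaleR orth' out matrix_vector_mul_lid)
  then have "Q ** (mat 1 + c *\<^sub>R outer y) ** transpose Q = mat 1 + c *\<^sub>R outer b"
    by (simp add: matrix_eq)
  then have "det Q * det (mat 1 + c *\<^sub>R outer y) * det (transpose Q) = det (mat 1 + c *\<^sub>R outer b)"
    by (metis det_mul)
  moreover have "det Q * det (transpose Q) = 1" using arg_cong[OF orth, of det] by (simp add: det_mul)
  ultimately have "det (mat 1 + c *\<^sub>R outer y) = det (mat 1 + c *\<^sub>R outer b)"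
    by (metis mult.assoc mult.commute mult_1)
  also have "\<dots> = (\<Prod>i\<in>UNIV. (mat 1 + c *\<^sub>R outer b) $ i $ i)"
    by (rule det_diagonal) (auto simp: mat_def outer_def b_def axis_def)
  also have "\<dots> = (\<Prod>i\<in>UNIV. if i = k then 1 + c * (norm y * norm y) else 1)"
    by (rule prod.cong) (auto simp: mat_def outer_def b_def axis_def)
  also have "\<dots> = 1 + c * (y \<bullet> y)" by (simp add: power2_norm_eq_inner[symmetric] power2_eq_square)
  finally show ?thesis .
qed

lemma det_scaleR: "det (s *\<^sub>R X) = s ^ CARD('n) * det X" for X :: "real^'n^'n"
proof -
  have "s *\<^sub>R X = mat s ** X"
    by (simp add: matrix_eq scaleR_mult_vec mat_mult_vec flip: matrix_vector_mul_assoc)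
  moreover have "det (mat s :: real^'n^'n) = s ^ CARD('n)"
    by (subst det_diagonal) (auto simp: mat_def)
  ultimately show ?thesis by (simp add: det_mul)
qed

lemma root_det_scaleR:
  fixes X :: "real^'n^'n"
  assumes "0 \<le> s"
  shows "root CARD('n) (det (s *\<^sub>R X)) = s * root CARD('n) (det X)"
  using assms by (simp add: det_scaleR real_root_mult real_root_power_cancel)

lemma psd_scaleR: "0 \<le> s \<Longrightarrow> psd X \<Longrightarrow> psd (s *\<^sub>R X)"
  by (simp add: psd_def sym_matrices_def transpose_scaleR scaleR_mult_vec)

text \<open>The dimension enters through the rank one term of the Hessian: it adds the factor
  $(1 + 2\lambda|x-z|^2)^{1/n}$, which makes the determinant beat any multiple of the gradient for large $\lambda$.\<close>

lemma strictly_convex_barrier: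
  fixes S :: "(real^'n) set"
  assumes S: "bounded S" and K: "0 \<le> K"
  obtains \<psi> G H where "C2 \<psi> G H" "\<And>x. psd (H x)" "\<And>x. 0 \<le> \<psi> x"
    "\<And>x. x \<in> S \<Longrightarrow> 1 + K * norm (G x) \<le> root CARD('n) (det (H x))"
proof -
  obtain R where R: "R > 0" "\<And>x. x \<in> S \<Longrightarrow> norm x < R" using S bounded_pos_less by blast
  obtain k :: 'n where True by blast
  \<comment> \<open>A pole at distance at least 1 from S, so that the rank one term of the Hessian
    never degenerates on S.\<close>
  define z where "z = (R + 1) *\<^sub>R axis k (1::real)"
  have nz: "norm z = R + 1" using R by (simp add: z_def)
  define D where "D = 2 * R + 1"
  have xz: "1 \<le> norm (x - z)" "norm (x - z) \<le> D" if "x \<in> S" for x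
    using R(2)[OF that] norm_triangle_ineq2[of z x] norm_triangle_ineq4[of x z] nz
    by (auto simp: D_def norm_minus_commute)
  \<comment> \<open>Its n-th root is exactly the factor 1 + K D that has to be gained; |x - z| \<ge>
    1 passes it on to the determinant.\<close>
  define l where "l = (K * D + 1) ^ CARD('n)"
  have KD: "K * D + 1 \<ge> 1" using K R by (simp add: D_def)
  have l: "l \<ge> 1" unfolding l_def using KD by (rule one_le_power)
  define e where "e r = exp (l * r)" for r
  have e: "C2 (\<lambda>x. e (x \<bullet> x)) (\<lambda>x. (2 * (l * e (x \<bullet> x))) *\<^sub>R x) 
      (\<lambda>x::real^'n. mat (2 * (l * e (x \<bullet> x))) + (4 * (l^2 * e (x \<bullet> x))) *\<^sub>R outer x)"
    unfolding e_def
    by (rule C2_radial) (auto intro!: derivative_eq_intros continuous_intros simp: power2_eq_square)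
  define E where "E x = e ((x - z) \<bullet> (x - z))" for x
  define G where "G x = (2 * (l * E x)) *\<^sub>R (x - z)" for x
  define H where "H x = mat (2 * (l * E x)) + (4 * (l^2 * E x)) *\<^sub>R outer (x - z)" for x
  have C: "C2 E G H" using C2_translate[OF e, of "- z"] unfolding E_def G_def H_def by simp
  have E: "E x \<ge> 1" for x using l by (simp add: E_def e_def)
  have Hs: "H x = (2 * (l * E x)) *\<^sub>R (mat 1 + (2 * l) *\<^sub>R outer (x - z))" for x
    by (simp add: H_def matrix_eq matrix_vector_mult_add_rdistrib scaleR_mult_vec mat_mult_vec power2_eq_square scaleR_add_right)
  show thesis
  proof (rule that[OF C])
    show "psd (H x)" for x
      unfolding psd_def sym_matrices_def
    proof (intro conjI allI)
      show "H x \<in> {X. transpose X = X}" using C2_D(3)[OF C] by simp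
      fix \<xi>
      have "\<xi> \<bullet> (H x *v \<xi>) = (2 * (l * E x)) * (\<xi> \<bullet> \<xi> + 2 * l * (\<xi> \<bullet> (x - z))^2)"
        unfolding Hs by (simp add: scaleR_mult_vec matrix_vector_mult_add_rdistrib outer_mult_vec inner_add_right inner_commute power2_eq_square)
      then show "0 \<le> \<xi> \<bullet> (H x *v \<xi>)" using l E[of x] by simp
    qed
    show "0 \<le> E x" for x using E[of x] by simp
    fix x assume x: "x \<in> S"
    have pos: "2 * (l * E x) \<ge> 1" using l E[of x] mult_mono[of 1 l 1 "E x"] by simp
    have "1 + K * D = root CARD('n) l" unfolding l_def using KD by (simp add: real_root_power_cancel)
    also have "\<dots> \<le> root CARD('n) (1 + 2 * l * ((x - z) \<bullet> (x - z)))"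
    proof -
      have "1 \<le> (x - z) \<bullet> (x - z)" using xz(1)[OF x] by (simp add: power2_norm_eq_inner[symmetric])
      then have "l * 1 \<le> l * ((x - z) \<bullet> (x - z))" using l by (intro mult_left_mono) auto
      then have "l \<le> 1 + 2 * l * ((x - z) \<bullet> (x - z))" using l by linarith
      then show ?thesis by simp
    qed
    finally have r: "1 + K * D \<le> root CARD('n) (1 + 2 * l * ((x - z) \<bullet> (x - z)))" .
    have "K * norm (G x) = (2 * (l * E x)) * (K * norm (x - z))"
      using l E[of x] by (simp add: G_def)
    also have "\<dots> \<le> (2 * (l * E x)) * (K * D)" using xz(2)[OF x] K pos by (intro mult_left_mono) auto
    finally have "1 + K * norm (G x) \<le> 2 * (l * E x) * (1 + K * D)" using pos by (simp add: distrib_left)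
    also have "\<dots> \<le> 2 * (l * E x) * root CARD('n) (1 + 2 * l * ((x - z) \<bullet> (x - z)))"
      using r pos by (intro mult_left_mono) auto
    also have "\<dots> = root CARD('n) (det (H x))"
      unfolding Hs using pos by (subst root_det_scaleR) (auto simp: det_rank_one_update)
    finally show "1 + K * norm (G x) \<le> root CARD('n) (det (H x))" .
  qed
qed

text \<open>Converts a gap a between n-th roots into a gap a^n between determinants.\<close>

lemma power_add_ge:
  fixes x a :: real
  assumes "0 \<le> x" "0 \<le> a" "n > 0"
  shows "x ^ n + a ^ n \<le> (x + a) ^ n"
  using assms(3)
proof (induction n rule: nat_induct_non_zero)
  case (Suc n)
  have "x ^ Suc n + a ^ Suc n \<le> (x + a) * (x ^ n + a ^ n)"
    using assms(1,2) by (simp add: algebra_simps)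
  also have "\<dots> \<le> (x + a) * (x + a) ^ n" using Suc assms(1,2) by (intro mult_left_mono) auto
  finally show ?case by simp
qed simp

section \<open>Comparison after shrinking the domain\<close>

text \<open>Homothety with centre c and ratio 1 - \<tau>. It maps the closure of a convex open set
  containing c into the set itself, which lets a function on the set be evaluated beyond its
  closure.\<close>

definition shrink :: "'a::real_vector \<Rightarrow> real \<Rightarrow> 'a \<Rightarrow> 'a" where
  "shrink c \<tau> x = x - \<tau> *\<^sub>R (x - c)"

lemma shrink_alt: "shrink c \<tau> x = (1 - \<tau>) *\<^sub>R x + \<tau> *\<^sub>R c"
  by (simp add: shrink_def algebra_simps)

lemma shrink_closure_subset:
  fixes \<Omega> :: "'a::euclidean_space set"
  assumes "convex \<Omega>" "open \<Omega>" "c \<in> \<Omega>" "x \<in> closure \<Omega>" "0 < \<tau>" "\<tau> \<le> 1"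
  shows "shrink c \<tau> x \<in> \<Omega>"
  using mem_interior_closure_convex_shrink[of \<Omega> c x \<tau>] assms by (simp add: shrink_def interior_open)

text \<open>Contracting multiplies gradients by 1 - \<tau> and Hessians by its square. A test
  function for the perturbed function, minus \<epsilon> \<psi> and pulled back by the inverse
  homothety, tests v. Stating the result in n-th roots lets Minkowski's inequality add the
  contribution of \<psi>.\<close>

lemma test_above_shrink:
  fixes v :: "real^'n \<Rightarrow> real" and \<psi> :: "real^'n \<Rightarrow> real"
  assumes v: "test_above v \<Omega> (\<lambda>z p X. psd X \<and> h z p \<le> det X)" and h: "\<And>z p. z \<in> \<Omega> \<Longrightarrow> 0 \<le> h z p"
    and \<tau>: "0 < \<tau>" "\<tau> < 1" and \<epsilon>: "0 \<le> \<epsilon>" and \<psi>: "C2 \<psi> G\<psi> H\<psi>" "\<And>x. psd (H\<psi> x)"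
  shows "test_above (\<lambda>x. v (shrink c \<tau> x) + \<epsilon> * \<psi> x + b) {x. shrink c \<tau> x \<in> \<Omega>}
    (\<lambda>z p X. psd X \<and> (1 - \<tau>)^2 * root CARD('n) (h (shrink c \<tau> z) ((1 / (1 - \<tau>)) *\<^sub>R (p - \<epsilon> *\<^sub>R G\<psi> z))) +
        \<epsilon> * root CARD('n) (det (H\<psi> z)) \<le> root CARD('n) (det X))"
  unfolding test_above_def
proof (intro allI impI ballI)
  fix \<phi> G H z
  assume \<phi>: "C2 \<phi> G H" and z: "z \<in> {x. shrink c \<tau> x \<in> \<Omega>}"
    and ev: "\<forall>\<^sub>F y in at z. v (shrink c \<tau> y) + \<epsilon> * \<psi> y + b - \<phi> y \<le> v (shrink c \<tau> z) + \<epsilon> * \<psi> z + b - \<phi> z"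
  define s where "s = 1 / (1 - \<tau>)"
  have s: "s > 0" "(1 - \<tau>) * s = 1" using \<tau> by (auto simp: s_def)
  define A where "A = (mat s :: real^'n^'n)"
  define a where "a = - ((s * \<tau>) *\<^sub>R c)"
  \<comment> \<open>The inverse of the contraction, in the affine form that
    \<open>C2_affine_comp\<close> expects.\<close>
  define S where "S y = a + A *v y" for y
  have S_alt: "S y = s *\<^sub>R (y - \<tau> *\<^sub>R c)" for y by (simp add: S_def a_def A_def mat_mult_vec algebra_simps)
  have TS: "shrink c \<tau> (S y) = y" for y
    unfolding shrink_alt S_alt scaleR_scaleR s(2) by simp
  have ST: "S (shrink c \<tau> y) = y" for y
    unfolding shrink_alt S_alt using s by (simp add: mult.commute)
  have "C2 (\<lambda>x. \<phi> x + (- \<epsilon>) * \<psi> x) (\<lambda>x. G x + (- \<epsilon>) *\<^sub>R G\<psi> x) (\<lambda>x. H x + (- \<epsilon>) *\<^sub>R H\<psi> x)"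
    by (intro C2_add \<phi> C2_scale \<psi>)
  note * = C2_affine_comp[OF this, of a A, folded S_def]
  let ?w = "shrink c \<tau> z"
  have Sc: "(S \<longlongrightarrow> S ?w) (nhds ?w)"
  proof -
    have "continuous_on UNIV S" unfolding S_alt by (intro continuous_intros)
    then have "isCont S ?w" by (simp add: continuous_on_eq_continuous_at)
    then show ?thesis by (simp add: isCont_def tendsto_at_iff_tendsto_nhds)
  qed
  have "eventually (\<lambda>y. v (shrink c \<tau> y) + \<epsilon> * \<psi> y + b - \<phi> y \<le> v ?w + \<epsilon> * \<psi> z + b - \<phi> z) (nhds z)"
    using ev by (simp add: eventually_nhds_conv_at)
  then have "eventually (\<lambda>y. v (shrink c \<tau> (S y)) + \<epsilon> * \<psi> (S y) + b - \<phi> (S y) \<le> v ?w + \<epsilon> * \<psi> z + b - \<phi> z) (nhds ?w)"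
    using Sc unfolding ST by (rule eventually_compose_filterlim)
  then have "\<forall>\<^sub>F y in at ?w. v y - (\<phi> (S y) + (- \<epsilon>) * \<psi> (S y)) \<le> v ?w - (\<phi> (S ?w) + (- \<epsilon>) * \<psi> (S ?w))"
    unfolding TS ST by (simp add: eventually_nhds_conv_at algebra_simps)
  with v * z have "psd (transpose A ** (H (S ?w) + (- \<epsilon>) *\<^sub>R H\<psi> (S ?w)) ** A)"
     "h ?w (transpose A *v (G (S ?w) + (- \<epsilon>) *\<^sub>R G\<psi> (S ?w))) \<le> det (transpose A ** (H (S ?w) + (- \<epsilon>) *\<^sub>R H\<psi> (S ?w)) ** A)"
    unfolding test_above_def by blast+
  moreover have tA: "transpose A = A" by (simp add: A_def transpose_def mat_def vec_eq_iff)
  moreover have "A ** X ** A = s^2 *\<^sub>R X" for X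
    by (simp add: matrix_eq scaleR_mult_vec A_def mat_mult_vec matrix_vector_mult_scaleR power2_eq_square flip: matrix_vector_mul_assoc)
  ultimately have 1: "psd (s^2 *\<^sub>R (H z - \<epsilon> *\<^sub>R H\<psi> z))"
    and 2: "h ?w (s *\<^sub>R (G z - \<epsilon> *\<^sub>R G\<psi> z)) \<le> det (s^2 *\<^sub>R (H z - \<epsilon> *\<^sub>R H\<psi> z))"
    unfolding ST by (simp_all add: A_def mat_mult_vec)
  have "(1 / s^2) *\<^sub>R (s^2 *\<^sub>R (H z - \<epsilon> *\<^sub>R H\<psi> z)) = H z - \<epsilon> *\<^sub>R H\<psi> z" using s by simp
  then have X: "psd (H z - \<epsilon> *\<^sub>R H\<psi> z)" using psd_scaleR[OF _ 1, of "1 / s^2"] by simp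
  have Y: "psd (\<epsilon> *\<^sub>R H\<psi> z)" by (rule psd_scaleR[OF \<epsilon> \<psi>(2)])
  have sum: "H z - \<epsilon> *\<^sub>R H\<psi> z + \<epsilon> *\<^sub>R H\<psi> z = H z" by simp
  have "psd (H z)" using psd_add[OF X Y] by (simp only: sum)
  moreover have "root CARD('n) (det (H z - \<epsilon> *\<^sub>R H\<psi> z)) + root CARD('n) (det (\<epsilon> *\<^sub>R H\<psi> z)) \<le> root CARD('n) (det (H z))"
    using Minkowski_determinant[OF X Y] by (simp only: sum)
  moreover have "root CARD('n) (det (\<epsilon> *\<^sub>R H\<psi> z)) = \<epsilon> * root CARD('n) (det (H\<psi> z))"
    by (rule root_det_scaleR[OF \<epsilon>])
  moreover have "(1 - \<tau>)^2 * root CARD('n) (h ?w (s *\<^sub>R (G z - \<epsilon> *\<^sub>R G\<psi> z))) \<le> root CARD('n) (det (H z - \<epsilon> *\<^sub>R H\<psi> z))"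
  proof -
    have "root CARD('n) (h ?w (s *\<^sub>R (G z - \<epsilon> *\<^sub>R G\<psi> z))) \<le> s^2 * root CARD('n) (det (H z - \<epsilon> *\<^sub>R H\<psi> z))"
      using 2 by (simp add: root_det_scaleR[symmetric])
    then have "(1 - \<tau>)^2 * root CARD('n) (h ?w (s *\<^sub>R (G z - \<epsilon> *\<^sub>R G\<psi> z))) \<le> (1 - \<tau>)^2 * (s^2 * root CARD('n) (det (H z - \<epsilon> *\<^sub>R H\<psi> z)))"
      by (intro mult_left_mono) auto
    also have "\<dots> = ((1 - \<tau>) * s)^2 * root CARD('n) (det (H z - \<epsilon> *\<^sub>R H\<psi> z))" by (simp add: power_mult_distrib)
    finally show ?thesis by (simp only: s(2) power_one mult_1)
  qed
  ultimately show "psd (H z) \<and> (1 - \<tau>)^2 * root CARD('n) (h ?w ((1 / (1 - \<tau>)) *\<^sub>R (G z - \<epsilon> *\<^sub>R G\<psi> z))) +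
        \<epsilon> * root CARD('n) (det (H\<psi> z)) \<le> root CARD('n) (det (H z))"
    unfolding s_def by linarith
qed

lemma C2_lipschitz_on_convex:
  assumes C: "C2 \<psi> G H" and S: "convex S" and B: "\<And>x. x \<in> S \<Longrightarrow> norm (G x) \<le> B" "0 \<le> B"
  shows "B-lipschitz_on S \<psi>"
proof (rule lipschitz_onI)
  fix x y assume xy: "x \<in> S" "y \<in> S"
  have "norm (\<psi> x - \<psi> y) \<le> B * norm (x - y)"
  proof (rule differentiable_bound[OF S])
    fix w assume w: "w \<in> S"
    show "(\<psi> has_derivative (\<lambda>h. h \<bullet> G w)) (at w within S)"
      using C2_D(1)[OF C, of w] unfolding gderiv_def by (rule has_derivative_at_withinI)
    show "onorm (\<lambda>h. h \<bullet> G w) \<le> B"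
    proof (rule onorm_bound[OF B(2)])
      fix h
      have "norm (h \<bullet> G w) \<le> norm h * norm (G w)" unfolding real_norm_def by (rule Cauchy_Schwarz_ineq2)
      also have "\<dots> \<le> norm h * B" using B(1)[OF w] by (intro mult_left_mono) auto
      finally show "norm (h \<bullet> G w) \<le> B * norm h" by (simp add: mult.commute)
    qed
  qed (use xy in auto)
  then show "dist (\<psi> x) (\<psi> y) \<le> B * dist x y" by (simp add: dist_norm)
qed (rule B)

text \<open>The contracted v plus \<epsilon> \<psi>, lowered by a constant, is a strict subsolution
  near the closure, to which \<open>comparison_convex\<close> applies. \<open>bdry\<close> says that
  at a frontier point W can fall below the contracted v by more than \<theta> only where W < g, so
  that the equation is available there. The alternatives in \<open>lip\<close> serve the comparison
  of u with w and that of v with u.\<close>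

lemma comparison_shrink:
  fixes \<Omega> :: "(real^'n) set" and f :: "real^'n \<Rightarrow> real \<Rightarrow> real^'n \<Rightarrow> real" and g v W :: "real^'n \<Rightarrow> real"
  assumes \<Omega>: "open \<Omega>" "convex \<Omega>" "bounded \<Omega>" and c: "c \<in> \<Omega>"
    and f_cont: "continuous_on (closure \<Omega> \<times> UNIV \<times> UNIV) (\<lambda>(x, s, p). f x s p)"
    and f_nonneg: "\<And>x s p. x \<in> closure \<Omega> \<Longrightarrow> 0 \<le> f x s p"
    and f_mono: "\<And>x s t p. x \<in> closure \<Omega> \<Longrightarrow> s \<le> t \<Longrightarrow> f x s p \<le> f x t p"
    and f_lip: "\<And>R. R > 0 \<Longrightarrow> \<exists>C\<ge>0. \<forall>x\<in>closure \<Omega>. \<forall>s p q. \<bar>s\<bar> \<le> R \<and> norm p \<le> R \<and> norm q \<le> R \<longrightarrow>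
        \<bar>root CARD('n) (f x s p) - root CARD('n) (f x s q)\<bar> \<le> C * norm (p - q)"
    and v: "usc_on \<Omega> v" "continuous_on \<Omega> v" "\<And>x. x \<in> \<Omega> \<Longrightarrow> \<bar>v x\<bar> \<le> R0"
    and vtest: "test_above v \<Omega> (\<lambda>z p X. psd X \<and> f z (v z) p \<le> det X)"
    and W: "usc_on (closure \<Omega>) (\<lambda>x. - W x)"
    and super: "\<And>\<phi> G H y. C2 \<phi> G H \<Longrightarrow> y \<in> closure \<Omega> \<Longrightarrow> (\<And>y'. y' \<in> closure \<Omega> \<Longrightarrow> W y - \<phi> y \<le> W y' - \<phi> y') \<Longrightarrow>
      psd (H y) \<Longrightarrow> y \<in> \<Omega> \<or> W y < g y \<Longrightarrow> det (H y) \<le> f y (W y) (G y)"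
    and L: "0 \<le> L" and lip: "L-lipschitz_on \<Omega> v \<or> (L-lipschitz_on (closure \<Omega>) W \<and> (\<forall>y\<in>frontier \<Omega>. g y \<le> W y))"
    and bdry: "\<And>\<theta>. \<theta> > 0 \<Longrightarrow> \<exists>\<tau>0>0. \<forall>\<tau>. 0 < \<tau> \<and> \<tau> < \<tau>0 \<longrightarrow> (\<forall>y\<in>frontier \<Omega>. W y < v (shrink c \<tau> y) - \<theta> \<longrightarrow> W y < g y)"
    and d: "d > 0"
  shows "\<exists>\<tau>1>0. \<forall>\<tau>. 0 < \<tau> \<and> \<tau> < \<tau>1 \<longrightarrow> (\<forall>x\<in>closure \<Omega>. v (shrink c \<tau> x) - d \<le> W x)"
proof -
  let ?r = "\<lambda>x s p. root CARD('n) (f x s p)"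
  \<comment> \<open>The extra 1 is the largest gradient that \<epsilon> \<psi> may add.\<close>
  define L1 where "L1 = L + 1"
  \<comment> \<open>Bounds every argument at which the Lipschitz condition is invoked: values of v,
    and gradients of norm up to L1 + 1 magnified by 1 / (1 - \<tau>) \<le> 2.\<close>
  define R where "R = R0 + 2 * (L1 + 1) + 1"
  have R0: "R0 \<ge> 0" using v(3)[OF c] by linarith
  have L1: "L1 \<ge> 1" using L by (simp add: L1_def)
  have R: "R > 0" "R0 \<le> R" "2 * (L1 + 1) \<le> R" using R0 L1 by (auto simp: R_def)
  obtain C where C: "C \<ge> 0" "\<And>x s p q. x \<in> closure \<Omega> \<Longrightarrow> \<bar>s\<bar> \<le> R \<Longrightarrow> norm p \<le> R \<Longrightarrow> norm q \<le> R \<Longrightarrow>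
      \<bar>?r x s p - ?r x s q\<bar> \<le> C * norm (p - q)"
    using f_lip[OF R(1)] by blast
  have bc: "bounded (closure \<Omega>)" and cc: "compact (closure \<Omega>)" using \<Omega>(3) by (auto simp: bounded_closure compact_closure)
  \<comment> \<open>The barrier has to beat 2 C |D \<psi>|, the 2 being the bound on the
    magnification 1 / (1 - \<tau>) of gradients.\<close>
  obtain \<psi> G\<psi> H\<psi> where \<psi>: "C2 \<psi> G\<psi> H\<psi>" "\<And>x. psd (H\<psi> x)" "\<And>x. 0 \<le> \<psi> x"
    "\<And>x. x \<in> closure \<Omega> \<Longrightarrow> 1 + 2 * C * norm (G\<psi> x) \<le> root CARD('n) (det (H\<psi> x))"
    using strictly_convex_barrier[OF bc, of "2 * C"] C(1) by auto
  obtain \<rho> where \<rho>: "\<rho> > 0" "\<And>x. x \<in> closure \<Omega> \<Longrightarrow> norm x < \<rho>" using bc bounded_pos_less by blast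
  obtain B\<psi> where B\<psi>: "B\<psi> > 0" "\<And>x. x \<in> cball 0 \<rho> \<Longrightarrow> norm (G\<psi> x) \<le> B\<psi>"
  proof -
    have "bounded (G\<psi> ` cball 0 \<rho>)"
      by (intro compact_imp_bounded compact_continuous_image C2_D(5)[OF \<psi>(1)] compact_cball)
    then show thesis using that by (auto simp: bounded_pos)
  qed
  obtain C\<psi> where C\<psi>: "C\<psi> > 0" "\<And>x. x \<in> cball 0 \<rho> \<Longrightarrow> \<psi> x \<le> C\<psi>"
  proof -
    have "bounded (\<psi> ` cball 0 \<rho>)"
      by (intro compact_imp_bounded compact_continuous_image C2_D(6)[OF \<psi>(1)] compact_cball)
    then obtain B where "B > 0" "\<forall>y\<in>\<psi> ` cball 0 \<rho>. norm y \<le> B" by (auto simp: bounded_pos)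
    then show thesis using that[of B] by force
  qed
  \<comment> \<open>The loss d is shared: half is the frontier margin \<theta>, and the barrier term
    \<epsilon> \<psi> may use up to the other half.\<close>
  define \<theta> where "\<theta> = d / 2"
  define \<epsilon> where "\<epsilon> = min (1 / B\<psi>) (d / (2 * C\<psi>))"
  have \<theta>: "\<theta> > 0" using d by (simp add: \<theta>_def)
  have \<epsilon>: "\<epsilon> > 0" "\<epsilon> * B\<psi> \<le> 1" "\<epsilon> * C\<psi> \<le> d / 2"
  proof -
    show "\<epsilon> > 0" using B\<psi> C\<psi> d by (simp add: \<epsilon>_def)
    have "\<epsilon> \<le> 1 / B\<psi>" "\<epsilon> \<le> d / (2 * C\<psi>)" by (simp_all add: \<epsilon>_def)
    then show "\<epsilon> * B\<psi> \<le> 1" "\<epsilon> * C\<psi> \<le> d / 2" using B\<psi> C\<psi> by (auto simp: field_simps)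
  qed
  obtain \<tau>0 where \<tau>0: "\<tau>0 > 0" "\<And>\<tau> y. 0 < \<tau> \<Longrightarrow> \<tau> < \<tau>0 \<Longrightarrow> y \<in> frontier \<Omega> \<Longrightarrow> W y < v (shrink c \<tau> y) - \<theta> \<Longrightarrow> W y < g y"
    using bdry[OF \<theta>] by blast
  have rcont: "continuous_on (closure \<Omega> \<times> UNIV \<times> UNIV) (\<lambda>(x, s, p). ?r x s p)"
    using f_cont unfolding split_beta by (intro continuous_on_real_root)
  define P where "P = closure \<Omega> \<times> cball (0::real) R0 \<times> cball (0 :: real^'n) (2 * L1)"
  have cP: "compact P" unfolding P_def by (intro compact_Times cc compact_cball)
  have contP: "continuous_on P (\<lambda>(x, s, p). ?r x s p)"
    by (rule continuous_on_subset[OF rcont]) (auto simp: P_def)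
  have "bounded ((\<lambda>(x, s, p). ?r x s p) ` P)"
    by (intro compact_imp_bounded compact_continuous_image contP cP)
  then obtain Mr where Mr: "Mr > 0" "\<And>q. q \<in> P \<Longrightarrow> norm ((\<lambda>(x, s, p). ?r x s p) q) \<le> Mr"
    unfolding bounded_pos by blast
  \<comment> \<open>Of the gain \<epsilon> = 4 e, one e each goes to the continuity of the root of
    f, to the factor (1 - \<tau>)^2 and to the final gap.\<close>
  define e where "e = \<epsilon> / 4"
  have e: "e > 0" using \<epsilon> by (simp add: e_def)
  have "uniformly_continuous_on P (\<lambda>(x, s, p). ?r x s p)" by (intro compact_uniformly_continuous contP cP)
  then obtain \<omega> where \<omega>: "\<omega> > 0" "\<And>a b. a \<in> P \<Longrightarrow> b \<in> P \<Longrightarrow> dist b a < \<omega> \<Longrightarrow>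
      dist ((\<lambda>(x, s, p). ?r x s p) b) ((\<lambda>(x, s, p). ?r x s p) a) < e"
    unfolding uniformly_continuous_on_def using e by meson
  define D where "D = 2 * \<rho> + 2 * L1"
  have D: "D > 0" using \<rho> L1 by (simp add: D_def)
  \<comment> \<open>\<omega> / D controls the displacement of the point and of the gradient; e / (2
    Mr) controls the loss 1 - (1 - \<tau>)^2 \<le> 2 \<tau> in the factor.\<close>
  define \<tau>1 where "\<tau>1 = min (min \<tau>0 (1/2)) (min (\<omega> / D) (e / (2 * Mr)))"
  have \<tau>1: "\<tau>1 > 0" using \<tau>0 \<omega> D e Mr by (simp add: \<tau>1_def)
  have main: "v (shrink c \<tau> x) - d \<le> W x" if \<tau>: "0 < \<tau>" "\<tau> < \<tau>1" and x: "x \<in> closure \<Omega>" for \<tau> x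
  proof -
    have "\<tau> < \<tau>0" "\<tau> < 1/2" "\<tau> < \<omega> / D" "\<tau> < e / (2 * Mr)" using \<tau> by (auto simp: \<tau>1_def)
    then have \<tau>s: "\<tau> < \<tau>0" "\<tau> < 1/2" "\<tau> * D < \<omega>" "\<tau> * (2 * Mr) < e"
      using D Mr by (auto simp: pos_less_divide_eq)
    let ?T = "shrink c \<tau>"
    define U where "U = {x. ?T x \<in> \<Omega>} \<inter> ball 0 \<rho>"
    have Tcont: "continuous_on S ?T" for S unfolding shrink_def by (intro continuous_intros)
    have oT: "open {x. ?T x \<in> \<Omega>}"
      using open_vimage[OF \<Omega>(1) Tcont[of UNIV]] by (simp add: vimage_def)
    then have oU: "open U" unfolding U_def by (intro open_Int open_ball)
    have "convex {x. ?T x \<in> \<Omega>}"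
    proof (rule convexI)
      fix x y and a b :: real assume *: "x \<in> {x. ?T x \<in> \<Omega>}" "y \<in> {x. ?T x \<in> \<Omega>}" "0 \<le> a" "0 \<le> b" "a + b = 1"
      have "a *\<^sub>R ?T x + b *\<^sub>R ?T y = (1 - \<tau>) *\<^sub>R (a *\<^sub>R x + b *\<^sub>R y) + (a + b) *\<^sub>R (\<tau> *\<^sub>R c)"
        by (simp add: shrink_alt algebra_simps)
      also have "\<dots> = ?T (a *\<^sub>R x + b *\<^sub>R y)" by (simp only: *(5) shrink_alt scaleR_one)
      finally have "?T (a *\<^sub>R x + b *\<^sub>R y) = a *\<^sub>R ?T x + b *\<^sub>R ?T y" by simp
      then show "a *\<^sub>R x + b *\<^sub>R y \<in> {x. ?T x \<in> \<Omega>}" using convexD[OF \<Omega>(2)] * by simp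
    qed
    then have conU: "convex U" unfolding U_def by (intro convex_Int convex_ball)
    have KU: "closure \<Omega> \<subseteq> U"
      using shrink_closure_subset[OF \<Omega>(2,1) c _ \<tau>(1)] \<tau>s(2) \<rho>(2) by (auto simp: U_def)
    define V where "V x = v (?T x) + \<epsilon> * \<psi> x + (- \<epsilon> * C\<psi> - \<theta>)" for x
    have Vle: "V y \<le> v (?T y) - \<theta>" if "y \<in> closure \<Omega>" for y
    proof -
      have "\<psi> y \<le> C\<psi>" using C\<psi>(2)[of y] \<rho>(2)[OF that] by simp
      then have "\<epsilon> * \<psi> y \<le> \<epsilon> * C\<psi>" using \<epsilon> by simp
      then show ?thesis by (simp add: V_def)
    qed
    define F where "F z p = ((1 - \<tau>)^2 * ?r (?T z) (v (?T z)) ((1 / (1 - \<tau>)) *\<^sub>R (p - \<epsilon> *\<^sub>R G\<psi> z)) +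
        \<epsilon> * root CARD('n) (det (H\<psi> z))) ^ CARD('n)" for z p
    have base_nonneg: "0 \<le> (1 - \<tau>)^2 * ?r (?T z) (v (?T z)) q + \<epsilon> * root CARD('n) (det (H\<psi> z))" if "z \<in> U" for z q
      using that f_nonneg[of "?T z"] closure_subset[of \<Omega>] \<epsilon> psd_det_nonneg[OF \<psi>(2)]
      by (intro add_nonneg_nonneg mult_nonneg_nonneg) (auto simp: U_def subset_iff)
    have "test_above V {x. ?T x \<in> \<Omega>}
      (\<lambda>z p X. psd X \<and> (1 - \<tau>)^2 * ?r (?T z) (v (?T z)) ((1 / (1 - \<tau>)) *\<^sub>R (p - \<epsilon> *\<^sub>R G\<psi> z)) +
        \<epsilon> * root CARD('n) (det (H\<psi> z)) \<le> root CARD('n) (det X))"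
      unfolding V_def
      by (rule test_above_shrink[OF vtest]) (use \<tau> \<tau>s \<epsilon> \<psi> f_nonneg closure_subset[of \<Omega>] in auto)
    moreover have "F z p \<le> det X" if "z \<in> U" "psd X"
      "(1 - \<tau>)^2 * ?r (?T z) (v (?T z)) ((1 / (1 - \<tau>)) *\<^sub>R (p - \<epsilon> *\<^sub>R G\<psi> z)) +
        \<epsilon> * root CARD('n) (det (H\<psi> z)) \<le> root CARD('n) (det X)" for z p X
    proof -
      have "F z p \<le> (root CARD('n) (det X)) ^ CARD('n)"
        unfolding F_def by (rule power_mono[OF that(3) base_nonneg[OF that(1)]])
      then show ?thesis using psd_det_nonneg[OF that(2)] by simp
    qed
    ultimately have tests: "test_above V U (\<lambda>z p X. psd X \<and> F z p \<le> det X)"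
      unfolding test_above_def U_def by blast
    have uscV: "usc_on U V"
      unfolding V_def add.assoc
      by (intro usc_on_add_continuous usc_on_compose[OF v(1) Tcont] continuous_intros C2_D(6)[OF \<psi>(1)])
        (auto simp: U_def)
    have convV: "convex_on U V"
      using tests by (intro test_above_psd_imp_convex oU conU uscV) (auto simp: test_above_def)
    \<comment> \<open>The right-hand side of the supersolution is taken at the value V y instead of
      W y: since W y < V y and f is non-decreasing, this only enlarges it. V y in turn lies below
      the value of v that enters \<open>F\<close>.\<close>
    have "V x \<le> W x"
    proof (rule comparison_convex[OF cc oU KU convV tests _ W, where L = L1 and Gf = "\<lambda>y p. f y (V y) p" and \<delta> = "e ^ CARD('n)"])
      show "continuous_on (U \<times> UNIV) (\<lambda>(z, p). F z p)"
      proof -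
        have c1: "continuous_on (U \<times> UNIV) (\<lambda>w::(real^'n) \<times> (real^'n). v (?T (fst w)))"
          by (rule continuous_on_compose2[OF v(2)]) (auto simp: U_def intro!: continuous_on_compose2[OF Tcont[of UNIV]] continuous_intros)
        have "continuous_on (U \<times> UNIV) (\<lambda>w::(real^'n) \<times> (real^'n).
          (\<lambda>(x, s, p). ?r x s p) (?T (fst w), v (?T (fst w)), (1 / (1 - \<tau>)) *\<^sub>R (snd w - \<epsilon> *\<^sub>R G\<psi> (fst w))))"
          by (rule continuous_on_compose2[OF rcont])
            (auto simp: U_def intro!: c1[unfolded U_def] continuous_intros continuous_on_compose2[OF Tcont[of UNIV]] 
              continuous_on_compose2[OF C2_D(5)[OF \<psi>(1), of UNIV]] subsetD[OF closure_subset])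
        then have "continuous_on (U \<times> UNIV) (\<lambda>w::(real^'n) \<times> (real^'n).
          ?r (?T (fst w)) (v (?T (fst w))) ((1 / (1 - \<tau>)) *\<^sub>R (snd w - \<epsilon> *\<^sub>R G\<psi> (fst w))))" by simp
        moreover have "continuous_on (U \<times> UNIV) (\<lambda>w::(real^'n) \<times> (real^'n). root CARD('n) (det (H\<psi> (fst w))))"
          by (intro continuous_on_real_root continuous_on_compose2[OF continuous_on_det[of UNIV]]
              continuous_on_compose2[OF C2_D(4)[OF \<psi>(1), of UNIV]] continuous_intros) auto
        ultimately show ?thesis
          unfolding F_def split_beta by (intro continuous_on_power continuous_on_add continuous_on_mult continuous_on_const)
      qed
      fix \<phi> G H y
      assume *: "C2 \<phi> G H" "y \<in> closure \<Omega>" "W y < V y" "\<And>y'. y' \<in> closure \<Omega> \<Longrightarrow> W y - \<phi> y \<le> W y' - \<phi> y'" "psd (H y)"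
      have "y \<in> \<Omega> \<or> W y < g y"
      proof (cases "y \<in> \<Omega>")
        case False
        then have "y \<in> frontier \<Omega>" using *(2) \<Omega>(1) by (simp add: frontier_def interior_open)
        moreover have "W y < v (?T y) - \<theta>" using Vle[OF *(2)] *(3) by linarith
        ultimately show ?thesis using \<tau>0(2)[OF \<tau>(1) \<tau>s(1)] by blast
      qed simp
      then have "det (H y) \<le> f y (W y) (G y)" using super[OF *(1,2,4,5)] by blast
      also have "\<dots> \<le> f y (V y) (G y)" using *(2,3) by (intro f_mono) auto
      finally show "det (H y) \<le> f y (V y) (G y)" .
    next
      show "L1-lipschitz_on U V \<or> (\<forall>\<phi> G H y. C2 \<phi> G H \<longrightarrow> y \<in> closure \<Omega> \<longrightarrow> W y < V y \<longrightarrow>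
        (\<forall>y'\<in>closure \<Omega>. W y - \<phi> y \<le> W y' - \<phi> y') \<longrightarrow> norm (G y) \<le> L1)"
        using lip
      proof
        assume lv: "L-lipschitz_on \<Omega> v"
        have "L1-lipschitz_on U V"
        proof (rule lipschitz_onI)
          fix x y assume xy: "x \<in> U" "y \<in> U"
          have "B\<psi>-lipschitz_on (ball 0 \<rho>) \<psi>"
            by (rule C2_lipschitz_on_convex[OF \<psi>(1) convex_ball]) (use B\<psi> in auto)
          then have "dist (\<psi> x) (\<psi> y) \<le> B\<psi> * dist x y" using xy by (intro lipschitz_onD) (auto simp: U_def)
          then have "\<epsilon> * dist (\<psi> x) (\<psi> y) \<le> \<epsilon> * (B\<psi> * dist x y)" using \<epsilon> by (intro mult_left_mono) auto
          also have "\<dots> = (\<epsilon> * B\<psi>) * dist x y" by simp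
          also have "\<dots> \<le> 1 * dist x y" using \<epsilon>(2) by (intro mult_right_mono) auto
          finally have 1: "\<epsilon> * dist (\<psi> x) (\<psi> y) \<le> dist x y" by simp
          have "dist (v (?T x)) (v (?T y)) \<le> L * dist (?T x) (?T y)"
            by (rule lipschitz_onD[OF lv]) (use xy in \<open>auto simp: U_def\<close>)
          also have "dist (?T x) (?T y) = norm ((1 - \<tau>) *\<^sub>R (x - y))"
            by (simp add: shrink_alt dist_norm algebra_simps)
          also have "\<dots> \<le> 1 * dist x y" unfolding norm_scaleR dist_norm using \<tau> \<tau>s by (intro mult_right_mono) auto
          finally have 2: "dist (v (?T x)) (v (?T y)) \<le> L * dist x y" using L by (simp add: mult_left_mono)
          have "dist (V x) (V y) \<le> dist (v (?T x)) (v (?T y)) + dist (\<epsilon> * \<psi> x) (\<epsilon> * \<psi> y)"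
            unfolding V_def dist_real_def by linarith
          also have "dist (\<epsilon> * \<psi> x) (\<epsilon> * \<psi> y) = \<epsilon> * dist (\<psi> x) (\<psi> y)"
            using \<epsilon> by (simp add: dist_real_def abs_mult right_diff_distrib[symmetric])
          finally show "dist (V x) (V y) \<le> L1 * dist x y" using 1 2 by (simp add: L1_def algebra_simps)
        qed (use L1 in auto)
        then show ?thesis ..
      next
        \<comment> \<open>On the frontier g \<le> W contradicts W < g, so the touching points are
          interior, and there the Lipschitz bound of W limits the gradient of a function touching
          from below.\<close>
        assume lw: "L-lipschitz_on (closure \<Omega>) W \<and> (\<forall>y\<in>frontier \<Omega>. g y \<le> W y)"
        have "norm (G y) \<le> L1" if *: "C2 \<phi> G H" "y \<in> closure \<Omega>" "W y < V y"
          "\<forall>y'\<in>closure \<Omega>. W y - \<phi> y \<le> W y' - \<phi> y'" for \<phi> G H y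
        proof -
          have y\<Omega>: "y \<in> \<Omega>"
          proof (rule ccontr)
            assume "y \<notin> \<Omega>"
            then have y: "y \<in> frontier \<Omega>" using *(2) \<Omega>(1) by (simp add: frontier_def interior_open)
            have "W y < v (?T y) - \<theta>" using Vle[OF *(2)] *(3) by linarith
            then have "W y < g y" using \<tau>0(2)[OF \<tau>(1) \<tau>s(1) y] by blast
            then show False using lw y by force
          qed
          obtain r where r: "r > 0" "ball y r \<subseteq> \<Omega>" using \<Omega>(1) y\<Omega> open_contains_ball by blast
          have "norm (G y - 0) \<le> L"
          proof (rule gderiv_norm_le[OF C2_D(1)[OF *(1)] r(1)])
            fix s :: "real^'n" assume "norm s < r"
            then have ys: "y + s \<in> closure \<Omega>" using r(2) closure_subset[of \<Omega>] by (auto simp: dist_norm subset_iff)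
            have "dist (W (y + s)) (W y) \<le> L * dist (y + s) y" using lw ys *(2) by (intro lipschitz_onD) auto
            then have "W (y + s) - W y \<le> L * norm s" by (simp add: dist_norm)
            then show "\<phi> (y + s) \<le> \<phi> y + 0 \<bullet> s + L * norm s" using *(4) ys by fastforce
          qed
          then show ?thesis by (simp add: L1_def)
        qed
        then show ?thesis by blast
      qed
    next
      show "0 < e ^ CARD('n)" using e by simp
      fix y p :: "real^'n" assume y: "y \<in> closure \<Omega>" and p: "norm p \<le> L1"
      define s where "s = v (?T y)"
      define q where "q = (1 / (1 - \<tau>)) *\<^sub>R p"
      define q' where "q' = (1 / (1 - \<tau>)) *\<^sub>R (p - \<epsilon> *\<^sub>R G\<psi> y)"
      have T\<Omega>: "?T y \<in> \<Omega>" using KU y by (auto simp: U_def)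
      then have Tc: "?T y \<in> closure \<Omega>" using closure_subset[of \<Omega>] by auto
      have sR: "\<bar>s\<bar> \<le> R0" using v(3)[OF T\<Omega>] by (simp add: s_def)
      have inv: "1 / (1 - \<tau>) \<le> 2" "1 / (1 - \<tau>) > 0" using \<tau> \<tau>s by (auto simp: field_simps)
      have nq: "norm q \<le> 2 * L1"
      proof -
        have "norm q = (1 / (1 - \<tau>)) * norm p" using inv by (simp add: q_def)
        also have "\<dots> \<le> 2 * L1" using inv p by (intro mult_mono) auto
        finally show ?thesis .
      qed
      have y\<rho>: "y \<in> cball 0 \<rho>" using \<rho>(2)[OF y] by simp
      have \<epsilon>G: "\<epsilon> * norm (G\<psi> y) \<le> 1"
        using mult_left_mono[OF B\<psi>(2)[OF y\<rho>], of \<epsilon>] \<epsilon> by linarith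
      have nq': "norm q' \<le> 2 * (L1 + 1)"
      proof -
        have "norm (p - \<epsilon> *\<^sub>R G\<psi> y) \<le> L1 + 1"
          using norm_triangle_ineq4[of p "\<epsilon> *\<^sub>R G\<psi> y"] p \<epsilon>G \<epsilon> by simp
        then have "(1 / (1 - \<tau>)) * norm (p - \<epsilon> *\<^sub>R G\<psi> y) \<le> 2 * (L1 + 1)" using inv by (intro mult_mono) auto
        then show ?thesis using inv by (simp add: q'_def)
      qed
      have qq': "norm (q - q') \<le> 2 * (\<epsilon> * norm (G\<psi> y))"
      proof -
        have "q - q' = (1 / (1 - \<tau>)) *\<^sub>R (\<epsilon> *\<^sub>R G\<psi> y)" by (simp add: q_def q'_def scaleR_diff_right)
        then have "norm (q - q') = (1 / (1 - \<tau>)) * (\<epsilon> * norm (G\<psi> y))" using inv \<epsilon> by simp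
        also have "\<dots> \<le> 2 * (\<epsilon> * norm (G\<psi> y))" using inv \<epsilon> by (intro mult_right_mono) auto
        finally show ?thesis .
      qed
      have 1: "?r y s p - ?r (?T y) s q < e"
      proof -
        have "(?T y, s, q) \<in> P" "(y, s, p) \<in> P" using Tc sR nq y p L1 by (auto simp: P_def)
        moreover have "dist (?T y, s, q) (y, s, p) < \<omega>"
        proof -
          have "dist (?T y) y = \<tau> * norm (y - c)" using \<tau> by (simp add: shrink_def dist_norm)
          also have "\<dots> \<le> \<tau> * (2 * \<rho>)"
            using norm_triangle_ineq4[of y c] \<rho>(2)[OF y] \<rho>(2)[of c] c closure_subset[of \<Omega>] \<tau> by (intro mult_left_mono) auto
          finally have a: "dist (?T y) y \<le> \<tau> * (2 * \<rho>)" .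
          have "q - p = (\<tau> / (1 - \<tau>)) *\<^sub>R p"
          proof -
            have "1 / (1 - \<tau>) - 1 = \<tau> / (1 - \<tau>)" using \<tau>s by (simp add: field_simps)
            then show ?thesis unfolding q_def by (metis scaleR_left_diff_distrib scaleR_one)
          qed
          then have "dist q p = \<tau> * ((1 / (1 - \<tau>)) * norm p)" using \<tau> inv \<tau>s by (simp add: dist_norm)
          also have "\<dots> \<le> \<tau> * (2 * L1)" using \<tau> inv p by (intro mult_left_mono mult_mono) auto
          finally have b: "dist q p \<le> \<tau> * (2 * L1)" .
          have "dist (?T y, s, q) (y, s, p) \<le> dist (?T y) y + dist (s, q) (s, p)"
            unfolding dist_Pair_Pair[of "?T y"] by (rule sqrt_sum_squares_le_sum) auto
          also have "dist (s, q) (s, p) = dist q p" by (simp add: dist_Pair_Pair)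
          finally show ?thesis using a b \<tau>s(3) by (simp add: D_def algebra_simps)
        qed
        ultimately have "dist (?r (?T y) s q) (?r y s p) < e" using \<omega>(2) by fastforce
        then show ?thesis unfolding dist_real_def by linarith
      qed
      have 2: "?r (?T y) s q \<le> (1 - \<tau>)^2 * ?r (?T y) s q + e"
      proof -
        have "(?T y, s, q) \<in> P" using Tc sR nq by (auto simp: P_def)
        then have m: "?r (?T y) s q \<le> Mr" using Mr(2) by fastforce
        have nn: "0 \<le> ?r (?T y) s q" using f_nonneg[OF Tc] by simp
        have "(1 - (1 - \<tau>)^2) * ?r (?T y) s q \<le> (2 * \<tau>) * Mr"
          using m nn \<tau> Mr by (intro mult_mono) (auto simp: power2_eq_square algebra_simps)
        then show ?thesis using \<tau>s(4) by (simp add: algebra_simps)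
      qed
      have 3: "(1 - \<tau>)^2 * ?r (?T y) s q \<le> (1 - \<tau>)^2 * ?r (?T y) s q' + 2 * C * (\<epsilon> * norm (G\<psi> y))"
      proof -
        have "\<bar>?r (?T y) s q - ?r (?T y) s q'\<bar> \<le> C * norm (q - q')"
          using sR R nq nq' L1 by (intro C(2) Tc) auto
        also have "\<dots> \<le> C * (2 * (\<epsilon> * norm (G\<psi> y)))" using qq' C(1) by (intro mult_left_mono)
        finally have "?r (?T y) s q - ?r (?T y) s q' \<le> 2 * C * (\<epsilon> * norm (G\<psi> y))" by simp
        then have "(1 - \<tau>)^2 * (?r (?T y) s q - ?r (?T y) s q') \<le> (1 - \<tau>)^2 * (2 * C * (\<epsilon> * norm (G\<psi> y)))"
          by (intro mult_left_mono) auto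
        also have "\<dots> \<le> 1 * (2 * C * (\<epsilon> * norm (G\<psi> y)))"
          using \<tau> \<tau>s C(1) \<epsilon> by (intro mult_right_mono) (auto simp: power_le_one)
        finally show ?thesis by (simp add: algebra_simps)
      qed
      have "\<epsilon> * (1 + 2 * C * norm (G\<psi> y)) \<le> \<epsilon> * root CARD('n) (det (H\<psi> y))"
        using \<psi>(4)[OF y] \<epsilon> by (intro mult_left_mono) auto
      then have 4: "\<epsilon> + 2 * C * (\<epsilon> * norm (G\<psi> y)) \<le> \<epsilon> * root CARD('n) (det (H\<psi> y))" by (simp add: algebra_simps)
      have "V y \<le> s" using Vle[OF y] \<theta> by (simp add: s_def)
      then have "?r y (V y) p \<le> ?r y s p" using f_mono[OF y] by simp
      then have "?r y (V y) p + e \<le> (1 - \<tau>)^2 * ?r (?T y) s q' + \<epsilon> * root CARD('n) (det (H\<psi> y))"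
        using 1 2 3 4 \<epsilon>(1) unfolding e_def by linarith
      moreover have nn: "0 \<le> ?r y (V y) p" using f_nonneg[OF y] by simp
      ultimately have "(?r y (V y) p + e) ^ CARD('n) \<le> F y p"
        unfolding F_def q'_def[symmetric] s_def[symmetric] using e by (intro power_mono) auto
      moreover have "(?r y (V y) p) ^ CARD('n) + e ^ CARD('n) \<le> (?r y (V y) p + e) ^ CARD('n)"
        using nn e by (intro power_add_ge) auto
      moreover have "(?r y (V y) p) ^ CARD('n) = f y (V y) p" using f_nonneg[OF y] by simp
      ultimately show "f y (V y) p + e ^ CARD('n) \<le> F y p" by linarith
    qed (use L1 x f_nonneg in auto)
    moreover have "0 \<le> \<epsilon> * \<psi> x" using \<epsilon> \<psi>(3)[of x] by simp
    ultimately show ?thesis using \<epsilon>(3) by (simp add: V_def \<theta>_def)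
  qed
  then show ?thesis using \<tau>1 by blast
qed

section \<open>The Dirichlet problem\<close>

lemma modified_det_nonneg_imp_psd:
  assumes "modified_det detp" "transpose X = X" "0 \<le> detp X"
  shows "psd X" "detp X = det X"
proof -
  show "psd X"
  proof (rule ccontr)
    assume "\<not> psd X"
    then have "detp X < 0" using assms(1,2) by (simp add: modified_det_def sym_matrices_def)
    then show False using assms(3) by simp
  qed
  then show "detp X = det X" using assms(1) unfolding modified_det_def by blast
qed

text \<open>At a touching point the modified determinant is at least f \<ge> 0, which its sign
  condition permits only for a semidefinite Hessian. This is how convexity of subsolutions
  enters.\<close>

lemma subsolution_test_above:
  assumes detp: "modified_det detp" and \<Omega>: "open \<Omega>"
    and f_nonneg: "\<And>x s p. x \<in> closure \<Omega> \<Longrightarrow> 0 \<le> f x s p"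
    and v: "viscosity_subsolution detp \<Omega> f g v"
  shows "test_above v \<Omega> (\<lambda>z p X. psd X \<and> f z (v z) p \<le> det X)"
  unfolding test_above_def
proof (intro allI impI ballI)
  fix \<phi> G H z
  assume \<phi>: "C2 \<phi> G H" and z: "z \<in> \<Omega>" and ev: "\<forall>\<^sub>F y in at z. v y - \<phi> y \<le> v z - \<phi> z"
  have zc: "z \<in> closure \<Omega>" using z closure_subset by blast
  have "\<forall>\<^sub>F y in at z within closure \<Omega>. v y - \<phi> y \<le> v z - \<phi> z"
    using ev by (rule filter_leD[OF at_le[OF subset_UNIV]])
  then have "MA_op_lower detp \<Omega> f g z (v z) (G z) (H z) \<le> 0"
    using v C2_imp_C2_closure[OF \<phi>] zc unfolding viscosity_subsolution_def by blast
  then have le: "f z (v z) (G z) \<le> detp (H z)" using z by (simp add: MA_op_lower_def)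
  then have "0 \<le> detp (H z)" using f_nonneg[OF zc, of "v z" "G z"] by linarith
  from modified_det_nonneg_imp_psd[OF detp C2_D(3)[OF \<phi>] this] le
  show "psd (H z) \<and> f z (v z) (G z) \<le> det (H z)" by simp
qed

text \<open>At a frontier point with w < g the entry w - g is negative, so non-negativity of the
  maximum in the upper envelope falls to the entry with the equation.\<close>

lemma supersolution_test_below:
  assumes detp: "modified_det detp" and w: "viscosity_supersolution detp \<Omega> f g w"
    and \<phi>: "C2 \<phi> G H" and y: "y \<in> closure \<Omega>" and min: "\<And>y'. y' \<in> closure \<Omega> \<Longrightarrow> w y - \<phi> y \<le> w y' - \<phi> y'"
    and psd: "psd (H y)" and y': "y \<in> \<Omega> \<or> w y < g y"
  shows "det (H y) \<le> f y (w y) (G y)"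
proof -
  have "\<forall>\<^sub>F y' in at y within closure \<Omega>. w y - \<phi> y \<le> w y' - \<phi> y'"
    using min by (auto simp: eventually_at_filter intro!: always_eventually)
  then have "0 \<le> MA_op_upper detp \<Omega> f g y (w y) (G y) (H y)"
    using w C2_imp_C2_closure[OF \<phi>] y unfolding viscosity_supersolution_def by blast
  moreover have "detp (H y) = det (H y)" using detp psd unfolding modified_det_def by blast
  ultimately show ?thesis using y' by (auto simp: MA_op_upper_def max_def split: if_splits)
qed

text \<open>The test function $At - t^2$, with $t$ the distance to the supporting hyperplane at $x_0$, has a Hessian that is not
  positive semidefinite, so it can only touch $v$ at a frontier point where $v \le g$. Uniform convexity
  forces that point towards $x_0$ as $A \to \infty$.\<close>

lemma subsolution_le_boundary_data:
  fixes \<Omega> :: "(real^'n) set"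
  assumes detp: "modified_det detp" and \<Omega>: "open \<Omega>" "uniformly_convex \<Omega>"
    and f_nonneg: "\<And>x s p. x \<in> closure \<Omega> \<Longrightarrow> 0 \<le> f x s p"
    and g: "continuous_on (frontier \<Omega>) g"
    and v: "viscosity_subsolution detp \<Omega> f g v" and x0: "x0 \<in> frontier \<Omega>"
  shows "v x0 \<le> g x0"
proof (rule ccontr)
  assume neg: "\<not> ?thesis"
  have fr: "frontier \<Omega> = closure \<Omega> - \<Omega>" using \<Omega>(1) by (simp add: frontier_def interior_open)
  have conv: "convex \<Omega>" "bounded \<Omega>" using \<Omega>(2) by (auto simp: uniformly_convex_def)
  obtain \<alpha> where \<alpha>: "\<alpha> > 0" "\<And>x0 \<nu> x. x0 \<in> frontier \<Omega> \<Longrightarrow> outward_normal \<Omega> x0 \<nu> \<Longrightarrow> x \<in> closure \<Omega> \<Longrightarrow>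
      (x - x0) \<bullet> \<nu> \<le> - \<alpha> * (norm (x - x0))^2"
    using \<Omega>(2) unfolding uniformly_convex_def by blast
  have x0c: "x0 \<in> closure \<Omega>" using x0 fr by blast
  have "x0 \<notin> rel_interior \<Omega>" using x0 fr \<Omega>(1) by (simp add: rel_interior_open)
  then obtain a where a: "a \<noteq> 0" "\<And>y. y \<in> closure \<Omega> \<Longrightarrow> a \<bullet> x0 \<le> a \<bullet> y"
    using supporting_hyperplane_relative_frontier[OF conv(1) x0c] by metis
  define \<nu> where "\<nu> = (- 1 / norm a) *\<^sub>R a"
  have \<nu>: "norm \<nu> = 1" using a by (simp add: \<nu>_def)
  have "outward_normal \<Omega> x0 \<nu>"
    unfolding outward_normal_def
  proof (intro conjI ballI \<nu>)
    fix x assume "x \<in> closure \<Omega>"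
    then have le: "a \<bullet> x0 \<le> a \<bullet> x" by (rule a)
    have "(x - x0) \<bullet> \<nu> = (- 1 / norm a) * ((x - x0) \<bullet> a)" by (simp only: \<nu>_def inner_scaleR_right)
    also have "(x - x0) \<bullet> a = a \<bullet> x - a \<bullet> x0" by (subst inner_commute) (simp only: inner_diff_right)
    finally show "(x - x0) \<bullet> \<nu> \<le> 0" using le by (simp add: divide_nonpos_nonneg)
  qed
  then have uc: "(x - x0) \<bullet> \<nu> \<le> - \<alpha> * (norm (x - x0))^2" if "x \<in> closure \<Omega>" for x using \<alpha>(2)[OF x0 _ that] by blast
  define t where "t x = (x0 - x) \<bullet> \<nu>" for x
  have t: "\<alpha> * (norm (x - x0))^2 \<le> t x" if "x \<in> closure \<Omega>" for x
    using uc[OF that] by (simp add: t_def inner_diff_left)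
  have t0: "0 \<le> t x" if "x \<in> closure \<Omega>" for x
    using t[OF that] \<alpha>(1) by (meson less_imp_le mult_nonneg_nonneg order_trans zero_le_power2)
  obtain \<rho> where \<rho>: "\<rho> > 0" "\<And>x. x \<in> closure \<Omega> \<Longrightarrow> norm x < \<rho>"
    using bounded_closure[OF conv(2)] bounded_pos_less by blast
  have tD: "t x \<le> 2 * \<rho>" if "x \<in> closure \<Omega>" for x
  proof -
    have "t x \<le> norm (x0 - x) * norm \<nu>" unfolding t_def by (rule norm_cauchy_schwarz)
    also have "\<dots> \<le> 2 * \<rho>" using \<nu> norm_triangle_ineq4[of x0 x] \<rho>(2)[OF that] \<rho>(2)[OF x0c] by simp
    finally show ?thesis .
  qed
  have cc: "compact (closure \<Omega>)" using conv(2) by (simp add: compact_closure)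
  have ne: "closure \<Omega> \<noteq> {}" using x0c by (metis empty_iff)
  have usc: "usc_on (closure \<Omega>) v" using v by (simp add: viscosity_subsolution_def)
  obtain xM where xM: "xM \<in> closure \<Omega>" "\<And>x. x \<in> closure \<Omega> \<Longrightarrow> v x \<le> v xM"
    by (rule usc_on_attains_max[OF cc ne usc]) blast
  have "\<forall>\<^sub>F y in at x0 within frontier \<Omega>. dist (g y) (g x0) < v x0 - g x0"
    using g x0 neg by (auto simp: continuous_on_def tendsto_iff)
  then obtain r where r: "r > 0" "\<And>y. y \<in> frontier \<Omega> \<Longrightarrow> dist y x0 < r \<Longrightarrow> g y < v x0"
    unfolding eventually_at using neg by (force simp: dist_real_def)
  \<comment> \<open>The first summand gives A t - t^2 \<ge> (A / 2) t, because t \<le> 2 \<rho>. The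
    second makes this at least v xM - v x0 + 1 outside the ball of radius r about x0, since t \<ge>
    \<alpha> r^2 there.\<close>
  define A where "A = 4 * \<rho> + 2 * (v xM - v x0 + 1) / (\<alpha> * r^2)"
  have vM: "v x0 \<le> v xM" by (rule xM(2)[OF x0c])
  have A: "A \<ge> 4 * \<rho>" "2 * (v xM - v x0 + 1) \<le> A * (\<alpha> * r^2)"
  proof -
    have p: "\<alpha> * r^2 > 0" using \<alpha> r by simp
    then show "A \<ge> 4 * \<rho>" using vM by (simp add: A_def)
    have "2 * (v xM - v x0 + 1) = (2 * (v xM - v x0 + 1) / (\<alpha> * r^2)) * (\<alpha> * r^2)" using \<alpha>(1) r(1) by simp
    also have "\<dots> \<le> A * (\<alpha> * r^2)" using p \<rho>(1) by (intro mult_right_mono) (auto simp: A_def)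
    finally show "2 * (v xM - v x0 + 1) \<le> A * (\<alpha> * r^2)" .
  qed
  define Q where "Q = (-2) *\<^sub>R outer \<nu>"
  define \<phi> where "\<phi> x = 0 + (- A *\<^sub>R \<nu>) \<bullet> (x + - x0) + (x + - x0) \<bullet> (Q *v (x + - x0)) / 2" for x
  have C: "C2 \<phi> (\<lambda>x. - A *\<^sub>R \<nu> + Q *v (x + - x0)) (\<lambda>_. Q)"
    unfolding \<phi>_def by (rule C2_translate[OF C2_quadratic]) (simp only: Q_def transpose_scaleR transpose_outer)
  have \<phi>: "\<phi> x = A * t x - (t x)^2" for x
  proof -
    have 1: "(x + - x0) \<bullet> \<nu> = - t x" by (simp add: t_def inner_diff_left)
    then have 2: "\<nu> \<bullet> (x + - x0) = - t x" by (simp only: inner_commute)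
    show ?thesis
      unfolding \<phi>_def Q_def scaleR_mult_vec outer_mult_vec inner_scaleR_left inner_scaleR_right 1 2
      by (simp add: power2_eq_square)
  qed
  have \<phi>ge: "A / 2 * t x \<le> \<phi> x" if "x \<in> closure \<Omega>" for x
  proof -
    have "t x * t x \<le> (A / 2) * t x" using t0[OF that] tD[OF that] A(1) by (intro mult_right_mono) auto
    then show ?thesis by (simp add: \<phi> power2_eq_square)
  qed
  have usc2: "usc_on (closure \<Omega>) (\<lambda>x. v x + - \<phi> x)"
    by (intro usc_on_add_continuous usc continuous_on_minus C2_D(6)[OF C])
  obtain y where y: "y \<in> closure \<Omega>" "\<And>x. x \<in> closure \<Omega> \<Longrightarrow> v x + - \<phi> x \<le> v y + - \<phi> y"
    by (rule usc_on_attains_max[OF cc ne usc2]) blast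
  have "\<forall>\<^sub>F x in at y within closure \<Omega>. v x - \<phi> x \<le> v y - \<phi> y"
    using y(2) by (auto simp: eventually_at_filter intro!: always_eventually)
  then have le: "MA_op_lower detp \<Omega> f g y (v y) (- A *\<^sub>R \<nu> + Q *v (y + - x0)) Q \<le> 0"
    using v C2_imp_C2_closure[OF C] y(1) unfolding viscosity_subsolution_def by blast
  have symQ: "transpose Q = Q" using C2_D(3)[OF C] .
  have "\<not> psd Q"
  proof
    assume "psd Q"
    then have "0 \<le> \<nu> \<bullet> (Q *v \<nu>)" by (simp add: psd_def)
    also have "\<nu> \<bullet> (Q *v \<nu>) = - 2 * (\<nu> \<bullet> \<nu>)^2" 
      unfolding Q_def scaleR_mult_vec outer_mult_vec by (simp add: power2_eq_square)
    finally show False using \<nu> by (simp add: power2_norm_eq_inner[symmetric])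
  qed
  then have "detp Q < 0" using modified_det_nonneg_imp_psd(1)[OF detp symQ] by force
  then have pos: "0 < - detp Q + f y s p" for s p using f_nonneg[OF y(1), of s p] by linarith
  have "y \<notin> \<Omega>"
  proof
    assume "y \<in> \<Omega>"
    then show False using le pos[of "v y" "- A *\<^sub>R \<nu> + Q *v (y + - x0)"] by (simp add: MA_op_lower_def)
  qed
  then have yf: "y \<in> frontier \<Omega>" using y(1) fr by blast
  then have yg: "v y \<le> g y" using le pos[of "v y" "- A *\<^sub>R \<nu> + Q *v (y + - x0)"] fr
    by (auto simp: MA_op_lower_def min_def split: if_splits)
  have "\<phi> x0 = 0" by (simp add: \<phi> t_def)
  then have step: "v x0 \<le> v y - \<phi> y" using y(2)[OF x0c] by simp
  have "0 \<le> A / 2 * t y" using t0[OF y(1)] A(1) \<rho>(1) by (intro mult_nonneg_nonneg) auto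
  then have \<phi>y: "0 \<le> \<phi> y" using \<phi>ge[OF y(1)] by linarith
  have "norm (y - x0) < r"
  proof (rule ccontr)
    assume "\<not> norm (y - x0) < r"
    then have "r^2 \<le> (norm (y - x0))^2" using r(1) by (intro power_mono) auto
    then have "\<alpha> * r^2 \<le> t y" using t[OF y(1)] \<alpha>(1) by (meson less_imp_le mult_left_mono order_trans)
    then have "A * (\<alpha> * r^2) \<le> A * t y" using A(1) \<rho>(1) by (intro mult_left_mono) auto
    then have "v xM - v x0 + 1 \<le> \<phi> y" using A(2) \<phi>ge[OF y(1)] by simp
    then show False using step xM(2)[OF y(1)] by linarith
  qed
  then have "g y < v x0" using r(2)[OF yf] by (simp add: dist_norm)
  then show False using step yg \<phi>y by linarith
qed

section \<open>Bounds and limits along the contraction\<close>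

lemma lsc_on_imp_usc_on_minus:
  assumes "lsc_on S w"
  shows "usc_on S (\<lambda>x. - w x)"
  unfolding usc_on_def
proof (intro ballI allI impI)
  fix x c assume "x \<in> S" "- w x < c"
  then have "\<forall>\<^sub>F y in at x within S. - c < w y" using assms by (simp add: lsc_on_def)
  then show "\<forall>\<^sub>F y in at x within S. - w y < c" by (rule eventually_mono) simp
qed

text \<open>Each x is balanced about c by a point close to c on the opposite side; convexity at c
  bounds v x from below through v c and the upper bound M at that point.\<close>

lemma convex_bounded_below:
  fixes v :: "'a::euclidean_space \<Rightarrow> real"
  assumes \<Omega>: "open \<Omega>" "bounded \<Omega>" and c: "c \<in> \<Omega>" and v: "convex_on \<Omega> v" and M: "\<And>x. x \<in> \<Omega> \<Longrightarrow> v x \<le> M"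
  obtains m where "\<And>x. x \<in> \<Omega> \<Longrightarrow> m \<le> v x"
proof -
  obtain r where r: "r > 0" "ball c r \<subseteq> \<Omega>" using \<Omega>(1) c open_contains_ball by blast
  obtain \<rho> where \<rho>: "\<rho> > 0" "\<And>x. x \<in> \<Omega> \<Longrightarrow> norm x < \<rho>" using \<Omega>(2) bounded_pos_less by blast
  \<comment> \<open>Since |x - c| \<le> 2 \<rho>, the balancing point stays within r / 2 of
    c.\<close>
  define t where "t = r / (4 * \<rho>)"
  have t: "t > 0" using r \<rho> by (simp add: t_def)
  have "((1 + t) * v c - M) / t \<le> v x" if x: "x \<in> \<Omega>" for x
  proof -
    let ?y = "c - t *\<^sub>R (x - c)"
    have "norm (t *\<^sub>R (x - c)) \<le> t * (2 * \<rho>)"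
      using norm_triangle_ineq4[of x c] \<rho>(2)[OF x] \<rho>(2)[OF c] t by simp
    also have "\<dots> < r" using r \<rho> by (simp add: t_def)
    finally have "?y \<in> ball c r" by (simp add: dist_norm)
    then have y: "?y \<in> \<Omega>" using r by blast
    have "(1 + t) *\<^sub>R c = ?y + t *\<^sub>R x" by (simp add: algebra_simps)
    then have "(1 / (1 + t)) *\<^sub>R ((1 + t) *\<^sub>R c) = (1 / (1 + t)) *\<^sub>R (?y + t *\<^sub>R x)" by simp
    then have "c = (1 / (1 + t)) *\<^sub>R ?y + (t / (1 + t)) *\<^sub>R x" using t by (simp add: scaleR_add_right)
    moreover have "1 - t / (1 + t) = 1 / (1 + t)" using t by (simp add: field_simps)
    ultimately have "v c \<le> (1 / (1 + t)) * v ?y + (t / (1 + t)) * v x"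
      using convex_onD[OF v, of "t / (1 + t)" ?y x] y x t by simp
    then have "(1 + t) * v c \<le> (1 + t) * ((1 / (1 + t)) * v ?y + (t / (1 + t)) * v x)"
      using t by (intro mult_left_mono) auto
    also have "\<dots> = v ?y + t * v x" using t by (simp add: distrib_left)
    finally have "(1 + t) * v c - M \<le> t * v x" using M[OF y] by linarith
    then show ?thesis using t by (simp add: divide_le_eq mult.commute)
  qed
  then show thesis by (rule that)
qed

lemma shrink_tendsto: "((\<lambda>\<tau>. shrink c \<tau> x) \<longlongrightarrow> x) (at_right 0)" for x :: "'a::real_normed_vector"
proof -
  have "((\<lambda>\<tau>. x - \<tau> *\<^sub>R (x - c)) \<longlongrightarrow> x - 0 *\<^sub>R (x - c)) (at_right 0)" by (intro tendsto_intros)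
  then show ?thesis by (simp add: shrink_def)
qed

text \<open>The segment from x towards c stays in S, so continuity of h at x relative to S lets
  \<tau> tend to 0.\<close>

lemma le_of_eventually_shrink:
  fixes h :: "'a::real_normed_vector \<Rightarrow> real"
  assumes h: "(h \<longlongrightarrow> h x) (at x within S)" and S: "\<And>\<tau>. 0 < \<tau> \<Longrightarrow> \<tau> < 1 \<Longrightarrow> shrink c \<tau> x \<in> S"
    and le: "\<And>d. d > 0 \<Longrightarrow> \<exists>\<tau>1>0. \<forall>\<tau>. 0 < \<tau> \<and> \<tau> < \<tau>1 \<longrightarrow> h (shrink c \<tau> x) - d \<le> W"
  shows "h x \<le> W"
proof (rule le_of_le_add_small)
  fix d :: real assume d: "d > 0"
  have "((\<lambda>\<tau>. h (shrink c \<tau> x)) \<longlongrightarrow> h x) (at_right 0)"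
  proof (rule topological_tendstoI)
    fix T assume T: "open T" "h x \<in> T"
    have "\<forall>\<^sub>F y in at x within S. h y \<in> T" using h T by (rule topological_tendstoD)
    then obtain B where B: "open B" "x \<in> B" "\<forall>y\<in>B. y \<noteq> x \<longrightarrow> y \<in> S \<longrightarrow> h y \<in> T"
      unfolding eventually_at_topological by auto
    have "\<forall>\<^sub>F \<tau> in at_right 0. shrink c \<tau> x \<in> B"
      using shrink_tendsto B(1,2) by (rule topological_tendstoD)
    moreover have "\<forall>\<^sub>F \<tau> in at_right 0. 0 < \<tau> \<and> \<tau> < (1::real)"
      by (auto simp: eventually_at_right_field intro!: exI[of _ 1])
    ultimately show "\<forall>\<^sub>F \<tau> in at_right 0. h (shrink c \<tau> x) \<in> T"
      by eventually_elim (use B(3) T(2) S in metis)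
  qed
  moreover have "\<forall>\<^sub>F \<tau> in at_right 0. h (shrink c \<tau> x) \<le> W + d"
    using le[OF d] by (force simp: eventually_at_right_field)
  ultimately have "h x \<le> W + d" by (rule tendsto_upperbound) simp
  then show "h x \<le> W + 1 * d" by simp
qed

lemma env_of_continuous:
  fixes u :: "'a::first_countable_topology \<Rightarrow> real"
  assumes u: "continuous_on S u" and x: "x \<in> S"
  shows "lsc_env S u x = ereal (u x)" "usc_env S u x = ereal (u x)"
proof -
  have c: "x \<in> closure S" using x closure_subset by blast
  show "lsc_env S u x = ereal (u x)" by (rule env_continuous[OF u _ x c]) auto
  have "lsc_env S (\<lambda>y. - u y) x = ereal (- u x)"
    by (rule env_continuous[OF continuous_on_minus[OF u] _ x c]) auto
  then show "usc_env S u x = ereal (u x)" by (simp add: usc_env_eq)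
qed

theorem theorem13:
  fixes \<Omega> :: "(real^'n) set"
    and f :: "real^'n \<Rightarrow> real \<Rightarrow> real^'n \<Rightarrow> real"
    and g u v w :: "real^'n \<Rightarrow> real"
    and detp :: "real^'n^'n \<Rightarrow> real"
  assumes detp: "modified_det detp"
    and \<Omega>: "open \<Omega>" "uniformly_convex \<Omega>"
    and f_cont: "continuous_on (closure \<Omega> \<times> UNIV \<times> UNIV) (\<lambda>(x, s, p). f x s p)"
    and f_nonneg: "\<And>x s p. x \<in> closure \<Omega> \<Longrightarrow> 0 \<le> f x s p"
    and f_mono: "\<And>x s t p. x \<in> closure \<Omega> \<Longrightarrow> s \<le> t \<Longrightarrow> f x s p \<le> f x t p"
    and f_lip: "\<And>R. R > 0 \<Longrightarrow> \<exists>C\<ge>0. \<forall>x\<in>closure \<Omega>. \<forall>s p q.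
        \<bar>s\<bar> \<le> R \<and> norm p \<le> R \<and> norm q \<le> R \<longrightarrow>
        \<bar>root CARD('n) (f x s p) - root CARD('n) (f x s q)\<bar> \<le> C * norm (p - q)"
    and u_lip: "\<exists>L. L-lipschitz_on (closure \<Omega>) u"
    and u_sol: "viscosity_solution detp \<Omega> f g u"
    and u_bdry: "\<And>x. x \<in> frontier \<Omega> \<Longrightarrow> u x = g x"
    and v: "viscosity_subsolution detp \<Omega> f g v"
    and w: "viscosity_supersolution detp \<Omega> f g w"
  shows "\<forall>x\<in>closure \<Omega>. v x \<le> w x"
proof (cases "\<Omega> = {}")
  case False
  then obtain c where c: "c \<in> \<Omega>" by blast
  have fr: "frontier \<Omega> = closure \<Omega> - \<Omega>" using \<Omega>(1) by (simp add: frontier_def interior_open)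
  have conv: "convex \<Omega>" "bounded \<Omega>" using \<Omega>(2) by (auto simp: uniformly_convex_def)
  have cc: "compact (closure \<Omega>)" using conv(2) by (simp add: compact_closure)
  have sub: "\<Omega> \<subseteq> closure \<Omega>" by (rule closure_subset)
  obtain L where L: "L-lipschitz_on (closure \<Omega>) u" using u_lip by blast
  have L0: "0 \<le> L" using L by (rule lipschitz_on_nonneg)
  have ucont: "continuous_on (closure \<Omega>) u" using L by (rule lipschitz_on_continuous_on)
  obtain u1 u2 where u12: "\<And>x. x \<in> closure \<Omega> \<Longrightarrow> usc_env (closure \<Omega>) u x = ereal (u1 x)"
      "\<And>x. x \<in> closure \<Omega> \<Longrightarrow> lsc_env (closure \<Omega>) u x = ereal (u2 x)"
    and u1: "viscosity_subsolution detp \<Omega> f g u1" and u2: "viscosity_supersolution detp \<Omega> f g u2"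
    using u_sol unfolding viscosity_solution_def by blast
  \<comment> \<open>u is continuous on the closure, so both envelopes coincide with it there;
    outside the closure \<open>u1\<close> and \<open>u2\<close> are unrelated to u.\<close>
  have eq: "u1 x = u x" "u2 x = u x" if "x \<in> closure \<Omega>" for x
    using u12[OF that] env_of_continuous[OF ucont that] by auto
  \<comment> \<open>Continuity of the boundary data is inherited from u.\<close>
  have gcont: "continuous_on (frontier \<Omega>) g"
    by (rule continuous_on_eq[OF continuous_on_subset[OF ucont, of "frontier \<Omega>"]]) (use fr u_bdry in auto)
  have shrink\<Omega>: "shrink c \<tau> y \<in> \<Omega>" if "y \<in> closure \<Omega>" "0 < \<tau>" "\<tau> < 1" for \<tau> y
    using shrink_closure_subset[OF conv(1) \<Omega>(1) c] that by auto
  \<comment> \<open>Stated for an arbitrary subsolution, because it serves both v and the envelope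
    \<open>u1\<close>.\<close>
  have facts: "usc_on \<Omega> s" "convex_on \<Omega> s" "continuous_on \<Omega> s" "\<exists>R. \<forall>x\<in>\<Omega>. \<bar>s x\<bar> \<le> R"
      "test_above s \<Omega> (\<lambda>z p X. psd X \<and> f z (s z) p \<le> det X)" if s: "viscosity_subsolution detp \<Omega> f g s" for s
  proof -
    show t: "test_above s \<Omega> (\<lambda>z p X. psd X \<and> f z (s z) p \<le> det X)"
      by (rule subsolution_test_above[OF detp \<Omega>(1) f_nonneg s])
    have us: "usc_on (closure \<Omega>) s" using s by (simp add: viscosity_subsolution_def)
    then show usc: "usc_on \<Omega> s" using sub by (rule usc_on_subset)
    show cs: "convex_on \<Omega> s"
      by (rule test_above_psd_imp_convex[OF \<Omega>(1) conv(1) usc]) (use t in \<open>auto simp: test_above_def\<close>)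
    show "continuous_on \<Omega> s" by (rule convex_on_continuous[OF \<Omega>(1) cs])
    obtain xM where xM: "\<And>x. x \<in> closure \<Omega> \<Longrightarrow> s x \<le> s xM"
      by (rule usc_on_attains_max[OF cc _ us]) (use False in auto)
    obtain m where m: "\<And>x. x \<in> \<Omega> \<Longrightarrow> m \<le> s x"
      using convex_bounded_below[OF \<Omega>(1) conv(2) c cs, of "s xM"] xM sub by blast
    show "\<exists>R. \<forall>x\<in>\<Omega>. \<bar>s x\<bar> \<le> R"
    proof (intro exI ballI)
      fix x assume x: "x \<in> \<Omega>"
      then show "\<bar>s x\<bar> \<le> max \<bar>m\<bar> \<bar>s xM\<bar>" using m[OF x] xM[of x] sub by force
    qed
  qed
  obtain \<rho> where \<rho>: "\<rho> > 0" "\<And>x. x \<in> closure \<Omega> \<Longrightarrow> norm x < \<rho>"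
    using bounded_closure[OF conv(2)] bounded_pos_less by blast
  \<comment> \<open>The contraction moves points by at most 2 \<rho> \<tau>; L + 1 in place of L
    keeps the quotient meaningful when L = 0.\<close>
  have ushrink: "\<exists>\<tau>0>0. \<forall>\<tau>. 0 < \<tau> \<and> \<tau> < \<tau>0 \<longrightarrow> (\<forall>y\<in>closure \<Omega>. \<bar>u (shrink c \<tau> y) - u y\<bar> \<le> \<theta>)" if \<theta>: "\<theta> > 0" for \<theta>
  proof (intro exI[of _ "min 1 (\<theta> / (2 * (L + 1) * \<rho>))"] conjI allI impI ballI)
    show "0 < min 1 (\<theta> / (2 * (L + 1) * \<rho>))" using \<theta> L0 \<rho> by simp
    fix \<tau> y assume \<tau>: "0 < \<tau> \<and> \<tau> < min 1 (\<theta> / (2 * (L + 1) * \<rho>))" and y: "y \<in> closure \<Omega>"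
    have "\<tau> < \<theta> / (2 * (L + 1) * \<rho>)" using \<tau> by simp
    then have \<tau>2: "\<tau> * (2 * (L + 1) * \<rho>) < \<theta>" using L0 \<rho> by (simp add: pos_less_divide_eq)
    have "shrink c \<tau> y \<in> closure \<Omega>" using shrink\<Omega>[OF y] \<tau> sub by auto
    then have "dist (u (shrink c \<tau> y)) (u y) \<le> L * dist (shrink c \<tau> y) y" using y by (intro lipschitz_onD[OF L])
    also have "dist (shrink c \<tau> y) y = \<tau> * norm (y - c)" using \<tau> by (simp add: shrink_def dist_norm)
    also have "L * (\<tau> * norm (y - c)) \<le> (L + 1) * (\<tau> * (2 * \<rho>))"
      using norm_triangle_ineq4[of y c] \<rho>(2)[OF y] \<rho>(2)[of c] c sub \<tau> L0 by (intro mult_mono mult_left_mono) auto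
    also have "\<dots> \<le> \<theta>" using \<tau>2 by (simp add: mult_ac)
    finally show "\<bar>u (shrink c \<tau> y) - u y\<bar> \<le> \<theta>" by (simp add: dist_real_def)
  qed
  \<comment> \<open>The Lipschitz side is the subsolution. On the frontier u = g, so for small
    \<tau> a value of w below the contracted u by more than \<theta> lies below g.\<close>
  have uw: "u x \<le> w x" if x: "x \<in> closure \<Omega>" for x
  proof -
    obtain R0 where R0: "\<And>x. x \<in> \<Omega> \<Longrightarrow> \<bar>u1 x\<bar> \<le> R0" using facts(4)[OF u1] by blast
    have lip: "L-lipschitz_on \<Omega> u1"
      using lipschitz_on_subset[OF L sub] eq(1) sub by (auto simp: lipschitz_on_def subset_iff)
    have main: "\<exists>\<tau>1>0. \<forall>\<tau>. 0 < \<tau> \<and> \<tau> < \<tau>1 \<longrightarrow> (\<forall>x\<in>closure \<Omega>. u1 (shrink c \<tau> x) - d \<le> w x)" if d: "d > 0" for d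
    proof (rule comparison_shrink[where g=g and W=w, OF \<Omega>(1) conv c f_cont f_nonneg f_mono f_lip facts(1)[OF u1] facts(3)[OF u1] R0 facts(5)[OF u1] _ _ L0 _ _ d])
      show "usc_on (closure \<Omega>) (\<lambda>x. - w x)"
        using w by (intro lsc_on_imp_usc_on_minus) (simp add: viscosity_supersolution_def)
      show "det (H y) \<le> f y (w y) (G y)" if "C2 \<phi> G H" "y \<in> closure \<Omega>" "\<And>y'. y' \<in> closure \<Omega> \<Longrightarrow> w y - \<phi> y \<le> w y' - \<phi> y'"
        "psd (H y)" "y \<in> \<Omega> \<or> w y < g y" for \<phi> G H y
        by (rule supersolution_test_below[OF detp w that])
      show "L-lipschitz_on \<Omega> u1 \<or> (L-lipschitz_on (closure \<Omega>) w \<and> (\<forall>y\<in>frontier \<Omega>. g y \<le> w y))" using lip ..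
      fix \<theta> :: real assume \<theta>: "\<theta> > 0"
      obtain \<tau>0 where \<tau>0: "\<tau>0 > 0" "\<forall>\<tau>. 0 < \<tau> \<and> \<tau> < \<tau>0 \<longrightarrow> (\<forall>y\<in>closure \<Omega>. \<bar>u (shrink c \<tau> y) - u y\<bar> \<le> \<theta>)"
        using ushrink[OF \<theta>] by blast
      show "\<exists>\<tau>0>0. \<forall>\<tau>. 0 < \<tau> \<and> \<tau> < \<tau>0 \<longrightarrow> (\<forall>y\<in>frontier \<Omega>. w y < u1 (shrink c \<tau> y) - \<theta> \<longrightarrow> w y < g y)"
      proof (intro exI[of _ "min \<tau>0 1"] conjI allI impI ballI)
        show "0 < min \<tau>0 1" using \<tau>0 by simp
        fix \<tau> y assume \<tau>: "0 < \<tau> \<and> \<tau> < min \<tau>0 1" and y: "y \<in> frontier \<Omega>" and lt: "w y < u1 (shrink c \<tau> y) - \<theta>"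
        have yc: "y \<in> closure \<Omega>" using y fr by blast
        have "shrink c \<tau> y \<in> closure \<Omega>" using shrink\<Omega>[OF yc] \<tau> sub by auto
        then have "u1 (shrink c \<tau> y) = u (shrink c \<tau> y)" by (rule eq)
        moreover have "u (shrink c \<tau> y) - u y \<le> \<theta>" using \<tau>0(2)[rule_format, of \<tau> y] \<tau> yc by linarith
        ultimately show "w y < g y" using lt u_bdry[OF y] by linarith
      qed
    qed
    show ?thesis
    proof (rule le_of_eventually_shrink[of u x "closure \<Omega>" c])
      show "(u \<longlongrightarrow> u x) (at x within closure \<Omega>)" using ucont x by (simp add: continuous_on_def)
      show sc: "shrink c \<tau> x \<in> closure \<Omega>" if "0 < \<tau>" "\<tau> < 1" for \<tau> using shrink\<Omega>[OF x that] sub by auto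
      show "\<exists>\<tau>1>0. \<forall>\<tau>. 0 < \<tau> \<and> \<tau> < \<tau>1 \<longrightarrow> u (shrink c \<tau> x) - d \<le> w x" if d: "d > 0" for d
      proof -
        obtain \<tau>1 where \<tau>1: "\<tau>1 > 0" "\<forall>\<tau>. 0 < \<tau> \<and> \<tau> < \<tau>1 \<longrightarrow> (\<forall>x\<in>closure \<Omega>. u1 (shrink c \<tau> x) - d \<le> w x)"
          using main[OF d] by blast
        have "u (shrink c \<tau> x) - d \<le> w x" if "0 < \<tau>" "\<tau> < min \<tau>1 1" for \<tau>
          using \<tau>1(2)[rule_format, of \<tau> x] x eq(1)[OF sc, of \<tau>] that by simp
        then show ?thesis using \<tau>1(1) by (intro exI[of _ "min \<tau>1 1"]) auto
      qed
    qed
  qed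
  \<comment> \<open>Supplies the frontier values of the conclusion, where v is not followed along
    the contraction, and also the frontier margin needed in \<open>vu\<close>.\<close>
  have vg: "v x \<le> u x" if x: "x \<in> frontier \<Omega>" for x
    using subsolution_le_boundary_data[OF detp \<Omega> f_nonneg gcont v x] u_bdry[OF x] by simp
  \<comment> \<open>The Lipschitz side is now the supersolution \<open>u2\<close>. The limit in
    \<tau> uses continuity of v, which convexity gives in \<Omega>.\<close>
  have vu: "v x \<le> u x" if x: "x \<in> \<Omega>" for x
  proof -
    obtain R0 where R0: "\<And>x. x \<in> \<Omega> \<Longrightarrow> \<bar>v x\<bar> \<le> R0" using facts(4)[OF v] by blast
    have lip: "L-lipschitz_on (closure \<Omega>) u2" using L eq(2) by (auto simp: lipschitz_on_def)
    have main: "\<exists>\<tau>1>0. \<forall>\<tau>. 0 < \<tau> \<and> \<tau> < \<tau>1 \<longrightarrow> (\<forall>x\<in>closure \<Omega>. v (shrink c \<tau> x) - d \<le> u2 x)" if d: "d > 0" for d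
    proof (rule comparison_shrink[where g=g and W=u2, OF \<Omega>(1) conv c f_cont f_nonneg f_mono f_lip facts(1)[OF v] facts(3)[OF v] R0 facts(5)[OF v] _ _ L0 _ _ d])
      show "usc_on (closure \<Omega>) (\<lambda>x. - u2 x)"
        by (intro continuous_imp_usc_on continuous_on_minus lipschitz_on_continuous_on[OF lip])
      show "det (H y) \<le> f y (u2 y) (G y)" if "C2 \<phi> G H" "y \<in> closure \<Omega>" "\<And>y'. y' \<in> closure \<Omega> \<Longrightarrow> u2 y - \<phi> y \<le> u2 y' - \<phi> y'"
        "psd (H y)" "y \<in> \<Omega> \<or> u2 y < g y" for \<phi> G H y
        by (rule supersolution_test_below[OF detp u2 that])
      have "\<forall>y\<in>frontier \<Omega>. g y \<le> u2 y" using eq(2) u_bdry fr by auto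
      then show "L-lipschitz_on \<Omega> v \<or> (L-lipschitz_on (closure \<Omega>) u2 \<and> (\<forall>y\<in>frontier \<Omega>. g y \<le> u2 y))" using lip by blast
      fix \<theta> :: real assume \<theta>: "\<theta> > 0"
      have usc: "usc_on (closure \<Omega>) (\<lambda>x. v x + - u x)"
        using v by (intro usc_on_add_continuous continuous_on_minus ucont) (simp add: viscosity_subsolution_def)
      have "\<theta> / 2 > 0" using \<theta> by simp
      then obtain \<tau>a where \<tau>a: "\<tau>a > 0" "\<forall>\<tau>. 0 < \<tau> \<and> \<tau> < \<tau>a \<longrightarrow> (\<forall>y\<in>closure \<Omega>. \<bar>u (shrink c \<tau> y) - u y\<bar> \<le> \<theta> / 2)"
        using ushrink[of "\<theta> / 2"] by blast
      \<comment> \<open>v - u is upper semicontinuous and at most 0 on the frontier; compactness of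
        the frontier makes the neighbourhood where it is below \<theta> / 2 uniform.\<close>
      have "\<exists>r>0. \<forall>x\<in>closure \<Omega>. \<forall>y\<in>frontier \<Omega>. dist x y < r \<longrightarrow> v x + - u x < \<theta> / 2"
      proof -
        have "\<exists>r>0. \<forall>x\<in>closure \<Omega>. dist x y < r \<longrightarrow> v x + - u x < \<theta> / 2" if y: "y \<in> frontier \<Omega>" for y
        proof -
          have yc: "y \<in> closure \<Omega>" and lt: "v y + - u y < \<theta> / 2" using y fr vg[OF y] \<theta> by auto
          have "\<forall>\<^sub>F x in at y within closure \<Omega>. v x + - u x < \<theta> / 2" using usc yc lt unfolding usc_on_def by blast
          then obtain r where r: "r > 0" "\<And>x. x \<in> closure \<Omega> \<Longrightarrow> x \<noteq> y \<Longrightarrow> dist x y < r \<Longrightarrow> v x + - u x < \<theta> / 2"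
            unfolding eventually_at by blast
          have "v x + - u x < \<theta> / 2" if "x \<in> closure \<Omega>" "dist x y < r" for x
            using r(2)[OF that(1) _ that(2)] lt by (cases "x = y") auto
          then show ?thesis using r(1) by blast
        qed
        then have "\<forall>y\<in>frontier \<Omega>. \<exists>r. r > 0 \<and> (\<forall>x\<in>closure \<Omega>. dist x y < r \<longrightarrow> v x + - u x < \<theta> / 2)" by blast
        from bchoice[OF this] obtain r where r: "\<And>y. y \<in> frontier \<Omega> \<Longrightarrow> r y > 0"
          "\<And>x y. y \<in> frontier \<Omega> \<Longrightarrow> x \<in> closure \<Omega> \<Longrightarrow> dist x y < r y \<Longrightarrow> v x + - u x < \<theta> / 2" by blast
        have cf: "compact (frontier \<Omega>)" using conv(2) by (rule compact_frontier_bounded)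
        have cover: "frontier \<Omega> \<subseteq> (\<Union>y\<in>frontier \<Omega>. ball y (r y))" using r(1) by force
        have "open (\<Union>y\<in>frontier \<Omega>. ball y (r y))" by (intro open_UN ballI open_ball)
        from compact_subset_open_imp_ball_epsilon_subset[OF cf this cover]
        obtain e where e: "e > 0" "(\<Union>y\<in>frontier \<Omega>. ball y e) \<subseteq> (\<Union>y\<in>frontier \<Omega>. ball y (r y))" .
        have "v x + - u x < \<theta> / 2" if "x \<in> closure \<Omega>" "y \<in> frontier \<Omega>" "dist x y < e" for x y
        proof -
          have "x \<in> (\<Union>y\<in>frontier \<Omega>. ball y e)" using that by (auto simp: dist_commute)
          then have "x \<in> (\<Union>y\<in>frontier \<Omega>. ball y (r y))" using e(2) by (rule subsetD[rotated])
          then obtain z where z: "z \<in> frontier \<Omega>" "x \<in> ball z (r z)" by (elim UN_E)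
          then show ?thesis using r(2)[OF z(1) that(1)] by (simp add: dist_commute)
        qed
        then show ?thesis using e(1) by blast
      qed
      then obtain r where r: "r > 0" "\<And>x y. x \<in> closure \<Omega> \<Longrightarrow> y \<in> frontier \<Omega> \<Longrightarrow> dist x y < r \<Longrightarrow> v x + - u x < \<theta> / 2" by blast
      show "\<exists>\<tau>0>0. \<forall>\<tau>. 0 < \<tau> \<and> \<tau> < \<tau>0 \<longrightarrow> (\<forall>y\<in>frontier \<Omega>. u2 y < v (shrink c \<tau> y) - \<theta> \<longrightarrow> u2 y < g y)"
      proof (intro exI[of _ "min (min \<tau>a 1) (r / (2 * \<rho>))"] conjI allI impI ballI)
        show "0 < min (min \<tau>a 1) (r / (2 * \<rho>))" using \<tau>a r \<rho> by simp
        fix \<tau> y assume \<tau>: "0 < \<tau> \<and> \<tau> < min (min \<tau>a 1) (r / (2 * \<rho>))" and y: "y \<in> frontier \<Omega>" and lt: "u2 y < v (shrink c \<tau> y) - \<theta>"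
        have yc: "y \<in> closure \<Omega>" using y fr by blast
        have sc: "shrink c \<tau> y \<in> closure \<Omega>" using shrink\<Omega>[OF yc] \<tau> sub by auto
        have "\<tau> < r / (2 * \<rho>)" using \<tau> by simp
        then have \<tau>2: "\<tau> * (2 * \<rho>) < r" using \<rho> by (simp add: pos_less_divide_eq)
        have "dist (shrink c \<tau> y) y = \<tau> * norm (y - c)" using \<tau> by (simp add: shrink_def dist_norm)
        also have "\<dots> \<le> \<tau> * (2 * \<rho>)"
          using norm_triangle_ineq4[of y c] \<rho>(2)[OF yc] \<rho>(2)[of c] c sub \<tau> by (intro mult_left_mono) auto
        finally have "v (shrink c \<tau> y) + - u (shrink c \<tau> y) < \<theta> / 2" using r(2)[OF sc y] \<tau>2 by simp
        moreover have "u (shrink c \<tau> y) - u y \<le> \<theta> / 2" using \<tau>a(2)[rule_format, of \<tau> y] \<tau> yc by linarith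
        \<comment> \<open>This contradicts \<open>lt\<close>: v at a contracted frontier point never
          exceeds the frontier value of u by \<theta>, so the frontier condition holds
          vacuously.\<close>
        ultimately have "v (shrink c \<tau> y) - \<theta> < u2 y" using eq(2)[OF yc] by linarith
        then show "u2 y < g y" using lt by linarith
      qed
    qed
    have "v x \<le> u2 x"
    proof (rule le_of_eventually_shrink[of v x \<Omega> c])
      show "(v \<longlongrightarrow> v x) (at x within \<Omega>)" using facts(3)[OF v] x by (simp add: continuous_on_def)
      show "shrink c \<tau> x \<in> \<Omega>" if "0 < \<tau>" "\<tau> < 1" for \<tau>
        by (rule shrink\<Omega>[OF subsetD[OF sub x] that])
      show "\<exists>\<tau>1>0. \<forall>\<tau>. 0 < \<tau> \<and> \<tau> < \<tau>1 \<longrightarrow> v (shrink c \<tau> x) - d \<le> u2 x" if d: "d > 0" for d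
      proof -
        obtain \<tau>1 where "\<tau>1 > 0" "\<forall>\<tau>. 0 < \<tau> \<and> \<tau> < \<tau>1 \<longrightarrow> (\<forall>x\<in>closure \<Omega>. v (shrink c \<tau> x) - d \<le> u2 x)"
          using main[OF d] by blast
        then show ?thesis using subsetD[OF sub x] by (intro exI[of _ \<tau>1]) simp
      qed
    qed
    then show ?thesis using eq(2)[OF subsetD[OF sub x]] by simp
  qed
  have final: "v x \<le> w x" if x: "x \<in> closure \<Omega>" for x
  proof -
    have "v x \<le> u x"
    proof (cases "x \<in> \<Omega>")
      case True
      then show ?thesis by (rule vu)
    next
      case False
      then have "x \<in> frontier \<Omega>" using x fr by blast
      then show ?thesis by (rule vg)
    qed
    also have "u x \<le> w x" by (rule uw[OF x])
    finally show ?thesis .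
  qed
  show ?thesis by (rule ballI, rule final)
next
  case True
  then show ?thesis by simp
qed

end
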